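(* Let $\mathcal C$ be a strict monoidal category with coequalizers, regarded as a 2-category with one 0-cell. A wreath (respectively cowreath) in $\mathcal C$ is the same thing as a pair $(A,X)$, where $A$ is an algebra in $\mathcal C$ and $X$ is an algebra (respectively coalgebra) in the monoidal category $\mathcal T_A^{\#}$. Consequently, for $A$ a left coflat algebra in $\mathcal C$ and $X$ a left coflat object of $\mathcal C$, $A$-ring (respectively $A$-coring) structures on $A\otimes X$, with left $A$-module structure $m_A\otimes\mathrm{Id}_X$, are in bijective correspondence with wreath (respectively cowreath) structures $(A,X)$ in $\mathcal C$.
   Context: In a 2-category $\mathcal K$, $\circ$ denotes vertical and $\odot$ horizontal composition of 2-cells, $gf$ the composite of 1-cells $f:U\to V$, $g:V\to W$, and $1_f$ the identity 2-cell of $f$. The 2-category $EM(\mathcal K)$: 0-cells are monads $(A,t,\mu_t,\eta_t)$ in $\mathcal K$. 1-cells $(A,t)\to(B,s)$ are pairs $(f,\psi)$, $f:A\to B$ a 1-cell and $\psi:sf\Rightarrow ft$ a 2-cell of $\mathcal K$ with $(1_f\odot\mu_t)\circ(\psi\odot1_t)\circ(1_s\odot\psi)=\psi\circ(\mu_s\odot1_f)$ and $\psi\circ(\eta_s\odot1_f)=1_f\odot\eta_t$. 2-cells $(f,\psi)\Rightarrow(g,\phi)$ are 2-cells $\rho:f\Rightarrow gt$ of $\mathcal K$ with $(1_g\odot\mu_t)\circ(\rho\odot1_t)\circ\psi=(1_g\odot\mu_t)\circ(\phi\odot1_t)\circ(1_s\odot\rho)$. Vertical composite of $\rho:(f,\psi)\Rightarrow(g,\phi)$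 and $\rho':(g,\phi)\Rightarrow(h,\gamma)$: $(1_h\odot\mu_t)\circ(\rho'\odot1_t)\circ\rho$. Composition of 1-cells: $(g,\phi)(f,\psi)=(gf,(1_g\odot\psi)\circ(\phi\odot1_f))$. Horizontal composite of $\rho:(f,\psi)\Rightarrow(f',\psi')$ and $\rho':(g,\phi)\Rightarrow(g',\phi')$: $(1_{g'}\odot1_{f'}\odot\mu_t)\circ(1_{g'}\odot\rho\odot1_t)\circ(1_{g'}\odot\psi)\circ(\rho'\odot1_f)$. The identity 1-cell of $(A,t)$ is $(1_A,1_t)$, and the identity 2-cell of $(f,\psi)$ is $1_f\odot\eta_t$. A wreath (resp. cowreath) in $\mathcal K$ is a monad (resp. comonad) in the 2-category $EM(\mathcal K)$. A strict monoidal category $\mathcal C$ is viewed as a 2-category with one 0-cell, 1-cells the objects and 2-cells the morphisms of $\mathcal C$, with composition of 1-cells $gf:=f\otimes g$ (and likewise $\rho'\odot\rho:=\rho\otimes\rho'$). The monoidal category $\mathcal T_A^{\#}=EM(\mathcal C)(A)$ (identity morphisms denoted by the object; $m_A,\eta_A$ the structure of $A$): objects are pairs $(X,\psi)$ with $\psi:X\otimes A\to A\otimes X$ satisfying $\psi(X\otimes m_A)=(m_A\otimes X)(A\otimes\psi)(\psi\otimes A)$ and $\psi(X\otimes\eta_A)=\eta_A\otimes X$; a morphism $(X,\psi)\to(Y,\phi)$ is $\rho:X\to A\otimes Y$ in $\mathcal C$ with $(m_A\otimes Y)(A\otimes\rho)\psi=(m_A\otimes Y)(A\otimes\phi)(\rho\otimes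 A)$; composition $\rho'\circ\rho=(m_A\otimes Z)(A\otimes\rho')\rho$, identity $\eta_A\otimes X$; $(X,\psi)\underline\otimes(Y,\phi)=(X\otimes Y,(\psi\otimes Y)(X\otimes\phi))$; for $\rho:(X,\psi)\to(X',\psi')$, $\rho':(Y,\phi)\to(Y',\phi')$, $\rho\underline\otimes\rho'=(m_A\otimes X'\otimes Y')(A\otimes\psi'\otimes Y')(\rho\otimes\rho')$; unit $(\underline 1,\mathrm{Id}_A)$. An object $X$ is left coflat if $-\otimes X$ preserves coequalizers. For $A$-modules, $M\otimes_AY$ is the coequalizer of $M\otimes A\otimes Y\rightrightarrows M\otimes Y$. A left $A$-module $Y$ is left robust if the canonical morphism $(M\otimes Z)\otimes_AY\to M\otimes(Z\otimes_AY)$ is an isomorphism for all $M\in\mathcal C$ and right $A$-modules $Z$. For $A$ left coflat, the $A$-bimodules that are left coflat and left robust form a monoidal category ${}^!_A\mathcal C_A$ under $\otimes_A$ with unit $A$; an $A$-(co)ring in $\mathcal C$ is a (co)algebra in it. An $A$-(co)ring structure on the left $A$-module $A\otimes X$ comprises the right $A$-action as well as the (co)multiplication and (co)unit. *)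

theory Defs
  imports Main
begin

section \<open>Categories and monoidal categories\<close>

record ('o, 'a) cat =
  Obj :: "'o set"
  Arr :: "'a set"
  Dom :: "'a \<Rightarrow> 'o"
  Cod :: "'a \<Rightarrow> 'o"
  Idn :: "'o \<Rightarrow> 'a"
  Cmp :: "'a \<Rightarrow> 'a \<Rightarrow> 'a" (infixr "\<cdot>\<index>" 55)

record ('o, 'a) moncat = "('o, 'a) cat" +
  TenO :: "'o \<Rightarrow> 'o \<Rightarrow> 'o" (infixr "\<otimes>\<index>" 75)
  TenA :: "'a \<Rightarrow> 'a \<Rightarrow> 'a" (infixr "\<boxtimes>\<index>" 75)
  Unit :: "'o" ("\<I>\<index>")
  Assoc :: "'o \<Rightarrow> 'o \<Rightarrow> 'o \<Rightarrow> 'a"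
  LUnit :: "'o \<Rightarrow> 'a"
  RUnit :: "'o \<Rightarrow> 'a"

definition hom :: "('o, 'a, 'x) cat_scheme \<Rightarrow> 'o \<Rightarrow> 'o \<Rightarrow> 'a set" where
  "hom C X Y = {f \<in> Arr C. Dom C f = X \<and> Cod C f = Y}"

locale category =
  fixes C :: "('o, 'a, 'x) cat_scheme" (structure)
  assumes Dom_Obj: "f \<in> Arr C \<Longrightarrow> Dom C f \<in> Obj C"
    and Cod_Obj: "f \<in> Arr C \<Longrightarrow> Cod C f \<in> Obj C"
    and Idn_hom: "X \<in> Obj C \<Longrightarrow> Idn C X \<in> hom C X X"
    and Cmp_hom: "\<lbrakk>f \<in> hom C X Y; g \<in> hom C Y Z\<rbrakk> \<Longrightarrow> g \<cdot> f \<in> hom C X Z"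
    and Cmp_Idn: "f \<in> hom C X Y \<Longrightarrow> f \<cdot> Idn C X = f"
    and Idn_Cmp: "f \<in> hom C X Y \<Longrightarrow> Idn C Y \<cdot> f = f"
    and Cmp_assoc: "\<lbrakk>f \<in> hom C W X; g \<in> hom C X Y; h \<in> hom C Y Z\<rbrakk> \<Longrightarrow> (h \<cdot> g) \<cdot> f = h \<cdot> (g \<cdot> f)"

definition is_iso :: "('o, 'a, 'x) cat_scheme \<Rightarrow> 'a \<Rightarrow> bool" where
  "is_iso C f \<longleftrightarrow> f \<in> Arr C \<and>
     (\<exists>g \<in> hom C (Cod C f) (Dom C f).
        Cmp C g f = Idn C (Dom C f) \<and> Cmp C f g = Idn C (Cod C f))"

locale monoidal_category = category C for C :: "('o, 'a) moncat" (structure) +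
  assumes Unit_Obj: "\<I> \<in> Obj C"
    and TenO_Obj: "\<lbrakk>X \<in> Obj C; Y \<in> Obj C\<rbrakk> \<Longrightarrow> X \<otimes> Y \<in> Obj C"
    and TenA_hom: "\<lbrakk>f \<in> hom C X X'; g \<in> hom C Y Y'\<rbrakk> \<Longrightarrow> f \<boxtimes> g \<in> hom C (X \<otimes> Y) (X' \<otimes> Y')"
    and TenA_Idn: "\<lbrakk>X \<in> Obj C; Y \<in> Obj C\<rbrakk> \<Longrightarrow> Idn C X \<boxtimes> Idn C Y = Idn C (X \<otimes> Y)"
    and TenA_Cmp: "\<lbrakk>f \<in> hom C X X'; f' \<in> hom C X' X''; g \<in> hom C Y Y'; g' \<in> hom C Y' Y''\<rbrakk>
          \<Longrightarrow> (f' \<cdot> f) \<boxtimes> (g' \<cdot> g) = (f' \<boxtimes> g') \<cdot> (f \<boxtimes> g)"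
    and Assoc_hom: "\<lbrakk>X \<in> Obj C; Y \<in> Obj C; Z \<in> Obj C\<rbrakk>
          \<Longrightarrow> Assoc C X Y Z \<in> hom C ((X \<otimes> Y) \<otimes> Z) (X \<otimes> (Y \<otimes> Z))"
    and Assoc_iso: "\<lbrakk>X \<in> Obj C; Y \<in> Obj C; Z \<in> Obj C\<rbrakk> \<Longrightarrow> is_iso C (Assoc C X Y Z)"
    and Assoc_nat: "\<lbrakk>f \<in> hom C X X'; g \<in> hom C Y Y'; h \<in> hom C Z Z'\<rbrakk>
          \<Longrightarrow> Assoc C X' Y' Z' \<cdot> ((f \<boxtimes> g) \<boxtimes> h) = (f \<boxtimes> (g \<boxtimes> h)) \<cdot> Assoc C X Y Z"
    and LUnit_hom: "X \<in> Obj C \<Longrightarrow> LUnit C X \<in> hom C (\<I> \<otimes> X) X"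
    and LUnit_iso: "X \<in> Obj C \<Longrightarrow> is_iso C (LUnit C X)"
    and LUnit_nat: "f \<in> hom C X Y \<Longrightarrow> LUnit C Y \<cdot> (Idn C \<I> \<boxtimes> f) = f \<cdot> LUnit C X"
    and RUnit_hom: "X \<in> Obj C \<Longrightarrow> RUnit C X \<in> hom C (X \<otimes> \<I>) X"
    and RUnit_iso: "X \<in> Obj C \<Longrightarrow> is_iso C (RUnit C X)"
    and RUnit_nat: "f \<in> hom C X Y \<Longrightarrow> RUnit C Y \<cdot> (f \<boxtimes> Idn C \<I>) = f \<cdot> RUnit C X"
    and pentagon: "\<lbrakk>W \<in> Obj C; X \<in> Obj C; Y \<in> Obj C; Z \<in> Obj C\<rbrakk>
          \<Longrightarrow> Assoc C W X (Y \<otimes> Z) \<cdot> Assoc C (W \<otimes> X) Y Z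
              = (Idn C W \<boxtimes> Assoc C X Y Z) \<cdot> Assoc C W (X \<otimes> Y) Z \<cdot> (Assoc C W X Y \<boxtimes> Idn C Z)"
    and triangle: "\<lbrakk>X \<in> Obj C; Y \<in> Obj C\<rbrakk>
          \<Longrightarrow> (Idn C X \<boxtimes> LUnit C Y) \<cdot> Assoc C X \<I> Y = RUnit C X \<boxtimes> Idn C Y"

locale strict_monoidal_category = monoidal_category +
  assumes TenO_assoc: "\<lbrakk>X \<in> Obj C; Y \<in> Obj C; Z \<in> Obj C\<rbrakk> \<Longrightarrow> (X \<otimes> Y) \<otimes> Z = X \<otimes> (Y \<otimes> Z)"
    and TenO_Unit_left: "X \<in> Obj C \<Longrightarrow> \<I> \<otimes> X = X"
    and TenO_Unit_right: "X \<in> Obj C \<Longrightarrow> X \<otimes> \<I> = X"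
    and Assoc_strict: "\<lbrakk>X \<in> Obj C; Y \<in> Obj C; Z \<in> Obj C\<rbrakk> \<Longrightarrow> Assoc C X Y Z = Idn C (X \<otimes> (Y \<otimes> Z))"
    and LUnit_strict: "X \<in> Obj C \<Longrightarrow> LUnit C X = Idn C X"
    and RUnit_strict: "X \<in> Obj C \<Longrightarrow> RUnit C X = Idn C X"

definition is_coequalizer :: "('o, 'a, 'x) cat_scheme \<Rightarrow> 'a \<Rightarrow> 'a \<Rightarrow> 'a \<Rightarrow> bool" where
  "is_coequalizer C f g q \<longleftrightarrow>
     f \<in> Arr C \<and> g \<in> Arr C \<and> q \<in> Arr C \<and>
     Dom C f = Dom C g \<and> Cod C f = Cod C g \<and> Dom C q = Cod C f \<and>
     Cmp C q f = Cmp C q g \<and>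
     (\<forall>h \<in> Arr C. Dom C h = Cod C f \<and> Cmp C h f = Cmp C h g \<longrightarrow>
        (\<exists>!k. k \<in> hom C (Cod C q) (Cod C h) \<and> Cmp C k q = h))"

definition has_coequalizers :: "('o, 'a, 'x) cat_scheme \<Rightarrow> bool" where
  "has_coequalizers C \<longleftrightarrow>
     (\<forall>f \<in> Arr C. \<forall>g \<in> Arr C. Dom C f = Dom C g \<and> Cod C f = Cod C g \<longrightarrow>
        (\<exists>q. is_coequalizer C f g q))"

definition coequalizer :: "('o, 'a, 'x) cat_scheme \<Rightarrow> 'a \<Rightarrow> 'a \<Rightarrow> 'a" where
  "coequalizer C f g = (SOME q. is_coequalizer C f g q)"

text \<open>The arrow \<open>k\<close> with \<open>k \<cdot> q = h\<close>; only used where it exists uniquely.\<close>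
definition factor :: "('o, 'a, 'x) cat_scheme \<Rightarrow> 'a \<Rightarrow> 'a \<Rightarrow> 'a" where
  "factor C q h = (THE k. k \<in> hom C (Cod C q) (Cod C h) \<and> Cmp C k q = h)"

section \<open>Algebras and coalgebras\<close>

context fixes C :: "('o, 'a) moncat" (structure) begin

fun algebra_in :: "'o \<times> 'a \<times> 'a \<Rightarrow> bool" where
  "algebra_in (X, m, u) \<longleftrightarrow>
     X \<in> Obj C \<and> m \<in> hom C (X \<otimes> X) X \<and> u \<in> hom C \<I> X \<and>
     m \<cdot> (m \<boxtimes> Idn C X) = m \<cdot> (Idn C X \<boxtimes> m) \<cdot> Assoc C X X X \<and>
     m \<cdot> (u \<boxtimes> Idn C X) = LUnit C X \<and>
     m \<cdot> (Idn C X \<boxtimes> u) = RUnit C X"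

fun coalgebra_in :: "'o \<times> 'a \<times> 'a \<Rightarrow> bool" where
  "coalgebra_in (X, \<delta>, \<epsilon>) \<longleftrightarrow>
     X \<in> Obj C \<and> \<delta> \<in> hom C X (X \<otimes> X) \<and> \<epsilon> \<in> hom C X \<I> \<and>
     Assoc C X X X \<cdot> (\<delta> \<boxtimes> Idn C X) \<cdot> \<delta> = (Idn C X \<boxtimes> \<delta>) \<cdot> \<delta> \<and>
     LUnit C X \<cdot> (\<epsilon> \<boxtimes> Idn C X) \<cdot> \<delta> = Idn C X \<and>
     RUnit C X \<cdot> (Idn C X \<boxtimes> \<epsilon>) \<cdot> \<delta> = Idn C X"

end

section \<open>Strict 2-categories, monads and comonads\<close>

text \<open>Both compositions are written in applicative order: \<open>g \<star> f\<close> is the composite \<open>gf\<close> of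
  \<open>f : U \<rightarrow> V\<close> and \<open>g : V \<rightarrow> W\<close>. Vertical composition of 2-cells is \<open>\<bullet>\<close>, horizontal
  composition is \<open>\<odot>\<close>.\<close>

record ('p, 'f, 'c) twocat =
  Cell0 :: "'p set"
  Cell1 :: "'f set"
  Cell2 :: "'c set"
  Src :: "'f \<Rightarrow> 'p"
  Tgt :: "'f \<Rightarrow> 'p"
  Dom2 :: "'c \<Rightarrow> 'f"
  Cod2 :: "'c \<Rightarrow> 'f"
  Id1 :: "'p \<Rightarrow> 'f"
  Cmp1 :: "'f \<Rightarrow> 'f \<Rightarrow> 'f" (infixr "\<star>\<index>" 75)
  Id2 :: "'f \<Rightarrow> 'c"
  VCmp :: "'c \<Rightarrow> 'c \<Rightarrow> 'c" (infixr "\<bullet>\<index>" 55)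
  HCmp :: "'c \<Rightarrow> 'c \<Rightarrow> 'c" (infixr "\<odot>\<index>" 75)

definition hom1 :: "('p, 'f, 'c) twocat \<Rightarrow> 'p \<Rightarrow> 'p \<Rightarrow> 'f set" where
  "hom1 K U V = {f \<in> Cell1 K. Src K f = U \<and> Tgt K f = V}"

definition hom2 :: "('p, 'f, 'c) twocat \<Rightarrow> 'f \<Rightarrow> 'f \<Rightarrow> 'c set" where
  "hom2 K f g = {\<alpha> \<in> Cell2 K. Dom2 K \<alpha> = f \<and> Cod2 K \<alpha> = g}"

locale two_category =
  fixes K :: "('p, 'f, 'c) twocat" (structure)
  assumes Src_Cell0: "f \<in> Cell1 K \<Longrightarrow> Src K f \<in> Cell0 K"
    and Tgt_Cell0: "f \<in> Cell1 K \<Longrightarrow> Tgt K f \<in> Cell0 K"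
    and Dom2_Cell1: "\<alpha> \<in> Cell2 K \<Longrightarrow> Dom2 K \<alpha> \<in> Cell1 K"
    and Cod2_Cell1: "\<alpha> \<in> Cell2 K \<Longrightarrow> Cod2 K \<alpha> \<in> Cell1 K"
    and globular_Src: "\<alpha> \<in> Cell2 K \<Longrightarrow> Src K (Dom2 K \<alpha>) = Src K (Cod2 K \<alpha>)"
    and globular_Tgt: "\<alpha> \<in> Cell2 K \<Longrightarrow> Tgt K (Dom2 K \<alpha>) = Tgt K (Cod2 K \<alpha>)"
    and Id1_hom1: "U \<in> Cell0 K \<Longrightarrow> Id1 K U \<in> hom1 K U U"
    and Cmp1_hom1: "\<lbrakk>f \<in> hom1 K U V; g \<in> hom1 K V W\<rbrakk> \<Longrightarrow> g \<star> f \<in> hom1 K U W"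
    and Cmp1_Id1: "f \<in> hom1 K U V \<Longrightarrow> f \<star> Id1 K U = f"
    and Id1_Cmp1: "f \<in> hom1 K U V \<Longrightarrow> Id1 K V \<star> f = f"
    and Cmp1_assoc: "\<lbrakk>f \<in> hom1 K U V; g \<in> hom1 K V W; h \<in> hom1 K W Z\<rbrakk>
          \<Longrightarrow> (h \<star> g) \<star> f = h \<star> (g \<star> f)"
    and Id2_hom2: "f \<in> Cell1 K \<Longrightarrow> Id2 K f \<in> hom2 K f f"
    and VCmp_hom2: "\<lbrakk>\<alpha> \<in> hom2 K f g; \<beta> \<in> hom2 K g h\<rbrakk> \<Longrightarrow> \<beta> \<bullet> \<alpha> \<in> hom2 K f h"
    and VCmp_Id2: "\<alpha> \<in> hom2 K f g \<Longrightarrow> \<alpha> \<bullet> Id2 K f = \<alpha>"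
    and Id2_VCmp: "\<alpha> \<in> hom2 K f g \<Longrightarrow> Id2 K g \<bullet> \<alpha> = \<alpha>"
    and VCmp_assoc: "\<lbrakk>\<alpha> \<in> hom2 K f g; \<beta> \<in> hom2 K g h; \<gamma> \<in> hom2 K h k\<rbrakk>
          \<Longrightarrow> (\<gamma> \<bullet> \<beta>) \<bullet> \<alpha> = \<gamma> \<bullet> (\<beta> \<bullet> \<alpha>)"
    and HCmp_hom2: "\<lbrakk>f \<in> hom1 K U V; g \<in> hom1 K V W; \<alpha> \<in> hom2 K f f'; \<beta> \<in> hom2 K g g'\<rbrakk>
          \<Longrightarrow> \<beta> \<odot> \<alpha> \<in> hom2 K (g \<star> f) (g' \<star> f')"
    and HCmp_Id2: "\<lbrakk>f \<in> hom1 K U V; g \<in> hom1 K V W\<rbrakk> \<Longrightarrow> Id2 K g \<odot> Id2 K f = Id2 K (g \<star> f)"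
    and interchange: "\<lbrakk>f \<in> hom1 K U V; g \<in> hom1 K V W; \<alpha> \<in> hom2 K f f'; \<alpha>' \<in> hom2 K f' f'';
             \<beta> \<in> hom2 K g g'; \<beta>' \<in> hom2 K g' g''\<rbrakk>
          \<Longrightarrow> (\<beta>' \<bullet> \<beta>) \<odot> (\<alpha>' \<bullet> \<alpha>) = (\<beta>' \<odot> \<alpha>') \<bullet> (\<beta> \<odot> \<alpha>)"
    and HCmp_Id1: "\<lbrakk>f \<in> hom1 K U V; \<alpha> \<in> hom2 K f f'\<rbrakk> \<Longrightarrow> \<alpha> \<odot> Id2 K (Id1 K U) = \<alpha>"
    and Id1_HCmp: "\<lbrakk>f \<in> hom1 K U V; \<alpha> \<in> hom2 K f f'\<rbrakk> \<Longrightarrow> Id2 K (Id1 K V) \<odot> \<alpha> = \<alpha>"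
    and HCmp_assoc: "\<lbrakk>f \<in> hom1 K U V; g \<in> hom1 K V W; h \<in> hom1 K W Z;
             \<alpha> \<in> hom2 K f f'; \<beta> \<in> hom2 K g g'; \<gamma> \<in> hom2 K h h'\<rbrakk>
          \<Longrightarrow> (\<gamma> \<odot> \<beta>) \<odot> \<alpha> = \<gamma> \<odot> (\<beta> \<odot> \<alpha>)"

type_synonym ('p, 'f, 'c) monad = "'p \<times> 'f \<times> 'c \<times> 'c"

context fixes K :: "('p, 'f, 'c) twocat" (structure) begin

fun monad_in :: "('p, 'f, 'c) monad \<Rightarrow> bool" where
  "monad_in (A, t, \<mu>, \<eta>) \<longleftrightarrow>
     A \<in> Cell0 K \<and> t \<in> hom1 K A A \<and> \<mu> \<in> hom2 K (t \<star> t) t \<and> \<eta> \<in> hom2 K (Id1 K A) t \<and>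
     \<mu> \<bullet> (\<mu> \<odot> Id2 K t) = \<mu> \<bullet> (Id2 K t \<odot> \<mu>) \<and>
     \<mu> \<bullet> (\<eta> \<odot> Id2 K t) = Id2 K t \<and>
     \<mu> \<bullet> (Id2 K t \<odot> \<eta>) = Id2 K t"

fun comonad_in :: "('p, 'f, 'c) monad \<Rightarrow> bool" where
  "comonad_in (A, t, \<delta>, \<epsilon>) \<longleftrightarrow>
     A \<in> Cell0 K \<and> t \<in> hom1 K A A \<and> \<delta> \<in> hom2 K t (t \<star> t) \<and> \<epsilon> \<in> hom2 K t (Id1 K A) \<and>
     (\<delta> \<odot> Id2 K t) \<bullet> \<delta> = (Id2 K t \<odot> \<delta>) \<bullet> \<delta> \<and>
     (\<epsilon> \<odot> Id2 K t) \<bullet> \<delta> = Id2 K t \<and>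
     (Id2 K t \<odot> \<epsilon>) \<bullet> \<delta> = Id2 K t"

end

section \<open>The 2-category \<open>EM(K)\<close>\<close>

text \<open>1-cells and 2-cells are stored together with their source and target, since the data
  \<open>(f, \<psi>)\<close> and \<open>\<rho>\<close> alone do not determine them.\<close>

type_synonym ('p, 'f, 'c) em1 = "('p, 'f, 'c) monad \<times> ('f \<times> 'c) \<times> ('p, 'f, 'c) monad"
type_synonym ('p, 'f, 'c) em2 = "('p, 'f, 'c) em1 \<times> 'c \<times> ('p, 'f, 'c) em1"

context fixes K :: "('p, 'f, 'c) twocat" (structure) begin

fun em_cell1 :: "('p, 'f, 'c) em1 \<Rightarrow> bool" where
  "em_cell1 ((A, t, \<mu>t, \<eta>t), (f, \<psi>), (B, s, \<mu>s, \<eta>s)) \<longleftrightarrow>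
     monad_in K (A, t, \<mu>t, \<eta>t) \<and> monad_in K (B, s, \<mu>s, \<eta>s) \<and>
     f \<in> hom1 K A B \<and> \<psi> \<in> hom2 K (s \<star> f) (f \<star> t) \<and>
     (Id2 K f \<odot> \<mu>t) \<bullet> (\<psi> \<odot> Id2 K t) \<bullet> (Id2 K s \<odot> \<psi>) = \<psi> \<bullet> (\<mu>s \<odot> Id2 K f) \<and>
     \<psi> \<bullet> (\<eta>s \<odot> Id2 K f) = Id2 K f \<odot> \<eta>t"

fun em_cell2 :: "('p, 'f, 'c) em2 \<Rightarrow> bool" where
  "em_cell2 ((S, (f, \<psi>), T), \<rho>, (S', (g, \<phi>), T')) \<longleftrightarrow>
     em_cell1 (S, (f, \<psi>), T) \<and> em_cell1 (S', (g, \<phi>), T') \<and> S = S' \<and> T = T' \<and>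
     (case (S, T) of ((A, t, \<mu>t, \<eta>t), (B, s, \<mu>s, \<eta>s)) \<Rightarrow>
        \<rho> \<in> hom2 K f (g \<star> t) \<and>
        (Id2 K g \<odot> \<mu>t) \<bullet> (\<rho> \<odot> Id2 K t) \<bullet> \<psi> = (Id2 K g \<odot> \<mu>t) \<bullet> (\<phi> \<odot> Id2 K t) \<bullet> (Id2 K s \<odot> \<rho>))"

fun em_Id1 :: "('p, 'f, 'c) monad \<Rightarrow> ('p, 'f, 'c) em1" where
  "em_Id1 (A, t, \<mu>, \<eta>) = ((A, t, \<mu>, \<eta>), (Id1 K A, Id2 K t), (A, t, \<mu>, \<eta>))"

fun em_Cmp1 :: "('p, 'f, 'c) em1 \<Rightarrow> ('p, 'f, 'c) em1 \<Rightarrow> ('p, 'f, 'c) em1" where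
  "em_Cmp1 (S', (g, \<phi>), T') (S, (f, \<psi>), T) =
     (S, (g \<star> f, (Id2 K g \<odot> \<psi>) \<bullet> (\<phi> \<odot> Id2 K f)), T')"

fun em_Id2 :: "('p, 'f, 'c) em1 \<Rightarrow> ('p, 'f, 'c) em2" where
  "em_Id2 ((A, t, \<mu>, \<eta>), (f, \<psi>), T) =
     (((A, t, \<mu>, \<eta>), (f, \<psi>), T), Id2 K f \<odot> \<eta>, ((A, t, \<mu>, \<eta>), (f, \<psi>), T))"

fun em_VCmp :: "('p, 'f, 'c) em2 \<Rightarrow> ('p, 'f, 'c) em2 \<Rightarrow> ('p, 'f, 'c) em2" where
  "em_VCmp (G, \<rho>', ((A, t, \<mu>, \<eta>), (h, \<gamma>), T)) (F, \<rho>, G') =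
     (F, (Id2 K h \<odot> \<mu>) \<bullet> (\<rho>' \<odot> Id2 K t) \<bullet> \<rho>, ((A, t, \<mu>, \<eta>), (h, \<gamma>), T))"

fun em_HCmp :: "('p, 'f, 'c) em2 \<Rightarrow> ('p, 'f, 'c) em2 \<Rightarrow> ('p, 'f, 'c) em2" where
  "em_HCmp (G, \<rho>', (R', (g', \<phi>'), U')) (((A, t, \<mu>, \<eta>), (f, \<psi>), T), \<rho>, (S', (f', \<psi>'), T')) =
     (em_Cmp1 G ((A, t, \<mu>, \<eta>), (f, \<psi>), T),
      (Id2 K g' \<odot> Id2 K f' \<odot> \<mu>) \<bullet> (Id2 K g' \<odot> \<rho> \<odot> Id2 K t) \<bullet> (Id2 K g' \<odot> \<psi>) \<bullet> (\<rho>' \<odot> Id2 K f),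
      em_Cmp1 (R', (g', \<phi>'), U') (S', (f', \<psi>'), T'))"

end

definition EM :: "('p, 'f, 'c) twocat
    \<Rightarrow> (('p, 'f, 'c) monad, ('p, 'f, 'c) em1, ('p, 'f, 'c) em2) twocat" where
  "EM K =
    \<lparr> Cell0 = {M. monad_in K M},
      Cell1 = {F. em_cell1 K F},
      Cell2 = {\<rho>. em_cell2 K \<rho>},
      Src = fst,
      Tgt = (\<lambda>F. snd (snd F)),
      Dom2 = fst,
      Cod2 = (\<lambda>\<rho>. snd (snd \<rho>)),
      Id1 = em_Id1 K,
      Cmp1 = em_Cmp1 K,
      Id2 = em_Id2 K,
      VCmp = em_VCmp K,
      HCmp = em_HCmp K \<rparr>"

definition wreath :: "('p, 'f, 'c) twocat
    \<Rightarrow> (('p, 'f, 'c) monad, ('p, 'f, 'c) em1, ('p, 'f, 'c) em2) monad \<Rightarrow> bool" where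
  "wreath K W \<longleftrightarrow> monad_in (EM K) W"

definition cowreath :: "('p, 'f, 'c) twocat
    \<Rightarrow> (('p, 'f, 'c) monad, ('p, 'f, 'c) em1, ('p, 'f, 'c) em2) monad \<Rightarrow> bool" where
  "cowreath K W \<longleftrightarrow> comonad_in (EM K) W"

section \<open>A strict monoidal category as a 2-category with one 0-cell\<close>

text \<open>Composition reverses the tensor product: \<open>gf := f \<otimes> g\<close> and \<open>\<rho>' \<odot> \<rho> := \<rho> \<otimes> \<rho>'\<close>.\<close>

definition one_object :: "('o, 'a) moncat \<Rightarrow> (unit, 'o, 'a) twocat" where
  "one_object C =
    \<lparr> Cell0 = {()},
      Cell1 = Obj C,
      Cell2 = Arr C,
      Src = (\<lambda>_. ()),
      Tgt = (\<lambda>_. ()),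
      Dom2 = Dom C,
      Cod2 = Cod C,
      Id1 = (\<lambda>_. Unit C),
      Cmp1 = (\<lambda>g f. TenO C f g),
      Id2 = Idn C,
      VCmp = Cmp C,
      HCmp = (\<lambda>\<rho>' \<rho>. TenA C \<rho> \<rho>') \<rparr>"

lemma (in strict_monoidal_category) TenA_assoc:
  assumes "f \<in> hom C X X'" "g \<in> hom C Y Y'" "h \<in> hom C Z Z'"
  shows "(f \<boxtimes> g) \<boxtimes> h = f \<boxtimes> (g \<boxtimes> h)"
proof -
  have objs: "X \<in> Obj C" "X' \<in> Obj C" "Y \<in> Obj C" "Y' \<in> Obj C" "Z \<in> Obj C" "Z' \<in> Obj C"
    using assms Dom_Obj Cod_Obj by (auto simp: hom_def)
  have l: "(f \<boxtimes> g) \<boxtimes> h \<in> hom C (X \<otimes> (Y \<otimes> Z)) (X' \<otimes> (Y' \<otimes> Z'))"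
    using TenA_hom[OF TenA_hom[OF assms(1,2)] assms(3)] objs by (simp add: TenO_assoc)
  have r: "f \<boxtimes> (g \<boxtimes> h) \<in> hom C (X \<otimes> (Y \<otimes> Z)) (X' \<otimes> (Y' \<otimes> Z'))"
    using TenA_hom[OF assms(1) TenA_hom[OF assms(2,3)]] .
  show ?thesis
    using Assoc_nat[OF assms] objs Idn_Cmp[OF l] Cmp_Idn[OF r] by (simp add: Assoc_strict)
qed

lemma (in strict_monoidal_category) TenA_Unit:
  assumes f: "f \<in> hom C X Y"
  shows "Idn C \<I> \<boxtimes> f = f" and "f \<boxtimes> Idn C \<I> = f"
proof -
  have objs: "X \<in> Obj C" "Y \<in> Obj C"
    using f Dom_Obj Cod_Obj by (auto simp: hom_def)
  have l: "Idn C \<I> \<boxtimes> f \<in> hom C X Y"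
    using TenA_hom[OF Idn_hom[OF Unit_Obj] f] objs by (simp add: TenO_Unit_left)
  have r: "f \<boxtimes> Idn C \<I> \<in> hom C X Y"
    using TenA_hom[OF f Idn_hom[OF Unit_Obj]] objs by (simp add: TenO_Unit_right)
  show "Idn C \<I> \<boxtimes> f = f"
    using LUnit_nat[OF f] objs Idn_Cmp[OF l] Cmp_Idn[OF f] by (simp add: LUnit_strict)
  show "f \<boxtimes> Idn C \<I> = f"
    using RUnit_nat[OF f] objs Idn_Cmp[OF r] Cmp_Idn[OF f] by (simp add: RUnit_strict)
qed

theorem (in strict_monoidal_category) two_category_one_object: "two_category (one_object C)"
proof -
  have h1: "hom1 (one_object C) U V = Obj C" for U V
    by (simp add: hom1_def one_object_def)
  have h2: "hom2 (one_object C) = hom C"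
    by (intro ext) (simp add: hom2_def hom_def one_object_def)
  have s: "Cell1 (one_object C) = Obj C" "Cell2 (one_object C) = Arr C"
      "Dom2 (one_object C) = Dom C" "Cod2 (one_object C) = Cod C"
      "Id1 (one_object C) U = \<I>" "Cmp1 (one_object C) g f = f \<otimes> g"
      "Id2 (one_object C) = Idn C" "VCmp (one_object C) = Cmp C"
      "HCmp (one_object C) \<beta> \<alpha> = \<alpha> \<boxtimes> \<beta>" for U f g \<alpha> \<beta>
    by (simp_all add: one_object_def)
  show ?thesis
    apply (unfold_locales; (simp only: h1 h2 s)?)
    apply (auto simp: one_object_def Dom_Obj Cod_Obj Unit_Obj TenO_Obj TenO_assoc TenO_Unit_left
        TenO_Unit_right TenA_hom TenA_Idn Idn_hom
        intro: Cmp_hom Cmp_Idn Idn_Cmp Cmp_assoc TenA_Cmp TenA_Unit)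
    by (metis TenA_assoc)
qed

section \<open>The monoidal category \<open>T\<^sub>A\<^sup>#\<close>\<close>

text \<open>An arrow \<open>(X, \<psi>) \<rightarrow> (Y, \<phi>)\<close> is stored as the triple \<open>((X, \<psi>), \<rho>, (Y, \<phi>))\<close>.\<close>

context fixes C :: "('o, 'a) moncat" (structure) begin

fun sharp_obj :: "'o \<times> 'a \<times> 'a \<Rightarrow> 'o \<times> 'a \<Rightarrow> bool" where
  "sharp_obj (A, m, u) (X, \<psi>) \<longleftrightarrow>
     X \<in> Obj C \<and> \<psi> \<in> hom C (X \<otimes> A) (A \<otimes> X) \<and>
     \<psi> \<cdot> (Idn C X \<boxtimes> m) = (m \<boxtimes> Idn C X) \<cdot> (Idn C A \<boxtimes> \<psi>) \<cdot> (\<psi> \<boxtimes> Idn C A) \<and>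
     \<psi> \<cdot> (Idn C X \<boxtimes> u) = u \<boxtimes> Idn C X"

fun sharp_arr :: "'o \<times> 'a \<times> 'a \<Rightarrow> ('o \<times> 'a) \<times> 'a \<times> ('o \<times> 'a) \<Rightarrow> bool" where
  "sharp_arr (A, m, u) ((X, \<psi>), \<rho>, (Y, \<phi>)) \<longleftrightarrow>
     sharp_obj (A, m, u) (X, \<psi>) \<and> sharp_obj (A, m, u) (Y, \<phi>) \<and> \<rho> \<in> hom C X (A \<otimes> Y) \<and>
     (m \<boxtimes> Idn C Y) \<cdot> (Idn C A \<boxtimes> \<rho>) \<cdot> \<psi> = (m \<boxtimes> Idn C Y) \<cdot> (Idn C A \<boxtimes> \<phi>) \<cdot> (\<rho> \<boxtimes> Idn C A)"

fun sharp_Idn :: "'o \<times> 'a \<times> 'a \<Rightarrow> 'o \<times> 'a \<Rightarrow> ('o \<times> 'a) \<times> 'a \<times> ('o \<times> 'a)" where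
  "sharp_Idn (A, m, u) (X, \<psi>) = ((X, \<psi>), u \<boxtimes> Idn C X, (X, \<psi>))"

fun sharp_Cmp :: "'o \<times> 'a \<times> 'a \<Rightarrow> ('o \<times> 'a) \<times> 'a \<times> ('o \<times> 'a)
    \<Rightarrow> ('o \<times> 'a) \<times> 'a \<times> ('o \<times> 'a) \<Rightarrow> ('o \<times> 'a) \<times> 'a \<times> ('o \<times> 'a)" where
  "sharp_Cmp (A, m, u) (Q, \<rho>', (Z, \<gamma>)) (P, \<rho>, Q') =
     (P, (m \<boxtimes> Idn C Z) \<cdot> (Idn C A \<boxtimes> \<rho>') \<cdot> \<rho>, (Z, \<gamma>))"

fun sharp_TenO :: "'o \<times> 'a \<Rightarrow> 'o \<times> 'a \<Rightarrow> 'o \<times> 'a" where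
  "sharp_TenO (X, \<psi>) (Y, \<phi>) = (X \<otimes> Y, (\<psi> \<boxtimes> Idn C Y) \<cdot> (Idn C X \<boxtimes> \<phi>))"

fun sharp_TenA :: "'o \<times> 'a \<times> 'a \<Rightarrow> ('o \<times> 'a) \<times> 'a \<times> ('o \<times> 'a)
    \<Rightarrow> ('o \<times> 'a) \<times> 'a \<times> ('o \<times> 'a) \<Rightarrow> ('o \<times> 'a) \<times> 'a \<times> ('o \<times> 'a)" where
  "sharp_TenA (A, m, u) (P, \<rho>, (X', \<psi>')) (Q, \<rho>', (Y', \<phi>')) =
     (sharp_TenO P Q,
      (m \<boxtimes> Idn C X' \<boxtimes> Idn C Y') \<cdot> (Idn C A \<boxtimes> \<psi>' \<boxtimes> Idn C Y') \<cdot> (\<rho> \<boxtimes> \<rho>'),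
      sharp_TenO (X', \<psi>') (Y', \<phi>'))"

definition sharp :: "'o \<times> 'a \<times> 'a \<Rightarrow> ('o \<times> 'a, ('o \<times> 'a) \<times> 'a \<times> ('o \<times> 'a)) moncat" where
  "sharp \<A> =
    \<lparr> Obj = {P. sharp_obj \<A> P},
      Arr = {\<rho>. sharp_arr \<A> \<rho>},
      Dom = fst,
      Cod = (\<lambda>\<rho>. snd (snd \<rho>)),
      Idn = sharp_Idn \<A>,
      Cmp = sharp_Cmp \<A>,
      TenO = sharp_TenO,
      TenA = sharp_TenA \<A>,
      Unit = (\<I>, Idn C (fst \<A>)),
      Assoc = (\<lambda>P Q R. sharp_Idn \<A> (sharp_TenO P (sharp_TenO Q R))),
      LUnit = sharp_Idn \<A>,
      RUnit = sharp_Idn \<A> \<rparr>"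

end

section \<open>Modules and bimodules over an algebra\<close>

context fixes C :: "('o, 'a) moncat" (structure) begin

definition left_coflat :: "'o \<Rightarrow> bool" where
  "left_coflat X \<longleftrightarrow> X \<in> Obj C \<and>
     (\<forall>f g q. is_coequalizer C f g q \<longrightarrow>
        is_coequalizer C (f \<boxtimes> Idn C X) (g \<boxtimes> Idn C X) (q \<boxtimes> Idn C X))"

fun left_module :: "'o \<times> 'a \<times> 'a \<Rightarrow> 'o \<times> 'a \<Rightarrow> bool" where
  "left_module (A, m, u) (Y, l) \<longleftrightarrow>
     Y \<in> Obj C \<and> l \<in> hom C (A \<otimes> Y) Y \<and>
     l \<cdot> (m \<boxtimes> Idn C Y) = l \<cdot> (Idn C A \<boxtimes> l) \<and> l \<cdot> (u \<boxtimes> Idn C Y) = Idn C Y"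

fun right_module :: "'o \<times> 'a \<times> 'a \<Rightarrow> 'o \<times> 'a \<Rightarrow> bool" where
  "right_module (A, m, u) (Z, r) \<longleftrightarrow>
     Z \<in> Obj C \<and> r \<in> hom C (Z \<otimes> A) Z \<and>
     r \<cdot> (Idn C Z \<boxtimes> m) = r \<cdot> (r \<boxtimes> Idn C A) \<and> r \<cdot> (Idn C Z \<boxtimes> u) = Idn C Z"

text \<open>The projection \<open>Z \<otimes> Y \<rightarrow> Z \<otimes>\<^sub>A Y\<close> of a right module \<open>(Z, r)\<close> and a left module \<open>(Y, l)\<close>;
  the object \<open>Z \<otimes>\<^sub>A Y\<close> is its codomain.\<close>
fun tensor_proj :: "'o \<times> 'a \<Rightarrow> 'o \<times> 'a \<Rightarrow> 'a" where
  "tensor_proj (Z, r) (Y, l) = coequalizer C (r \<boxtimes> Idn C Y) (Idn C Z \<boxtimes> l)"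

text \<open>The second clause says that the canonical arrow \<open>(M \<otimes> Z) \<otimes>\<^sub>A Y \<rightarrow> M \<otimes> (Z \<otimes>\<^sub>A Y)\<close> is invertible.\<close>
definition left_robust :: "'o \<times> 'a \<times> 'a \<Rightarrow> 'o \<times> 'a \<Rightarrow> bool" where
  "left_robust \<A> Y \<longleftrightarrow> left_module \<A> Y \<and>
     (\<forall>M Z r. M \<in> Obj C \<and> right_module \<A> (Z, r) \<longrightarrow>
        is_iso C (factor C (tensor_proj (M \<otimes> Z, Idn C M \<boxtimes> r) Y)
                           (Idn C M \<boxtimes> tensor_proj (Z, r) Y)))"

end

section \<open>The monoidal category of left coflat, left robust bimodules\<close>

text \<open>A bimodule is a triple \<open>(X, l, r)\<close> of an object with its left and right action. All
  structure arrows below are determined by their composite with the projections onto \<open>\<otimes>\<^sub>A\<close>.\<close>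

type_synonym ('o, 'a) bimod = "'o \<times> 'a \<times> 'a"

context fixes C :: "('o, 'a) moncat" (structure) begin

fun bimodule :: "'o \<times> 'a \<times> 'a \<Rightarrow> ('o, 'a) bimod \<Rightarrow> bool" where
  "bimodule (A, m, u) (X, l, r) \<longleftrightarrow>
     left_module C (A, m, u) (X, l) \<and> right_module C (A, m, u) (X, r) \<and>
     r \<cdot> (l \<boxtimes> Idn C A) = l \<cdot> (Idn C A \<boxtimes> r)"

fun bimod_obj :: "'o \<times> 'a \<times> 'a \<Rightarrow> ('o, 'a) bimod \<Rightarrow> bool" where
  "bimod_obj \<A> (X, l, r) \<longleftrightarrow>
     bimodule \<A> (X, l, r) \<and> left_coflat C X \<and> left_robust C \<A> (X, l)"

fun bimod_arr :: "'o \<times> 'a \<times> 'a \<Rightarrow> ('o, 'a) bimod \<times> 'a \<times> ('o, 'a) bimod \<Rightarrow> bool" where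
  "bimod_arr (A, m, u) ((X, l, r), f, (X', l', r')) \<longleftrightarrow>
     bimod_obj (A, m, u) (X, l, r) \<and> bimod_obj (A, m, u) (X', l', r') \<and> f \<in> hom C X X' \<and>
     f \<cdot> l = l' \<cdot> (Idn C A \<boxtimes> f) \<and> f \<cdot> r = r' \<cdot> (f \<boxtimes> Idn C A)"

fun bimod_proj :: "('o, 'a) bimod \<Rightarrow> ('o, 'a) bimod \<Rightarrow> 'a" where
  "bimod_proj (X, l, r) (Y, l', r') = tensor_proj C (X, r) (Y, l')"

fun bimod_TenO :: "'o \<times> 'a \<times> 'a \<Rightarrow> ('o, 'a) bimod \<Rightarrow> ('o, 'a) bimod \<Rightarrow> ('o, 'a) bimod" where
  "bimod_TenO (A, m, u) (X, l, r) (Y, l', r') =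
     (let q = bimod_proj (X, l, r) (Y, l', r') in
       (Cod C q,
        factor C (Idn C A \<boxtimes> q) (q \<cdot> (l \<boxtimes> Idn C Y)),
        factor C (q \<boxtimes> Idn C A) (q \<cdot> (Idn C X \<boxtimes> r'))))"

fun bimod_TenA :: "'o \<times> 'a \<times> 'a \<Rightarrow> ('o, 'a) bimod \<times> 'a \<times> ('o, 'a) bimod
    \<Rightarrow> ('o, 'a) bimod \<times> 'a \<times> ('o, 'a) bimod \<Rightarrow> ('o, 'a) bimod \<times> 'a \<times> ('o, 'a) bimod" where
  "bimod_TenA \<A> (X, f, X') (Y, g, Y') =
     (bimod_TenO \<A> X Y,
      factor C (bimod_proj X Y) (bimod_proj X' Y' \<cdot> (f \<boxtimes> g)),
      bimod_TenO \<A> X' Y')"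

definition bimod_Assoc :: "'o \<times> 'a \<times> 'a \<Rightarrow> ('o, 'a) bimod \<Rightarrow> ('o, 'a) bimod \<Rightarrow> ('o, 'a) bimod
    \<Rightarrow> ('o, 'a) bimod \<times> 'a \<times> ('o, 'a) bimod" where
  "bimod_Assoc \<A> X Y Z =
     (let XY = bimod_TenO \<A> X Y; YZ = bimod_TenO \<A> Y Z in
       (bimod_TenO \<A> XY Z,
        factor C (bimod_proj XY Z \<cdot> (bimod_proj X Y \<boxtimes> Idn C (fst Z)))
                 (bimod_proj X YZ \<cdot> (Idn C (fst X) \<boxtimes> bimod_proj Y Z)),
        bimod_TenO \<A> X YZ))"

fun bimod_LUnit :: "'o \<times> 'a \<times> 'a \<Rightarrow> ('o, 'a) bimod \<Rightarrow> ('o, 'a) bimod \<times> 'a \<times> ('o, 'a) bimod" where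
  "bimod_LUnit (A, m, u) (X, l, r) =
     (bimod_TenO (A, m, u) (A, m, m) (X, l, r), factor C (bimod_proj (A, m, m) (X, l, r)) l, (X, l, r))"

fun bimod_RUnit :: "'o \<times> 'a \<times> 'a \<Rightarrow> ('o, 'a) bimod \<Rightarrow> ('o, 'a) bimod \<times> 'a \<times> ('o, 'a) bimod" where
  "bimod_RUnit (A, m, u) (X, l, r) =
     (bimod_TenO (A, m, u) (X, l, r) (A, m, m), factor C (bimod_proj (X, l, r) (A, m, m)) r, (X, l, r))"

fun regular_bimod :: "'o \<times> 'a \<times> 'a \<Rightarrow> ('o, 'a) bimod" where
  "regular_bimod (A, m, u) = (A, m, m)"

definition bimod_cat :: "'o \<times> 'a \<times> 'a
    \<Rightarrow> (('o, 'a) bimod, ('o, 'a) bimod \<times> 'a \<times> ('o, 'a) bimod) moncat" where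
  "bimod_cat \<A> =
    \<lparr> Obj = {X. bimod_obj \<A> X},
      Arr = {f. bimod_arr \<A> f},
      Dom = fst,
      Cod = (\<lambda>f. snd (snd f)),
      Idn = (\<lambda>X. (X, Idn C (fst X), X)),
      Cmp = (\<lambda>(Y, g, Z) (X, f, Y'). (X, g \<cdot> f, Z)),
      TenO = bimod_TenO \<A>,
      TenA = bimod_TenA \<A>,
      Unit = regular_bimod \<A>,
      Assoc = bimod_Assoc \<A>,
      LUnit = bimod_LUnit \<A>,
      RUnit = bimod_RUnit \<A> \<rparr>"

definition A_ring :: "'o \<times> 'a \<times> 'a
    \<Rightarrow> ('o, 'a) bimod \<times> (('o, 'a) bimod \<times> 'a \<times> ('o, 'a) bimod)
        \<times> (('o, 'a) bimod \<times> 'a \<times> ('o, 'a) bimod) \<Rightarrow> bool" where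
  "A_ring \<A> R \<longleftrightarrow> algebra_in (bimod_cat \<A>) R"

definition A_coring :: "'o \<times> 'a \<times> 'a
    \<Rightarrow> ('o, 'a) bimod \<times> (('o, 'a) bimod \<times> 'a \<times> ('o, 'a) bimod)
        \<times> (('o, 'a) bimod \<times> 'a \<times> ('o, 'a) bimod) \<Rightarrow> bool" where
  "A_coring \<A> R \<longleftrightarrow> coalgebra_in (bimod_cat \<A>) R"

end

section \<open>The correspondences\<close>

text \<open>A (co)wreath in \<open>C\<close> and a (co)algebra in \<open>sharp C \<A>\<close> consist of the same arrows of \<open>C\<close>; they
  only differ in how sources and targets are recorded.\<close>

type_synonym ('o, 'a) cwreath =
  "((unit, 'o, 'a) monad, (unit, 'o, 'a) em1, (unit, 'o, 'a) em2) monad"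

fun em2_to_sharp :: "('p, 'f, 'c) em2 \<Rightarrow> ('f \<times> 'c) \<times> 'c \<times> ('f \<times> 'c)" where
  "em2_to_sharp ((S, P, T), \<rho>, (S', Q, T')) = (P, \<rho>, Q)"

fun wreath_to_pair :: "('o, 'a) cwreath
    \<Rightarrow> ('o \<times> 'a \<times> 'a) \<times> (('o \<times> 'a) \<times> (('o \<times> 'a) \<times> 'a \<times> ('o \<times> 'a)) \<times> (('o \<times> 'a) \<times> 'a \<times> ('o \<times> 'a)))" where
  "wreath_to_pair ((_, \<A>), (S, P, T), \<mu>, \<eta>) = (\<A>, (P, em2_to_sharp \<mu>, em2_to_sharp \<eta>))"

context fixes C :: "('o, 'a) moncat" (structure) begin

definition wreath_structures :: "'o \<times> 'a \<times> 'a \<Rightarrow> 'o \<Rightarrow> ('o, 'a) cwreath set" where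
  "wreath_structures \<A> X =
     {W. wreath (one_object C) W \<and> (\<exists>\<psi> \<mu> \<eta>. wreath_to_pair W = (\<A>, ((X, \<psi>), \<mu>, \<eta>)))}"

definition cowreath_structures :: "'o \<times> 'a \<times> 'a \<Rightarrow> 'o \<Rightarrow> ('o, 'a) cwreath set" where
  "cowreath_structures \<A> X =
     {W. cowreath (one_object C) W \<and> (\<exists>\<psi> \<delta> \<epsilon>. wreath_to_pair W = (\<A>, ((X, \<psi>), \<delta>, \<epsilon>)))}"

fun ring_structures :: "'o \<times> 'a \<times> 'a \<Rightarrow> 'o
    \<Rightarrow> (('o, 'a) bimod \<times> (('o, 'a) bimod \<times> 'a \<times> ('o, 'a) bimod)
        \<times> (('o, 'a) bimod \<times> 'a \<times> ('o, 'a) bimod)) set" where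
  "ring_structures (A, m, u) X =
     {R. A_ring C (A, m, u) R \<and> (\<exists>r \<mu> \<eta>. R = ((A \<otimes> X, m \<boxtimes> Idn C X, r), \<mu>, \<eta>))}"

fun coring_structures :: "'o \<times> 'a \<times> 'a \<Rightarrow> 'o
    \<Rightarrow> (('o, 'a) bimod \<times> (('o, 'a) bimod \<times> 'a \<times> ('o, 'a) bimod)
        \<times> (('o, 'a) bimod \<times> 'a \<times> ('o, 'a) bimod)) set" where
  "coring_structures (A, m, u) X =
     {R. A_coring C (A, m, u) R \<and> (\<exists>r \<delta> \<epsilon>. R = ((A \<otimes> X, m \<boxtimes> Idn C X, r), \<delta>, \<epsilon>))}"

text \<open>The strong monoidal functor \<open>X \<mapsto> A \<otimes> X\<close> from \<open>sharp C (A, m, u)\<close> to bimodules: on objects, on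
  arrows, and its structure arrow \<open>A \<otimes> (X \<otimes> Y) \<rightarrow> (A \<otimes> X) \<otimes>\<^sub>A (A \<otimes> Y)\<close>, which is invertible.\<close>

fun free_bimod :: "'o \<times> 'a \<times> 'a \<Rightarrow> 'o \<times> 'a \<Rightarrow> ('o, 'a) bimod" where
  "free_bimod (A, m, u) (X, \<psi>) = (A \<otimes> X, m \<boxtimes> Idn C X, (m \<boxtimes> Idn C X) \<cdot> (Idn C A \<boxtimes> \<psi>))"

fun free_arr :: "'o \<times> 'a \<times> 'a \<Rightarrow> ('o \<times> 'a) \<times> 'a \<times> ('o \<times> 'a) \<Rightarrow> 'a" where
  "free_arr (A, m, u) (P, \<rho>, (Y, \<phi>)) = (m \<boxtimes> Idn C Y) \<cdot> (Idn C A \<boxtimes> \<rho>)"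

fun free_tensor :: "'o \<times> 'a \<times> 'a \<Rightarrow> 'o \<times> 'a \<Rightarrow> 'o \<times> 'a \<Rightarrow> 'a" where
  "free_tensor (A, m, u) (X, \<psi>) (Y, \<phi>) =
     bimod_proj C (free_bimod (A, m, u) (X, \<psi>)) (free_bimod (A, m, u) (Y, \<phi>))
       \<cdot> (Idn C A \<boxtimes> Idn C X \<boxtimes> u \<boxtimes> Idn C Y)"

definition wreath_to_ring :: "('o, 'a) cwreath
    \<Rightarrow> ('o, 'a) bimod \<times> (('o, 'a) bimod \<times> 'a \<times> ('o, 'a) bimod) \<times> (('o, 'a) bimod \<times> 'a \<times> ('o, 'a) bimod)" where
  "wreath_to_ring W =
     (case wreath_to_pair W of (\<A>, (P, \<mu>, \<eta>)) \<Rightarrow>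
        let F = free_bimod \<A> P in
          (F, (bimod_TenO C \<A> F F, factor C (free_tensor \<A> P P) (free_arr \<A> \<mu>), F),
              (regular_bimod \<A>, free_arr \<A> \<eta>, F)))"

definition cowreath_to_coring :: "('o, 'a) cwreath
    \<Rightarrow> ('o, 'a) bimod \<times> (('o, 'a) bimod \<times> 'a \<times> ('o, 'a) bimod) \<times> (('o, 'a) bimod \<times> 'a \<times> ('o, 'a) bimod)" where
  "cowreath_to_coring W =
     (case wreath_to_pair W of (\<A>, (P, \<delta>, \<epsilon>)) \<Rightarrow>
        let F = free_bimod \<A> P in
          (F, (F, free_tensor \<A> P P \<cdot> free_arr \<A> \<delta>, bimod_TenO C \<A> F F),
              (F, free_arr \<A> \<epsilon>, regular_bimod \<A>)))"

end

end

theory Submission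
  imports Defs
begin

text \<open>
  Wreaths and algebras in \<open>T\<^sub>A\<^sup>#\<close>. In \<open>EM\<close> of a one-object 2-category, an endo-1-cell of \<open>((), A)\<close>
  is a pair \<open>(X, \<psi>)\<close> subject to the conditions on an object of \<open>T\<^sub>A\<^sup>#\<close>, a 2-cell between two such is an
  arrow of \<open>T\<^sub>A\<^sup>#\<close>, and vertical composition is composition in \<open>T\<^sub>A\<^sup>#\<close>. Only the horizontal composite
  is written differently: for \<open>\<rho> : (X, \<psi>) \<rightarrow> (X', \<psi>')\<close>, one formula moves \<open>A\<close> past \<open>X\<close> with \<open>\<psi>\<close> before
  applying \<open>\<rho>\<close>, the other moves \<open>A\<close> past \<open>X'\<close> with \<open>\<psi>'\<close> afterwards. The condition on \<open>\<rho>\<close> says that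
  these agree (\<open>em_HCmp_endo2\<close>), so the monad axioms and the algebra axioms are the same equations
  (\<open>monad_pair_to_wreath\<close>, \<open>comonad_pair_to_wreath\<close>). The 0-cell and all ends of 1- and 2-cells of a
  wreath are repetitions of \<open>((), A)\<close> and \<open>(X, \<psi>)\<close>, so no data is lost in passing to the pair.

  Rings. The functor \<open>(X, \<psi>) \<mapsto> A \<otimes> X\<close>, with right action \<open>(m \<otimes> X)(A \<otimes> \<psi>)\<close>, \<open>\<rho> \<mapsto> (m \<otimes> Y)(A \<otimes> \<rho>)\<close>, is
  fully faithful, because a left linear arrow out of \<open>A \<otimes> X\<close> is determined by its restriction along
  the unit of \<open>A\<close>, and it hits every bimodule \<open>A \<otimes> X\<close> with left action \<open>m \<otimes> X\<close>, because the right
  action is determined by \<open>\<psi> = r (u \<otimes> X \<otimes> A)\<close> (\<open>bimodule_free_bimod\<close>). It is strong monoidal, so it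
  transports algebras and coalgebras in both directions, and these are the rings and corings.

  Strong monoidality rests on one fact: for a right module \<open>Z\<close>, the action \<open>Z \<otimes> A \<otimes> X \<rightarrow> Z \<otimes> X\<close> is a
  split coequalizer of the pair that defines \<open>Z \<otimes>\<^sub>A (A \<otimes> X)\<close> (\<open>free_on_coequalizer\<close>). A split
  coequalizer is preserved by every functor, which makes free modules left robust and makes the
  projections onto tensor products split epimorphisms, so that all structure arrows defined by
  factorization can be computed. Coflatness of \<open>A\<close> and \<open>X\<close> makes \<open>A \<otimes> X\<close> and \<open>A \<otimes> X \<otimes> X\<close> left coflat,
  hence objects of the category of bimodules.

  The axioms involve bimodules such as \<open>(A \<otimes> X) \<otimes>\<^sub>A (A \<otimes> X)\<close> that are free only up to isomorphism. For
  this reason the functor is replaced by relations: \<open>presents\<close> says that a bimodule is identified with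
  some \<open>A \<otimes> X\<close> by a given isomorphism, and \<open>represents\<close> says that an arrow of bimodules is, under such
  identifications, the extension of a given arrow of \<open>T\<^sub>A\<^sup>#\<close>. Presentations have tensor products
  (\<open>presents_TenO\<close>), representation is compatible with composition, tensor product, associativity and
  units (\<open>represents_Cmp\<close>, \<open>represents_TenA\<close>, \<open>represents_Assoc\<close>, \<open>represents_LUnit\<close>,
  \<open>represents_RUnit\<close>) and is one-to-one (\<open>represents_unique\<close>, \<open>represents_onto\<close>). Both sides of
  each axiom are thereby represented by the two sides of the corresponding axiom in \<open>T\<^sub>A\<^sup>#\<close>
  (\<open>algebra_presented\<close>, \<open>coalgebra_presented\<close>).
\<close>

section \<open>Calculating in a strict monoidal category\<close>

context category
begin

text \<open>Membership in \<open>hom\<close> is split into conditions on \<open>Dom\<close> and \<open>Cod\<close>. In this form the simplifier can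
  compute sources and targets of composites and discharge the side conditions of the laws below.\<close>
lemma hom_iff: "f \<in> hom C X Y \<longleftrightarrow> f \<in> Arr C \<and> Dom C f = X \<and> Cod C f = Y"
  by (simp add: hom_def)

lemma Obj_Dom_Cod [simp]:
  "f \<in> Arr C \<Longrightarrow> Dom C f \<in> Obj C" "f \<in> Arr C \<Longrightarrow> Cod C f \<in> Obj C"
  by (simp_all add: Dom_Obj Cod_Obj)

lemma Idn_typing [simp]:
  assumes "X \<in> Obj C"
  shows "Idn C X \<in> Arr C" "Dom C (Idn C X) = X" "Cod C (Idn C X) = X"
  using Idn_hom[OF assms] by (auto simp: hom_iff)

lemma Cmp_typing [simp]:
  assumes "f \<in> Arr C" "g \<in> Arr C" "Dom C g = Cod C f"
  shows "g \<cdot> f \<in> Arr C" "Dom C (g \<cdot> f) = Dom C f" "Cod C (g \<cdot> f) = Cod C g"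
  using Cmp_hom[of f "Dom C f" "Cod C f" g "Cod C g"] assms by (auto simp: hom_iff)

lemma Cmp_Idn_right [simp]: "f \<in> Arr C \<Longrightarrow> Dom C f = X \<Longrightarrow> f \<cdot> Idn C X = f"
  using Cmp_Idn[of f "Dom C f" "Cod C f"] by (auto simp: hom_iff)

lemma Cmp_Idn_left [simp]: "f \<in> Arr C \<Longrightarrow> Cod C f = X \<Longrightarrow> Idn C X \<cdot> f = f"
  using Idn_Cmp[of f "Dom C f" "Cod C f"] by (auto simp: hom_iff)

lemma Cmp_assoc_arr [simp]:
  assumes "f \<in> Arr C" "g \<in> Arr C" "h \<in> Arr C" "Dom C g = Cod C f" "Dom C h = Cod C g"
  shows "(h \<cdot> g) \<cdot> f = h \<cdot> (g \<cdot> f)"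
  using Cmp_assoc[of f "Dom C f" "Cod C f" g "Cod C g" h "Cod C h"] assms by (auto simp: hom_iff)

text \<open>Composites are kept nested to the right, so an equation between two-fold composites
  rewrites the middle of a longer composite only in this form.\<close>
lemma Cmp_extend:
  assumes "g \<cdot> f = k" "f \<in> Arr C" "g \<in> Arr C" "Dom C g = Cod C f" "h \<in> Arr C" "Dom C f = Cod C h"
  shows "g \<cdot> (f \<cdot> h) = k \<cdot> h"
  using assms Cmp_assoc_arr[of h f g] by simp

lemma iso_inverse:
  assumes "is_iso C f"
  obtains g where "f \<in> Arr C" "g \<in> Arr C" "Dom C g = Cod C f" "Cod C g = Dom C f"
    "g \<cdot> f = Idn C (Dom C f)" "f \<cdot> g = Idn C (Cod C f)"
  using assms by (auto simp: is_iso_def hom_iff)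

lemma is_isoI:
  assumes "f \<in> Arr C" "g \<in> Arr C" "Dom C g = Cod C f" "Cod C g = Dom C f"
    "g \<cdot> f = Idn C (Dom C f)" "f \<cdot> g = Idn C (Cod C f)"
  shows "is_iso C f"
  using assms by (auto simp: is_iso_def hom_iff)

text \<open>Arrows out of a tensor product over \<open>A\<close> are compared after composing with its projection, which
  has a section in the cases considered below.\<close>
lemma split_epi_cancel:
  assumes "k \<cdot> q = k' \<cdot> q" "q \<cdot> s = Idn C (Cod C q)"
    and "q \<in> Arr C" "s \<in> Arr C" "Dom C q = Cod C s"
    and "k \<in> Arr C" "Dom C k = Cod C q" "k' \<in> Arr C" "Dom C k' = Cod C q"
  shows "k = k'"
proof -
  have "k = k \<cdot> (q \<cdot> s)" "k' = k' \<cdot> (q \<cdot> s)"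
    using assms by simp_all
  moreover have "k \<cdot> (q \<cdot> s) = k' \<cdot> (q \<cdot> s)"
    using assms(1) Cmp_assoc_arr[of s q k] Cmp_assoc_arr[of s q k'] assms(3-) by simp
  ultimately show ?thesis by simp
qed

lemma iso_cancel_right:
  assumes "k \<cdot> e = k' \<cdot> e" "is_iso C e" "k \<in> Arr C" "Dom C k = Cod C e" "k' \<in> Arr C" "Dom C k' = Cod C e"
  shows "k = k'"
proof -
  obtain g where "e \<in> Arr C" "g \<in> Arr C" "Dom C g = Cod C e" "Cod C g = Dom C e"
    "e \<cdot> g = Idn C (Cod C e)"
    using assms(2) by (rule iso_inverse)
  then show ?thesis
    using assms by (intro split_epi_cancel[of k e k' g]) simp_all
qed

lemma iso_cancel_left:
  assumes "e \<cdot> k = e \<cdot> k'" "is_iso C e" "k \<in> Arr C" "Cod C k = Dom C e" "k' \<in> Arr C" "Cod C k' = Dom C e"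
  shows "k = k'"
proof -
  obtain g where g: "e \<in> Arr C" "g \<in> Arr C" "Dom C g = Cod C e" "Cod C g = Dom C e"
    "g \<cdot> e = Idn C (Dom C e)"
    using assms(2) by (rule iso_inverse)
  have "k = (g \<cdot> e) \<cdot> k" "k' = (g \<cdot> e) \<cdot> k'"
    using assms g by simp_all
  then show ?thesis
    using Cmp_assoc_arr[of k e g] Cmp_assoc_arr[of k' e g] assms g(1-4) by simp
qed

lemma is_iso_Cmp:
  assumes "is_iso C f" "is_iso C g" "Dom C g = Cod C f"
  shows "is_iso C (g \<cdot> f)"
proof -
  obtain f' where f: "f \<in> Arr C" "f' \<in> Arr C" "Dom C f' = Cod C f" "Cod C f' = Dom C f"
    "f' \<cdot> f = Idn C (Dom C f)" "f \<cdot> f' = Idn C (Cod C f)"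
    using assms(1) by (rule iso_inverse)
  obtain g' where g: "g \<in> Arr C" "g' \<in> Arr C" "Dom C g' = Cod C g" "Cod C g' = Dom C g"
    "g' \<cdot> g = Idn C (Dom C g)" "g \<cdot> g' = Idn C (Cod C g)"
    using assms(2) by (rule iso_inverse)
  have "g' \<cdot> g \<cdot> f = f" "f \<cdot> f' \<cdot> g' = g'"
    using Cmp_extend[OF g(5)] Cmp_extend[OF f(6)] f g assms(3) by simp_all
  then show ?thesis
    using f g assms(3) by (intro is_isoI[of _ "f' \<cdot> g'"]) simp_all
qed

lemma is_iso_Idn: "X \<in> Obj C \<Longrightarrow> is_iso C (Idn C X)"
  by (rule is_isoI[of _ "Idn C X"]) simp_all

end

context strict_monoidal_category
begin

lemma TenO_simps [simp]:
  "\<I> \<in> Obj C"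
  "X \<in> Obj C \<Longrightarrow> Y \<in> Obj C \<Longrightarrow> X \<otimes> Y \<in> Obj C"
  "X \<in> Obj C \<Longrightarrow> \<I> \<otimes> X = X" "X \<in> Obj C \<Longrightarrow> X \<otimes> \<I> = X"
  "X \<in> Obj C \<Longrightarrow> Y \<in> Obj C \<Longrightarrow> Z \<in> Obj C \<Longrightarrow> (X \<otimes> Y) \<otimes> Z = X \<otimes> (Y \<otimes> Z)"
  by (simp_all add: Unit_Obj TenO_Obj TenO_assoc TenO_Unit_left TenO_Unit_right)

lemma TenA_typing [simp]:
  assumes "f \<in> Arr C" "g \<in> Arr C"
  shows "f \<boxtimes> g \<in> Arr C" "Dom C (f \<boxtimes> g) = Dom C f \<otimes> Dom C g" "Cod C (f \<boxtimes> g) = Cod C f \<otimes> Cod C g"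
  using TenA_hom[of f "Dom C f" "Cod C f" g "Dom C g" "Cod C g"] assms by (auto simp: hom_iff)

lemma TenA_assoc_arr [simp]:
  "f \<in> Arr C \<Longrightarrow> g \<in> Arr C \<Longrightarrow> h \<in> Arr C \<Longrightarrow> (f \<boxtimes> g) \<boxtimes> h = f \<boxtimes> (g \<boxtimes> h)"
  by (rule TenA_assoc) (auto simp: hom_iff)

lemma TenA_Unit_arr [simp]:
  "f \<in> Arr C \<Longrightarrow> Idn C \<I> \<boxtimes> f = f" "f \<in> Arr C \<Longrightarrow> f \<boxtimes> Idn C \<I> = f"
  by (rule TenA_Unit; auto simp: hom_iff)+

lemma TenA_Idn_simp [simp]:
  "X \<in> Obj C \<Longrightarrow> Y \<in> Obj C \<Longrightarrow> Idn C X \<boxtimes> Idn C Y = Idn C (X \<otimes> Y)"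
  by (rule TenA_Idn)

text \<open>Together with the preceding laws this gives whiskered arrows the normal form
  \<open>Idn C X \<boxtimes> (f \<boxtimes> Idn C Y)\<close>, with all identities on either side of \<open>f\<close> collected into one.\<close>
lemma TenA_Idn_merge [simp]:
  "X \<in> Obj C \<Longrightarrow> Y \<in> Obj C \<Longrightarrow> f \<in> Arr C \<Longrightarrow> Idn C X \<boxtimes> (Idn C Y \<boxtimes> f) = Idn C (X \<otimes> Y) \<boxtimes> f"
  by (simp flip: TenA_Idn TenA_assoc_arr del: TenA_Idn_simp TenA_assoc_arr)

lemma TenA_Cmp_arr:
  assumes "f \<in> Arr C" "f' \<in> Arr C" "g \<in> Arr C" "g' \<in> Arr C" "Dom C f' = Cod C f" "Dom C g' = Cod C g"
  shows "(f' \<boxtimes> g') \<cdot> (f \<boxtimes> g) = (f' \<cdot> f) \<boxtimes> (g' \<cdot> g)"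
  using TenA_Cmp[of f "Dom C f" "Cod C f" f' "Cod C f'" g "Dom C g" "Cod C g" g' "Cod C g'"] assms
  by (auto simp: hom_iff)

lemma whisker_left [simp]:
  assumes "X \<in> Obj C" "f \<in> Arr C" "g \<in> Arr C" "Dom C g = Cod C f"
  shows "Idn C X \<boxtimes> (g \<cdot> f) = (Idn C X \<boxtimes> g) \<cdot> (Idn C X \<boxtimes> f)"
  using assms by (simp add: TenA_Cmp_arr)

lemma whisker_right [simp]:
  assumes "X \<in> Obj C" "f \<in> Arr C" "g \<in> Arr C" "Dom C g = Cod C f"
  shows "(g \<cdot> f) \<boxtimes> Idn C X = (g \<boxtimes> Idn C X) \<cdot> (f \<boxtimes> Idn C X)"
  using assms by (simp add: TenA_Cmp_arr)

text \<open>The exchange of two arrows acting on disjoint tensor factors has no preferred direction, so it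
  is kept out of the simplifier and applied at chosen places.\<close>
lemma interchange_left_first:
  assumes "f \<in> Arr C" "g \<in> Arr C" "Dom C g = W" "Cod C f = Z"
  shows "(Idn C Z \<boxtimes> g) \<cdot> (f \<boxtimes> Idn C W) = f \<boxtimes> g"
  using assms by (auto simp: TenA_Cmp_arr)

lemma interchange_right_first:
  assumes "f \<in> Arr C" "g \<in> Arr C" "Dom C f = W" "Cod C g = Z"
  shows "(f \<boxtimes> Idn C Z) \<cdot> (Idn C W \<boxtimes> g) = f \<boxtimes> g"
  using assms by (auto simp: TenA_Cmp_arr)

lemma interchange_arr:
  assumes "f \<in> Arr C" "g \<in> Arr C" "Dom C f = X" "Cod C f = Y" "Dom C g = V" "Cod C g = W"
  shows "(f \<boxtimes> Idn C W) \<cdot> (Idn C X \<boxtimes> g) = (Idn C Y \<boxtimes> g) \<cdot> (f \<boxtimes> Idn C V)"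
  using assms by (auto simp: TenA_Cmp_arr)

lemma is_iso_TenA:
  assumes "is_iso C f" "is_iso C g"
  shows "is_iso C (f \<boxtimes> g)"
proof -
  obtain f' where f: "f \<in> Arr C" "f' \<in> Arr C" "Dom C f' = Cod C f" "Cod C f' = Dom C f"
    "f' \<cdot> f = Idn C (Dom C f)" "f \<cdot> f' = Idn C (Cod C f)"
    using assms(1) by (rule iso_inverse)
  obtain g' where g: "g \<in> Arr C" "g' \<in> Arr C" "Dom C g' = Cod C g" "Cod C g' = Dom C g"
    "g' \<cdot> g = Idn C (Dom C g)" "g \<cdot> g' = Idn C (Cod C g)"
    using assms(2) by (rule iso_inverse)
  show ?thesis
    using f g by (intro is_isoI[of _ "f' \<boxtimes> g'"]) (simp_all add: TenA_Cmp_arr)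
qed

end

section \<open>Split coequalizers and factorizations\<close>

context category
begin

text \<open>The structure arrows of a tensor product of bimodules are factorizations through \<open>A \<otimes> q\<close> and
  \<open>q \<otimes> A\<close> for a projection \<open>q\<close>. A section of \<open>q\<close> makes these split epimorphisms, through which
  there is at most one factorization.\<close>
lemma factor_split_epi:
  assumes "k \<cdot> q = h" "q \<cdot> s = Idn C (Cod C q)"
    and "q \<in> Arr C" "s \<in> Arr C" "Dom C q = Cod C s" "k \<in> Arr C" "Dom C k = Cod C q"
  shows "factor C q h = k"
  unfolding factor_def
proof (rule the_equality)
  show "k \<in> hom C (Cod C q) (Cod C h) \<and> k \<cdot> q = h"
    using assms by (auto simp: hom_iff)
  fix k' assume "k' \<in> hom C (Cod C q) (Cod C h) \<and> k' \<cdot> q = h"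
  then show "k' = k"
    using assms by (intro split_epi_cancel[of k' q k s]) (auto simp: hom_iff)
qed

lemma factor_iso:
  assumes "is_iso C q" "k \<in> Arr C" "Dom C k = Cod C q"
  shows "factor C q (k \<cdot> q) = k"
proof -
  obtain s where "q \<in> Arr C" "s \<in> Arr C" "Dom C s = Cod C q" "Cod C s = Dom C q"
    "q \<cdot> s = Idn C (Cod C q)"
    using assms(1) by (rule iso_inverse)
  then show ?thesis
    using assms by (intro factor_split_epi[of k q _ s]) simp_all
qed

lemma coequalizer_typing:
  assumes "is_coequalizer C f g q"
  shows "f \<in> Arr C" "g \<in> Arr C" "q \<in> Arr C" "Dom C g = Dom C f" "Cod C g = Cod C f"
    "Dom C q = Cod C f" "q \<cdot> f = q \<cdot> g"
  using assms unfolding is_coequalizer_def by simp_all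

lemma coequalizer_universal:
  assumes "is_coequalizer C f g q" "h \<in> Arr C" "Dom C h = Cod C f" "h \<cdot> f = h \<cdot> g"
  shows "\<exists>!k. k \<in> hom C (Cod C q) (Cod C h) \<and> k \<cdot> q = h"
  using assms unfolding is_coequalizer_def by blast

lemma factor_coequalizer:
  assumes "is_coequalizer C f g q" "h \<in> Arr C" "Dom C h = Cod C f" "h \<cdot> f = h \<cdot> g"
  shows "factor C q h \<in> Arr C" "Dom C (factor C q h) = Cod C q" "Cod C (factor C q h) = Cod C h"
    "factor C q h \<cdot> q = h"
proof -
  from theI'[OF coequalizer_universal[OF assms]] show "factor C q h \<in> Arr C" "Dom C (factor C q h) = Cod C q"
    "Cod C (factor C q h) = Cod C h" "factor C q h \<cdot> q = h"
    by (simp_all add: factor_def hom_iff)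
qed

lemma coequalizer_cancel:
  assumes "is_coequalizer C f g q" "k \<cdot> q = k' \<cdot> q"
    "k \<in> Arr C" "Dom C k = Cod C q" "k' \<in> Arr C" "Dom C k' = Cod C q"
  shows "k = k'"
proof -
  note q = coequalizer_typing[OF assms(1)]
  have "(k \<cdot> q) \<cdot> f = (k \<cdot> q) \<cdot> g"
    using assms q by simp
  then have ex: "\<exists>!j. j \<in> hom C (Cod C q) (Cod C (k \<cdot> q)) \<and> j \<cdot> q = k \<cdot> q"
    using assms(3,4) q(1-6) by (intro coequalizer_universal[OF assms(1)]) simp_all
  have "Cod C (k \<cdot> q) = Cod C k" "Cod C (k \<cdot> q) = Cod C k'"
    using assms(3-) q by (simp, simp add: assms(2))
  then have c: "Cod C k' = Cod C k" by (rule trans[OF sym, rotated])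
  have "k \<in> hom C (Cod C q) (Cod C (k \<cdot> q)) \<and> k \<cdot> q = k \<cdot> q"
    using assms(3,4) q(3,6) by (simp add: hom_iff)
  moreover have "k' \<in> hom C (Cod C q) (Cod C (k \<cdot> q)) \<and> k' \<cdot> q = k \<cdot> q"
    using assms(3-) q(3,6) c by (simp add: hom_iff assms(2))
  ultimately show ?thesis
    using ex by (elim ex1E) metis
qed

text \<open>Since \<open>coequalizer\<close> picks an arbitrary coequalizer, this comparison is how an explicit one is
  brought in.\<close>
lemma coequalizer_comparison:
  assumes p: "is_coequalizer C f g p" and q: "is_coequalizer C f g q"
  obtains j where "is_iso C j" "Dom C j = Cod C p" "Cod C j = Cod C q" "j \<cdot> p = q"
proof -
  note t = coequalizer_typing[OF p] coequalizer_typing[OF q]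
  note j = factor_coequalizer[OF p t(10,13,14)] and j' = factor_coequalizer[OF q t(3,6,7)]
  let ?j = "factor C p q" and ?j' = "factor C q p"
  have "?j' \<cdot> ?j = Idn C (Cod C p)"
    using j j' t by - (rule coequalizer_cancel[OF p], simp_all)
  moreover have "?j \<cdot> ?j' = Idn C (Cod C q)"
    using j j' t by - (rule coequalizer_cancel[OF q], simp_all)
  ultimately have "is_iso C ?j"
    using j j' t by (intro is_isoI[of _ ?j']) simp_all
  then show ?thesis
    using j by (intro that[of ?j])
qed

text \<open>The data \<open>s\<close>, \<open>t\<close> are those of a split coequalizer: \<open>h \<cdot> s\<close> is the factorization of \<open>h\<close>
  because \<open>h = h \<cdot> g \<cdot> t = h \<cdot> f \<cdot> t = h \<cdot> s \<cdot> p\<close>.\<close>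
lemma split_coequalizer:
  assumes t: "f \<in> Arr C" "g \<in> Arr C" "Dom C f = Dom C g" "Cod C f = Cod C g"
      "p \<in> Arr C" "Dom C p = Cod C f" "s \<in> Arr C" "Dom C s = Cod C p" "Cod C s = Cod C f"
      "t \<in> Arr C" "Dom C t = Cod C f" "Cod C t = Dom C f"
    and e: "p \<cdot> f = p \<cdot> g" "p \<cdot> s = Idn C (Cod C p)" "f \<cdot> t = s \<cdot> p" "g \<cdot> t = Idn C (Cod C f)"
  shows "is_coequalizer C f g p"
  unfolding is_coequalizer_def
proof (intro conjI ballI impI)
  fix h assume h: "h \<in> Arr C" "Dom C h = Cod C f \<and> h \<cdot> f = h \<cdot> g"
  have "(h \<cdot> s) \<cdot> p = h \<cdot> (f \<cdot> t)"
    using t h e by simp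
  also have "\<dots> = (h \<cdot> g) \<cdot> t"
    using t h Cmp_assoc_arr[of t f h] by simp
  also have "\<dots> = h"
    using t h e by simp
  finally have hs: "(h \<cdot> s) \<cdot> p = h" .
  show "\<exists>!k. k \<in> hom C (Cod C p) (Cod C h) \<and> k \<cdot> p = h"
  proof (rule ex1I[of _ "h \<cdot> s"])
    show "h \<cdot> s \<in> hom C (Cod C p) (Cod C h) \<and> (h \<cdot> s) \<cdot> p = h"
      using t h hs by (simp add: hom_iff)
    fix k assume k: "k \<in> hom C (Cod C p) (Cod C h) \<and> k \<cdot> p = h"
    show "k = h \<cdot> s"
      using t k h hs e by (intro split_epi_cancel[of k p "h \<cdot> s" s]) (auto simp: hom_iff)
  qed
qed (use assms in auto)

lemma coequalizer_iso_transport: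
  assumes q: "is_coequalizer C f g q"
    and a: "is_iso C a" "Dom C a = Dom C f" and b: "is_iso C b" "Dom C b = Cod C f"
    and c: "is_iso C c" "Dom C c = Cod C q"
    and f': "f' \<in> Arr C" "Dom C f' = Cod C a" "Cod C f' = Cod C b" "f' \<cdot> a = b \<cdot> f"
    and g': "g' \<in> Arr C" "Dom C g' = Cod C a" "Cod C g' = Cod C b" "g' \<cdot> a = b \<cdot> g"
    and q': "q' \<in> Arr C" "Dom C q' = Cod C b" "Cod C q' = Cod C c" "q' \<cdot> b = c \<cdot> q"
  shows "is_coequalizer C f' g' q'"
proof -
  note t = coequalizer_typing[OF q]
  obtain a' where a': "a \<in> Arr C" "a' \<in> Arr C" "Dom C a' = Cod C a" "Cod C a' = Dom C a"
    "a' \<cdot> a = Idn C (Dom C a)" "a \<cdot> a' = Idn C (Cod C a)"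
    using a(1) by (rule iso_inverse)
  obtain b' where b': "b \<in> Arr C" "b' \<in> Arr C" "Dom C b' = Cod C b" "Cod C b' = Dom C b"
    "b' \<cdot> b = Idn C (Dom C b)" "b \<cdot> b' = Idn C (Cod C b)"
    using b(1) by (rule iso_inverse)
  obtain c' where c': "c \<in> Arr C" "c' \<in> Arr C" "Dom C c' = Cod C c" "Cod C c' = Dom C c"
    "c' \<cdot> c = Idn C (Dom C c)" "c \<cdot> c' = Idn C (Cod C c)"
    using c(1) by (rule iso_inverse)
  note ty = t a(2) b(2) c(2) a'(1-4) b'(1-4) c'(1-4) f'(1-3) g'(1-3) q'(1-3)
  have ff: "h \<cdot> f' = h \<cdot> g' \<longleftrightarrow> (h \<cdot> b) \<cdot> f = (h \<cdot> b) \<cdot> g" if "h \<in> Arr C" "Dom C h = Cod C b" for h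
  proof -
    have "(h \<cdot> b) \<cdot> f = (h \<cdot> f') \<cdot> a" "(h \<cdot> b) \<cdot> g = (h \<cdot> g') \<cdot> a"
      using ty f'(4) g'(4) that by simp_all
    moreover have "(h \<cdot> f') \<cdot> a = (h \<cdot> g') \<cdot> a \<Longrightarrow> h \<cdot> f' = h \<cdot> g'"
      by (erule iso_cancel_right[OF _ a(1)]) (use ty that in simp_all)
    ultimately show ?thesis
      by metis
  qed
  show ?thesis
    unfolding is_coequalizer_def
  proof (intro conjI ballI impI)
    have "c \<cdot> (q \<cdot> f) = c \<cdot> (q \<cdot> g)"
      using t by simp
    then have "(q' \<cdot> b) \<cdot> f = (q' \<cdot> b) \<cdot> g"
      unfolding q'(4) using ty by simp
    then show "q' \<cdot> f' = q' \<cdot> g'"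
      using ff[of q'] q' by simp
    fix h assume h: "h \<in> Arr C" "Dom C h = Cod C f' \<and> h \<cdot> f' = h \<cdot> g'"
    then have hb: "(h \<cdot> b) \<cdot> f = (h \<cdot> b) \<cdot> g"
      using ff ty by auto
    note k = factor_coequalizer[OF q _ _ hb]
    let ?k = "factor C q (h \<cdot> b)"
    have k: "?k \<in> Arr C" "Dom C ?k = Cod C q" "Cod C ?k = Cod C h" "?k \<cdot> q = h \<cdot> b"
      using k h ty by auto
    have "(?k \<cdot> c') \<cdot> (q' \<cdot> b) = ?k \<cdot> ((c' \<cdot> c) \<cdot> q)"
      using ty k q'(4) by simp
    also have "\<dots> = h \<cdot> b"
      using c' ty k by simp
    finally have kb: "((?k \<cdot> c') \<cdot> q') \<cdot> b = h \<cdot> b"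
      using ty k by simp
    have kq: "(?k \<cdot> c') \<cdot> q' = h"
      by (rule iso_cancel_right[OF kb b(1)]) (use ty k h in simp_all)
    show "\<exists>!k. k \<in> hom C (Cod C q') (Cod C h) \<and> k \<cdot> q' = h"
    proof (rule ex1I[of _ "?k \<cdot> c'"])
      show "?k \<cdot> c' \<in> hom C (Cod C q') (Cod C h) \<and> (?k \<cdot> c') \<cdot> q' = h"
        using kq ty k h by (simp add: hom_iff)
      fix l assume l: "l \<in> hom C (Cod C q') (Cod C h) \<and> l \<cdot> q' = h"
      have "(l \<cdot> c) \<cdot> q = (l \<cdot> q') \<cdot> b"
        using ty l q'(4) Cmp_assoc_arr[of b q' l] by (simp add: hom_iff)
      also have "\<dots> = ?k \<cdot> q"
        using l k by simp
      finally have "(l \<cdot> c) \<cdot> q = ?k \<cdot> q" .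
      then have "l \<cdot> c = ?k"
        by (rule coequalizer_cancel[OF q]) (use ty l k in \<open>simp_all add: hom_iff\<close>)
      then have "(l \<cdot> c) \<cdot> c' = ?k \<cdot> c'" by simp
      then show "l = ?k \<cdot> c'"
        using ty l c' by (simp add: hom_iff)
    qed
  qed (use ty in simp_all)
qed

lemma factor_of_Cmp:
  assumes q: "is_coequalizer C f g q" and k: "k \<in> Arr C" "Dom C k = Cod C q"
  shows "factor C q (k \<cdot> q) = k"
  unfolding factor_def
proof (rule the_equality)
  note t = coequalizer_typing[OF q]
  show "k \<in> hom C (Cod C q) (Cod C (k \<cdot> q)) \<and> k \<cdot> q = k \<cdot> q"
    using k t by (simp add: hom_iff)
  fix k' assume "k' \<in> hom C (Cod C q) (Cod C (k \<cdot> q)) \<and> k' \<cdot> q = k \<cdot> q"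
  then show "k' = k"
    using k by (intro coequalizer_cancel[OF q, of k' k]) (auto simp: hom_iff)
qed

lemma coequalizer_of_pair:
  assumes "has_coequalizers C" "f \<in> Arr C" "g \<in> Arr C" "Dom C f = Dom C g" "Cod C f = Cod C g"
  shows "is_coequalizer C f g (coequalizer C f g)"
  using assms unfolding has_coequalizers_def coequalizer_def by - (rule someI_ex, blast)

end

section \<open>Left linear extension and the laws of \<open>T\<^sub>A\<^sup>#\<close>\<close>

locale strict_algebra = strict_monoidal_category C
  for C :: "('o, 'a) moncat" (structure) +
  fixes A :: 'o and m u :: 'a
  assumes algebra: "algebra_in C (A, m, u)"
begin

lemma algebra_typing [simp]:
  "A \<in> Obj C" "m \<in> Arr C" "Dom C m = A \<otimes> A" "Cod C m = A"
  "u \<in> Arr C" "Dom C u = \<I>" "Cod C u = A"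
  using algebra by (auto simp: hom_iff)

lemma algebra_laws:
  "m \<cdot> (m \<boxtimes> Idn C A) = m \<cdot> (Idn C A \<boxtimes> m)"
  "m \<cdot> (u \<boxtimes> Idn C A) = Idn C A" "m \<cdot> (Idn C A \<boxtimes> u) = Idn C A"
  using algebra by (simp_all add: Assoc_strict LUnit_strict RUnit_strict)

text \<open>The algebra laws with an object \<open>X\<close> as a spectator: the laws of the free left module \<open>A \<otimes> X\<close>.\<close>
lemma mult_whisker:
  assumes "X \<in> Obj C"
  shows "(m \<boxtimes> Idn C X) \<cdot> (m \<boxtimes> Idn C (A \<otimes> X)) = (m \<boxtimes> Idn C X) \<cdot> (Idn C A \<boxtimes> (m \<boxtimes> Idn C X))"
    and "(m \<boxtimes> Idn C X) \<cdot> (u \<boxtimes> Idn C (A \<otimes> X)) = Idn C (A \<otimes> X)"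
    and "(m \<boxtimes> Idn C X) \<cdot> (Idn C A \<boxtimes> (u \<boxtimes> Idn C X)) = Idn C (A \<otimes> X)"
  using arg_cong[OF algebra_laws(1), of "\<lambda>f. f \<boxtimes> Idn C X"]
    arg_cong[OF algebra_laws(2), of "\<lambda>f. f \<boxtimes> Idn C X"]
    arg_cong[OF algebra_laws(3), of "\<lambda>f. f \<boxtimes> Idn C X"] assms
  by simp_all

text \<open>The left linear extension \<open>A \<otimes> X \<rightarrow> A \<otimes> Y\<close> of an arrow \<open>\<rho> : X \<rightarrow> A \<otimes> Y\<close>: it turns composition
  in \<open>sharp\<close> into composition in \<open>C\<close>.\<close>
definition ext :: "'a \<Rightarrow> 'o \<Rightarrow> 'a" where
  "ext \<rho> Y = (m \<boxtimes> Idn C Y) \<cdot> (Idn C A \<boxtimes> \<rho>)"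

lemma ext_typing [simp]:
  assumes "\<rho> \<in> Arr C" "Cod C \<rho> = A \<otimes> Y" "Y \<in> Obj C"
  shows "ext \<rho> Y \<in> Arr C" "Dom C (ext \<rho> Y) = A \<otimes> Dom C \<rho>" "Cod C (ext \<rho> Y) = A \<otimes> Y"
  using assms by (simp_all add: ext_def)

text \<open>An arrow is recovered from its extension by restricting along the unit of \<open>A\<close>; with
  \<open>linear_eq_ext\<close> this makes extension a bijection onto the left linear arrows.\<close>
lemma ext_unit:
  assumes "\<rho> \<in> Arr C" "Dom C \<rho> = X" "Cod C \<rho> = A \<otimes> Y" "Y \<in> Obj C"
  shows "ext \<rho> Y \<cdot> (u \<boxtimes> Idn C X) = \<rho>"
proof -
  have "ext \<rho> Y \<cdot> (u \<boxtimes> Idn C X) = (m \<boxtimes> Idn C Y) \<cdot> ((Idn C A \<boxtimes> \<rho>) \<cdot> (u \<boxtimes> Idn C X))"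
    using assms by (auto simp: ext_def)
  also have "(Idn C A \<boxtimes> \<rho>) \<cdot> (u \<boxtimes> Idn C X) = (u \<boxtimes> Idn C (A \<otimes> Y)) \<cdot> \<rho>"
    using assms interchange_arr[of u \<rho> \<I> A X "A \<otimes> Y"] by auto
  also have "(m \<boxtimes> Idn C Y) \<cdot> ((u \<boxtimes> Idn C (A \<otimes> Y)) \<cdot> \<rho>) = \<rho>"
    using assms by (subst Cmp_extend[OF mult_whisker(2)]) simp_all
  finally show ?thesis .
qed

lemma ext_linear:
  assumes "\<rho> \<in> Arr C" "Dom C \<rho> = X" "Cod C \<rho> = A \<otimes> Y" "Y \<in> Obj C"
  shows "ext \<rho> Y \<cdot> (m \<boxtimes> Idn C X) = (m \<boxtimes> Idn C Y) \<cdot> (Idn C A \<boxtimes> ext \<rho> Y)"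
proof -
  have "ext \<rho> Y \<cdot> (m \<boxtimes> Idn C X) = (m \<boxtimes> Idn C Y) \<cdot> ((Idn C A \<boxtimes> \<rho>) \<cdot> (m \<boxtimes> Idn C X))"
    using assms by (auto simp: ext_def)
  also have "(Idn C A \<boxtimes> \<rho>) \<cdot> (m \<boxtimes> Idn C X) = (m \<boxtimes> Idn C (A \<otimes> Y)) \<cdot> (Idn C (A \<otimes> A) \<boxtimes> \<rho>)"
    using assms interchange_arr[of m \<rho> "A \<otimes> A" A X "A \<otimes> Y"] by auto
  also have "(m \<boxtimes> Idn C Y) \<cdot> ((m \<boxtimes> Idn C (A \<otimes> Y)) \<cdot> (Idn C (A \<otimes> A) \<boxtimes> \<rho>))
      = (m \<boxtimes> Idn C Y) \<cdot> (Idn C A \<boxtimes> ext \<rho> Y)"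
    using assms by (subst Cmp_extend[OF mult_whisker(1)]) (simp_all add: ext_def)
  finally show ?thesis .
qed

lemma ext_inject:
  assumes "ext \<rho> Y = ext \<sigma> Y" "Y \<in> Obj C"
    "\<rho> \<in> Arr C" "Dom C \<rho> = X" "Cod C \<rho> = A \<otimes> Y" "\<sigma> \<in> Arr C" "Dom C \<sigma> = X" "Cod C \<sigma> = A \<otimes> Y"
  shows "\<rho> = \<sigma>"
  by (rule trans[OF ext_unit[symmetric, of \<rho> X Y] trans[OF _ ext_unit[of \<sigma> X Y]]]) (use assms in auto)

lemma linear_eq_ext:
  assumes "f \<cdot> (m \<boxtimes> Idn C X) = (m \<boxtimes> Idn C Y) \<cdot> (Idn C A \<boxtimes> f)"
    and "f \<in> Arr C" "Dom C f = A \<otimes> X" "Cod C f = A \<otimes> Y" "X \<in> Obj C" "Y \<in> Obj C"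
  shows "f = ext (f \<cdot> (u \<boxtimes> Idn C X)) Y"
proof -
  have "ext (f \<cdot> (u \<boxtimes> Idn C X)) Y = ((m \<boxtimes> Idn C Y) \<cdot> (Idn C A \<boxtimes> f)) \<cdot> (Idn C A \<boxtimes> (u \<boxtimes> Idn C X))"
    using assms by (simp add: ext_def)
  also have "\<dots> = f \<cdot> ((m \<boxtimes> Idn C X) \<cdot> (Idn C A \<boxtimes> (u \<boxtimes> Idn C X)))"
    unfolding assms(1)[symmetric] using assms(2-) by simp
  also have "\<dots> = f"
    using assms by (simp add: mult_whisker)
  finally show ?thesis by simp
qed

text \<open>The composite of \<open>\<sigma>\<close> and \<open>\<rho>\<close> in \<open>T\<^sub>A\<^sup>#\<close> is \<open>ext \<sigma> Z \<cdot> \<rho>\<close>, so this is functoriality of the extension.\<close>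
lemma ext_Cmp:
  assumes "\<rho> \<in> Arr C" "Dom C \<rho> = X" "Cod C \<rho> = A \<otimes> Y" "Y \<in> Obj C"
    and "\<sigma> \<in> Arr C" "Dom C \<sigma> = Y" "Cod C \<sigma> = A \<otimes> Z" "Z \<in> Obj C"
  shows "ext (ext \<sigma> Z \<cdot> \<rho>) Z = ext \<sigma> Z \<cdot> ext \<rho> Y"
proof -
  have "ext (ext \<sigma> Z \<cdot> \<rho>) Z = ((m \<boxtimes> Idn C Z) \<cdot> (Idn C A \<boxtimes> ext \<sigma> Z)) \<cdot> (Idn C A \<boxtimes> \<rho>)"
    using assms by (simp add: ext_def[of "_ \<cdot> _"])
  also have "\<dots> = (ext \<sigma> Z \<cdot> (m \<boxtimes> Idn C Y)) \<cdot> (Idn C A \<boxtimes> \<rho>)"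
    using ext_linear[of \<sigma> Y Z] assms by simp
  also have "\<dots> = ext \<sigma> Z \<cdot> ext \<rho> Y"
    using assms by (simp add: ext_def[of \<rho>])
  finally show ?thesis .
qed

lemma ext_Idn: "X \<in> Obj C \<Longrightarrow> ext (u \<boxtimes> Idn C X) X = Idn C (A \<otimes> X)"
  by (simp add: ext_def mult_whisker)

text \<open>The conditions on sources and targets in \<open>sharp_arr\<close>. They pass to composites and tensor products by
  computing sources and targets, which is enough for the identity laws to apply to them.\<close>
definition sharp_typed :: "('o \<times> 'a) \<times> 'a \<times> ('o \<times> 'a) \<Rightarrow> bool" where
  "sharp_typed r \<longleftrightarrow> (case r of (P, \<rho>, Q) \<Rightarrow>
     fst P \<in> Obj C \<and> snd P \<in> hom C (fst P \<otimes> A) (A \<otimes> fst P) \<and>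
     fst Q \<in> Obj C \<and> snd Q \<in> hom C (fst Q \<otimes> A) (A \<otimes> fst Q) \<and>
     \<rho> \<in> hom C (fst P) (A \<otimes> fst Q))"

lemma sharp_typed_simp [simp]:
  "sharp_typed ((X, \<psi>), \<rho>, (Y, \<phi>)) \<longleftrightarrow>
     X \<in> Obj C \<and> \<psi> \<in> Arr C \<and> Dom C \<psi> = X \<otimes> A \<and> Cod C \<psi> = A \<otimes> X \<and>
     Y \<in> Obj C \<and> \<phi> \<in> Arr C \<and> Dom C \<phi> = Y \<otimes> A \<and> Cod C \<phi> = A \<otimes> Y \<and>
     \<rho> \<in> Arr C \<and> Dom C \<rho> = X \<and> Cod C \<rho> = A \<otimes> Y"
  by (auto simp: sharp_typed_def hom_iff)

lemma sharp_typed_arr: "sharp_arr C (A, m, u) r \<Longrightarrow> sharp_typed r"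
  by (cases r) (auto simp: hom_iff)

text \<open>\<open>T\<^sub>A\<^sup>#\<close> is again strict. Its associativity and unit arrows are identities, and the left and right
  sides of the axioms for a monad in \<open>EM\<close> have literally equal ends.\<close>
lemma sharp_TenO_assoc:
  assumes "fst P \<in> Obj C" "snd P \<in> hom C (fst P \<otimes> A) (A \<otimes> fst P)"
    and "fst Q \<in> Obj C" "snd Q \<in> hom C (fst Q \<otimes> A) (A \<otimes> fst Q)"
    and "fst R \<in> Obj C" "snd R \<in> hom C (fst R \<otimes> A) (A \<otimes> fst R)"
  shows "sharp_TenO C (sharp_TenO C P Q) R = sharp_TenO C P (sharp_TenO C Q R)"
  using assms by (cases P; cases Q; cases R) (simp add: hom_iff)

lemma sharp_TenO_Unit:
  assumes "fst P \<in> Obj C" "snd P \<in> hom C (fst P \<otimes> A) (A \<otimes> fst P)"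
  shows "sharp_TenO C (\<I>, Idn C A) P = P" "sharp_TenO C P (\<I>, Idn C A) = P"
  using assms by (cases P; simp add: hom_iff)+

lemma sharp_Cmp_Idn:
  assumes "sharp_typed r"
  shows "sharp_Cmp C (A, m, u) r (sharp_Idn C (A, m, u) (fst r)) = r"
    and "sharp_Cmp C (A, m, u) (sharp_Idn C (A, m, u) (snd (snd r))) r = r"
proof -
  obtain X \<psi> \<rho> Y \<phi> where r: "r = ((X, \<psi>), \<rho>, (Y, \<phi>))"
    by (cases r) auto
  show "sharp_Cmp C (A, m, u) r (sharp_Idn C (A, m, u) (fst r)) = r"
    using assms ext_unit[of \<rho> X Y] by (auto simp: r ext_def)
  show "sharp_Cmp C (A, m, u) (sharp_Idn C (A, m, u) (snd (snd r))) r = r"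
    using assms mult_whisker(3)[of Y] Cmp_extend[OF mult_whisker(3), of Y \<rho>] by (auto simp: r)
qed

lemma sharp_ends [simp]:
  "fst (sharp_Idn C (A, m, u) P) = P" "snd (snd (sharp_Idn C (A, m, u) P)) = P"
  "fst (sharp_Cmp C (A, m, u) s r) = fst r" "snd (snd (sharp_Cmp C (A, m, u) s r)) = snd (snd s)"
  "fst (sharp_TenA C (A, m, u) r s) = sharp_TenO C (fst r) (fst s)"
  "snd (snd (sharp_TenA C (A, m, u) r s)) = sharp_TenO C (snd (snd r)) (snd (snd s))"
  by (cases P; simp) (cases P; simp | cases r; cases s; cases "snd (snd r)"; cases "snd (snd s)"; simp)+

text \<open>Both sides of the compatibility condition reduce to \<open>\<psi>\<close> by the unit laws of \<open>A\<close>.\<close>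
lemma sharp_arr_Idn:
  assumes "sharp_obj C (A, m, u) P"
  shows "sharp_arr C (A, m, u) (sharp_Idn C (A, m, u) P)"
proof -
  obtain X \<psi> where P: "P = (X, \<psi>)" by (cases P)
  have "(m \<boxtimes> Idn C X) \<cdot> (Idn C A \<boxtimes> (u \<boxtimes> Idn C X)) \<cdot> \<psi> = \<psi>"
    using assms Cmp_extend[OF mult_whisker(3), of X \<psi>] by (simp add: P hom_iff)
  moreover have "(m \<boxtimes> Idn C X) \<cdot> (Idn C A \<boxtimes> \<psi>) \<cdot> (u \<boxtimes> Idn C (X \<otimes> A)) = \<psi>"
    using assms ext_unit[of \<psi> "X \<otimes> A" X] by (simp add: P hom_iff ext_def)
  ultimately show ?thesis
    using assms by (auto simp: P hom_iff)
qed

lemma sharp_typed_Idn: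
  "sharp_obj C (A, m, u) P \<Longrightarrow> sharp_typed (sharp_Idn C (A, m, u) P)"
  by (cases P) (simp add: hom_iff)

lemma sharp_typed_Cmp:
  assumes "sharp_typed r" "sharp_typed s" "snd (snd r) = fst s"
  shows "sharp_typed (sharp_Cmp C (A, m, u) s r)"
  using assms by (cases r; cases s) (auto simp: hom_iff)

lemma sharp_typed_TenA:
  assumes "sharp_typed r" "sharp_typed s"
  shows "sharp_typed (sharp_TenA C (A, m, u) r s)"
  using assms by (cases r; cases s) auto

end

section \<open>Wreaths as algebras in \<open>T\<^sub>A\<^sup>#\<close>\<close>

lemma one_object_simps [simp]:
  "Cell0 (one_object C) = {()}" "Cell1 (one_object C) = Obj C" "Cell2 (one_object C) = Arr C"
  "Dom2 (one_object C) = Dom C" "Cod2 (one_object C) = Cod C"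
  "Id1 (one_object C) p = Unit C" "Cmp1 (one_object C) g f = TenO C f g"
  "Id2 (one_object C) = Idn C" "VCmp (one_object C) = Cmp C"
  "HCmp (one_object C) \<beta> \<alpha> = TenA C \<alpha> \<beta>"
  "hom1 (one_object C) p q = Obj C" "hom2 (one_object C) = hom C"
  by (auto simp: one_object_def hom1_def hom2_def hom_def fun_eq_iff)

lemma EM_simps [simp]:
  "Cell0 (EM K) = {M. monad_in K M}"
  "Id1 (EM K) = em_Id1 K" "Cmp1 (EM K) = em_Cmp1 K" "Id2 (EM K) = em_Id2 K"
  "VCmp (EM K) = em_VCmp K" "HCmp (EM K) = em_HCmp K"
  "hom1 (EM K) M N = {F. em_cell1 K F \<and> fst F = M \<and> snd (snd F) = N}"
  "hom2 (EM K) F G = {\<rho>. em_cell2 K \<rho> \<and> fst \<rho> = F \<and> snd (snd \<rho>) = G}"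
  by (auto simp: EM_def hom1_def hom2_def)

lemma sharp_simps [simp]:
  "Obj (sharp C \<A>) = {P. sharp_obj C \<A> P}"
  "hom (sharp C \<A>) P Q = {\<rho>. sharp_arr C \<A> \<rho> \<and> fst \<rho> = P \<and> snd (snd \<rho>) = Q}"
  "Idn (sharp C \<A>) = sharp_Idn C \<A>" "Cmp (sharp C \<A>) = sharp_Cmp C \<A>"
  "TenO (sharp C \<A>) = sharp_TenO C" "TenA (sharp C \<A>) = sharp_TenA C \<A>"
  "Unit (sharp C \<A>) = (Unit C, Idn C (fst \<A>))"
  "Assoc (sharp C \<A>) P Q R = sharp_Idn C \<A> (sharp_TenO C P (sharp_TenO C Q R))"
  "LUnit (sharp C \<A>) = sharp_Idn C \<A>" "RUnit (sharp C \<A>) = sharp_Idn C \<A>"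
  by (auto simp: sharp_def hom_def)

text \<open>Cells of \<open>EM\<close> carry their ends. These definitions add the ends \<open>((), \<A>)\<close> to the data kept by
  \<open>wreath_to_pair\<close>.\<close>
definition endo1 :: "'o \<times> 'a \<times> 'a \<Rightarrow> 'o \<times> 'a \<Rightarrow> (unit, 'o, 'a) em1" where
  "endo1 \<A> P = (((), \<A>), P, ((), \<A>))"

definition endo2 :: "'o \<times> 'a \<times> 'a \<Rightarrow> ('o \<times> 'a) \<times> 'a \<times> ('o \<times> 'a) \<Rightarrow> (unit, 'o, 'a) em2" where
  "endo2 \<A> r = (endo1 \<A> (fst r), fst (snd r), endo1 \<A> (snd (snd r)))"

fun pair_to_wreath :: "('o \<times> 'a \<times> 'a) \<times> (('o \<times> 'a) \<times> (('o \<times> 'a) \<times> 'a \<times> ('o \<times> 'a)) \<times> (('o \<times> 'a) \<times> 'a \<times> ('o \<times> 'a)))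
    \<Rightarrow> ('o, 'a) cwreath" where
  "pair_to_wreath (\<A>, (P, \<mu>, \<eta>)) = (((), \<A>), endo1 \<A> P, endo2 \<A> \<mu>, endo2 \<A> \<eta>)"

lemma endo_inject [simp]:
  "endo1 \<A> P = endo1 \<A> Q \<longleftrightarrow> P = Q" "endo2 \<A> r = endo2 \<A> s \<longleftrightarrow> r = s"
  by (cases r; cases s; auto simp: endo1_def endo2_def)+

lemma wreath_to_pair_to_wreath: "wreath_to_pair (pair_to_wreath p) = p"
  by (cases p; cases "fst (snd p)") (auto simp: endo1_def endo2_def)

text \<open>The only 0-cell occurring in a wreath is that of its monad in \<open>EM\<close>: \<open>em_cell2\<close> forces the two ends
  of a 2-cell to be parallel, and one of these ends is the endo-1-cell \<open>F\<close>. The disjunctions cover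
  the directions of the structure 2-cells of monads and of comonads.\<close>
lemma pair_to_wreath_surj:
  assumes "F \<in> hom1 (EM K) M M" "\<mu> \<in> hom2 (EM K) G F \<or> \<mu> \<in> hom2 (EM K) F G"
    and "\<eta> \<in> hom2 (EM K) H F \<or> \<eta> \<in> hom2 (EM K) F H"
  shows "pair_to_wreath (wreath_to_pair (M, F, \<mu>, \<eta>)) = (M, F, \<mu>, \<eta>)"
proof -
  obtain \<A> where M: "M = ((), \<A>)" by (cases M) auto
  obtain P where F: "F = endo1 \<A> P"
    using assms(1) by (cases F) (auto simp: endo1_def M)
  have "\<exists>r. \<nu> = endo2 \<A> r" if "\<nu> \<in> hom2 (EM K) G F \<or> \<nu> \<in> hom2 (EM K) F G" for \<nu> G
  proof -
    obtain S Q T \<rho> S' Q' T' where \<nu>: "\<nu> = ((S, Q, T), \<rho>, (S', Q', T'))"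
      by (cases \<nu>) auto
    have "em_cell2 K \<nu>" "fst \<nu> = F \<or> snd (snd \<nu>) = F"
      using that by auto
    then have "S = M \<and> T = M \<and> S' = M \<and> T' = M"
      unfolding \<nu> by (cases Q; cases Q') (auto simp: M F endo1_def)
    then show ?thesis
      by (intro exI[of _ "(Q, \<rho>, Q')"]) (simp add: \<nu> M endo2_def endo1_def)
  qed
  then obtain r s where "\<mu> = endo2 \<A> r" "\<eta> = endo2 \<A> s"
    using assms(2,3) by meson
  then show ?thesis
    using wreath_to_pair_to_wreath[of "(\<A>, (P, r, s))"] by (simp add: M F)
qed

context strict_monoidal_category
begin

lemma monad_one_object: "monad_in (one_object C) ((), \<A>) \<longleftrightarrow> algebra_in C \<A>"
proof -
  obtain A m u where A: "\<A> = (A, m, u)" by (cases \<A>)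
  show ?thesis
    unfolding A by (auto simp: hom_iff Assoc_strict LUnit_strict RUnit_strict)
qed

lemma em_cell1_endo1:
  "em_cell1 (one_object C) (endo1 \<A> P) \<longleftrightarrow> algebra_in C \<A> \<and> sharp_obj C \<A> P"
proof -
  obtain A m u X \<psi> where A: "\<A> = (A, m, u)" "P = (X, \<psi>)" by (cases \<A>; cases P)
  have "em_cell1 (one_object C) (endo1 \<A> P) \<longleftrightarrow> monad_in (one_object C) ((), \<A>) \<and> sharp_obj C \<A> P"
    unfolding A endo1_def by (auto simp del: monad_in.simps)
  then show ?thesis
    unfolding monad_one_object .
qed

lemma em_cell2_endo2:
  "em_cell2 (one_object C) (endo2 \<A> r) \<longleftrightarrow> algebra_in C \<A> \<and> sharp_arr C \<A> r"
proof -
  obtain A m u X \<psi> \<rho> Y \<phi> where A: "\<A> = (A, m, u)" "r = ((X, \<psi>), \<rho>, (Y, \<phi>))"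
    by (cases \<A>; cases r) auto
  have "em_cell2 (one_object C) (endo2 \<A> r) \<longleftrightarrow>
    em_cell1 (one_object C) (endo1 \<A> (X, \<psi>)) \<and> em_cell1 (one_object C) (endo1 \<A> (Y, \<phi>)) \<and>
    (sharp_obj C \<A> (X, \<psi>) \<and> sharp_obj C \<A> (Y, \<phi>) \<longrightarrow> sharp_arr C \<A> r)"
    using em_cell1_endo1[of \<A> "(X, \<psi>)"] em_cell1_endo1[of \<A> "(Y, \<phi>)"]
    unfolding A endo1_def endo2_def by (auto simp del: em_cell1.simps sharp_obj.simps)
  then show ?thesis
    unfolding em_cell1_endo1 A by auto
qed

end

context strict_algebra
begin

abbreviation "\<A> \<equiv> (A, m, u)"
abbreviation "K \<equiv> one_object C"

lemma em_Id1_endo1: "em_Id1 K ((), \<A>) = endo1 \<A> (\<I>, Idn C A)"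
  by (simp add: endo1_def)

lemma em_Cmp1_endo1: "em_Cmp1 K (endo1 \<A> Q) (endo1 \<A> P) = endo1 \<A> (sharp_TenO C P Q)"
  by (cases P; cases Q) (simp add: endo1_def)

lemma em_Id2_endo2: "em_Id2 K (endo1 \<A> P) = endo2 \<A> (sharp_Idn C \<A> P)"
  by (cases P) (simp add: endo1_def endo2_def)

lemma em_VCmp_endo2: "em_VCmp K (endo2 \<A> s) (endo2 \<A> r) = endo2 \<A> (sharp_Cmp C \<A> s r)"
  by (cases r; cases s; cases "snd (snd s)") (auto simp add: endo1_def endo2_def)

text \<open>The two horizontal composites use the arrow \<open>\<psi>\<close> of the source, respectively \<open>\<psi>'\<close> of the
  target, of the first factor; they agree because that factor is compatible with both.\<close>
lemma em_HCmp_endo2: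
  assumes "sharp_arr C \<A> r" "sharp_arr C \<A> s"
  shows "em_HCmp K (endo2 \<A> s) (endo2 \<A> r) = endo2 \<A> (sharp_TenA C \<A> r s)"
proof -
  obtain X \<psi> \<rho> X' \<psi>' where r: "r = ((X, \<psi>), \<rho>, (X', \<psi>'))"
    by (cases r) auto
  obtain Y \<phi> \<sigma> Y' \<phi>' where s: "s = ((Y, \<phi>), \<sigma>, (Y', \<phi>'))"
    by (cases s) auto
  have ty: "X \<in> Obj C" "\<psi> \<in> Arr C" "Dom C \<psi> = X \<otimes> A" "Cod C \<psi> = A \<otimes> X"
    "X' \<in> Obj C" "\<psi>' \<in> Arr C" "Dom C \<psi>' = X' \<otimes> A" "Cod C \<psi>' = A \<otimes> X'"
    "\<rho> \<in> Arr C" "Dom C \<rho> = X" "Cod C \<rho> = A \<otimes> X'"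
    "Y \<in> Obj C" "Y' \<in> Obj C" "\<sigma> \<in> Arr C" "Dom C \<sigma> = Y" "Cod C \<sigma> = A \<otimes> Y'"
    using assms by (auto simp: r s hom_iff)
  have "(m \<boxtimes> Idn C X') \<cdot> (Idn C A \<boxtimes> \<rho>) \<cdot> \<psi> = (m \<boxtimes> Idn C X') \<cdot> (Idn C A \<boxtimes> \<psi>') \<cdot> (\<rho> \<boxtimes> Idn C A)"
    using assms by (simp add: r)
  from arg_cong[OF this, of "\<lambda>f. (f \<boxtimes> Idn C Y') \<cdot> (Idn C X \<boxtimes> \<sigma>)"]
  have "(m \<boxtimes> Idn C (X' \<otimes> Y')) \<cdot> (Idn C A \<boxtimes> (\<rho> \<boxtimes> Idn C Y')) \<cdot> (\<psi> \<boxtimes> Idn C Y') \<cdot> (Idn C X \<boxtimes> \<sigma>)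
      = (m \<boxtimes> Idn C (X' \<otimes> Y')) \<cdot> (Idn C A \<boxtimes> (\<psi>' \<boxtimes> Idn C Y')) \<cdot> (\<rho> \<boxtimes> \<sigma>)"
    using ty interchange_right_first[of \<rho> \<sigma> X "A \<otimes> Y'"] by simp
  then show ?thesis
    using ty by (simp add: r s endo1_def endo2_def)
qed

lemma hom1_endo1:
  "endo1 \<A> P \<in> hom1 (EM K) ((), \<A>) ((), \<A>) \<longleftrightarrow> sharp_obj C \<A> P"
  using em_cell1_endo1[of \<A> P] algebra by (auto simp: endo1_def)

lemma hom2_endo2:
  "endo2 \<A> r \<in> hom2 (EM K) (endo1 \<A> P) (endo1 \<A> Q) \<longleftrightarrow> r \<in> hom (sharp C \<A>) P Q"
  using em_cell2_endo2[of \<A> r] algebra by (auto simp: endo2_def)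

lemma sharp_obj_typing:
  assumes "sharp_obj C \<A> P"
  shows "fst P \<in> Obj C" "snd P \<in> hom C (fst P \<otimes> A) (A \<otimes> fst P)"
  using assms by (cases P, simp)+

text \<open>The associativity axioms in \<open>sharp\<close> carry an associativity arrow that is absent from the axioms
  for (co)monads in a strict 2-category; here it is an identity and disappears.\<close>
lemma sharp_Assoc_Idn_TenA:
  assumes "sharp_obj C \<A> P"
  shows "\<nu> \<in> hom (sharp C \<A>) (sharp_TenO C P P) P \<Longrightarrow>
      sharp_Cmp C \<A> (sharp_TenA C \<A> (sharp_Idn C \<A> P) \<nu>) (sharp_Idn C \<A> (sharp_TenO C P (sharp_TenO C P P)))
      = sharp_TenA C \<A> (sharp_Idn C \<A> P) \<nu>"
    and "\<nu> \<in> hom (sharp C \<A>) P (sharp_TenO C P P) \<Longrightarrow>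
      sharp_Cmp C \<A> (sharp_Idn C \<A> (sharp_TenO C P (sharp_TenO C P P)))
        (sharp_Cmp C \<A> (sharp_TenA C \<A> \<nu> (sharp_Idn C \<A> P)) \<nu>)
      = sharp_Cmp C \<A> (sharp_TenA C \<A> \<nu> (sharp_Idn C \<A> P)) \<nu>"
proof -
  note P = sharp_obj_typing[OF assms] and I = sharp_typed_Idn[OF assms]
  show "\<nu> \<in> hom (sharp C \<A>) (sharp_TenO C P P) P \<Longrightarrow>
      sharp_Cmp C \<A> (sharp_TenA C \<A> (sharp_Idn C \<A> P) \<nu>) (sharp_Idn C \<A> (sharp_TenO C P (sharp_TenO C P P)))
      = sharp_TenA C \<A> (sharp_Idn C \<A> P) \<nu>"
    using sharp_Cmp_Idn(1)[OF sharp_typed_TenA[OF I, of \<nu>]] by (simp add: sharp_typed_arr)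
  assume \<nu>: "\<nu> \<in> hom (sharp C \<A>) P (sharp_TenO C P P)"
  then have "sharp_typed \<nu>" by (simp add: sharp_typed_arr)
  then have "sharp_typed (sharp_Cmp C \<A> (sharp_TenA C \<A> \<nu> (sharp_Idn C \<A> P)) \<nu>)"
    using \<nu> by (intro sharp_typed_Cmp sharp_typed_TenA I) simp_all
  from sharp_Cmp_Idn(2)[OF this] show
    "sharp_Cmp C \<A> (sharp_Idn C \<A> (sharp_TenO C P (sharp_TenO C P P)))
        (sharp_Cmp C \<A> (sharp_TenA C \<A> \<nu> (sharp_Idn C \<A> P)) \<nu>)
      = sharp_Cmp C \<A> (sharp_TenA C \<A> \<nu> (sharp_Idn C \<A> P)) \<nu>"
    using \<nu> sharp_TenO_assoc[OF P P P] by simp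
qed

text \<open>Horizontal composition reverses the order of the tensor factors, so the left (right) unit law of
  the monad is the right (left) unit law of the algebra.\<close>
lemma monad_pair_to_wreath:
  "monad_in (EM K) (pair_to_wreath (\<A>, (P, \<mu>, \<eta>))) \<longleftrightarrow> algebra_in (sharp C \<A>) (P, \<mu>, \<eta>)"
proof -
  \<comment> \<open>The base monad and the membership in hom-sets stay folded, so that they are translated as a whole.\<close>
  note [simp del] = monad_in.simps algebra_in.simps sharp_obj.simps em_Id1.simps EM_simps(7,8) sharp_simps(2)
  note [simp] = hom1_endo1 hom2_endo2 em_Id1_endo1 em_Cmp1_endo1 em_Id2_endo2 em_VCmp_endo2
  have M: "monad_in K ((), \<A>)"
    using algebra monad_one_object by simp
  show ?thesis
  proof (cases "sharp_obj C \<A> P \<and> \<mu> \<in> hom (sharp C \<A>) (sharp_TenO C P P) P \<and> \<eta> \<in> hom (sharp C \<A>) (\<I>, Idn C A) P")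
    case True
    then have "sharp_arr C \<A> \<mu>" "sharp_arr C \<A> \<eta>" "sharp_arr C \<A> (sharp_Idn C \<A> P)"
      by (auto intro: sharp_arr_Idn simp: sharp_simps(2))
    with True M show ?thesis
      by (auto simp: monad_in.simps[of "EM K"] algebra_in.simps[of "sharp C \<A>"] em_HCmp_endo2
          sharp_Assoc_Idn_TenA(1))
  next
    case False
    then show ?thesis
      by (auto simp: monad_in.simps[of "EM K"] algebra_in.simps[of "sharp C \<A>"])
  qed
qed

lemma comonad_pair_to_wreath:
  "comonad_in (EM K) (pair_to_wreath (\<A>, (P, \<delta>, \<epsilon>))) \<longleftrightarrow> coalgebra_in (sharp C \<A>) (P, \<delta>, \<epsilon>)"
proof -
  note [simp del] = monad_in.simps sharp_obj.simps em_Id1.simps EM_simps(7,8) sharp_simps(2)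
  note [simp] = hom1_endo1 hom2_endo2 em_Id1_endo1 em_Cmp1_endo1 em_Id2_endo2 em_VCmp_endo2
  have M: "monad_in K ((), \<A>)"
    using algebra monad_one_object by simp
  show ?thesis
  proof (cases "sharp_obj C \<A> P \<and> \<delta> \<in> hom (sharp C \<A>) P (sharp_TenO C P P) \<and> \<epsilon> \<in> hom (sharp C \<A>) P (\<I>, Idn C A)")
    case True
    then have ar: "sharp_arr C \<A> \<delta>" "sharp_arr C \<A> \<epsilon>" "sharp_arr C \<A> (sharp_Idn C \<A> P)"
      by (auto intro: sharp_arr_Idn simp: sharp_simps(2))
    have "sharp_typed (sharp_Cmp C \<A> (sharp_TenA C \<A> r s) \<delta>)"
      if "sharp_arr C \<A> r" "sharp_arr C \<A> s" "fst r = P" "fst s = P" for r s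
      using True ar that by (intro sharp_typed_Cmp sharp_typed_TenA sharp_typed_arr) (auto simp: sharp_simps(2))
    note ty = this
    have "sharp_Cmp C \<A> (sharp_Idn C \<A> P) (sharp_Cmp C \<A> (sharp_TenA C \<A> \<epsilon> (sharp_Idn C \<A> P)) \<delta>)
        = sharp_Cmp C \<A> (sharp_TenA C \<A> \<epsilon> (sharp_Idn C \<A> P)) \<delta>"
      "sharp_Cmp C \<A> (sharp_Idn C \<A> P) (sharp_Cmp C \<A> (sharp_TenA C \<A> (sharp_Idn C \<A> P) \<epsilon>) \<delta>)
        = sharp_Cmp C \<A> (sharp_TenA C \<A> (sharp_Idn C \<A> P) \<epsilon>) \<delta>"
      using sharp_Cmp_Idn(2)[OF ty, of \<epsilon> "sharp_Idn C \<A> P"] sharp_Cmp_Idn(2)[OF ty, of "sharp_Idn C \<A> P" \<epsilon>]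
        True ar sharp_TenO_Unit[OF sharp_obj_typing, of P] by (auto simp: sharp_simps(2))
    with True M ar show ?thesis
      by (auto simp: em_HCmp_endo2 sharp_Assoc_Idn_TenA(2))
  next
    case False
    then show ?thesis
      by auto
  qed
qed

end

lemma bij_betw_wreath_to_pair:
  assumes inv: "\<And>W. Q W \<Longrightarrow> pair_to_wreath (wreath_to_pair W) = W"
    and iff: "\<And>\<A> \<X>. Q (pair_to_wreath (\<A>, \<X>)) \<longleftrightarrow> R \<A> \<X>"
  shows "bij_betw wreath_to_pair {W. Q W} {(\<A>, \<X>). R \<A> \<X>}"
proof (rule bij_betw_byWitness[of _ pair_to_wreath])
  show "\<forall>W\<in>{W. Q W}. pair_to_wreath (wreath_to_pair W) = W"
    using inv by simp
  show "\<forall>p\<in>{(\<A>, \<X>). R \<A> \<X>}. wreath_to_pair (pair_to_wreath p) = p"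
    using wreath_to_pair_to_wreath by blast
  show "wreath_to_pair ` {W. Q W} \<subseteq> {(\<A>, \<X>). R \<A> \<X>}"
    using inv by (auto simp flip: iff)
  show "pair_to_wreath ` {(\<A>, \<X>). R \<A> \<X>} \<subseteq> {W. Q W}"
    using iff by (auto simp del: pair_to_wreath.simps)
qed

theorem (in strict_monoidal_category) wreath_bij_algebra:
  "bij_betw wreath_to_pair {W. wreath (one_object C) W}
     {(\<A>, \<X>). algebra_in C \<A> \<and> algebra_in (sharp C \<A>) \<X>}"
proof (rule bij_betw_wreath_to_pair)
  fix W assume W: "wreath (one_object C) W"
  obtain M F \<mu> \<eta> where e: "W = (M, F, \<mu>, \<eta>)" by (cases W)
  show "pair_to_wreath (wreath_to_pair W) = W"
    using W unfolding e wreath_def monad_in.simps[of "EM (one_object C)"]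
    by (intro pair_to_wreath_surj) blast+
next
  fix \<A> \<X>
  show "wreath (one_object C) (pair_to_wreath (\<A>, \<X>)) \<longleftrightarrow> algebra_in C \<A> \<and> algebra_in (sharp C \<A>) \<X>"
  proof (cases "algebra_in C \<A>")
    case True
    obtain A m u P \<mu> \<eta> where e: "\<A> = (A, m, u)" "\<X> = (P, \<mu>, \<eta>)" by (cases \<A>; cases \<X>)
    interpret strict_algebra C A m u
      using True by unfold_locales (simp add: e)
    show ?thesis
      using True monad_pair_to_wreath by (simp only: e wreath_def simp_thms)
  next
    case False
    then show ?thesis
      using monad_one_object[of \<A>] by (cases \<X>) (auto simp: wreath_def simp del: algebra_in.simps)
  qed
qed

theorem (in strict_monoidal_category) cowreath_bij_coalgebra:
  "bij_betw wreath_to_pair {W. cowreath (one_object C) W}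
     {(\<A>, \<X>). algebra_in C \<A> \<and> coalgebra_in (sharp C \<A>) \<X>}"
proof (rule bij_betw_wreath_to_pair)
  fix W assume W: "cowreath (one_object C) W"
  obtain M F \<delta> \<epsilon> where e: "W = (M, F, \<delta>, \<epsilon>)" by (cases W)
  show "pair_to_wreath (wreath_to_pair W) = W"
    using W unfolding e cowreath_def comonad_in.simps[of "EM (one_object C)"]
    by (intro pair_to_wreath_surj) blast+
next
  fix \<A> \<X>
  show "cowreath (one_object C) (pair_to_wreath (\<A>, \<X>)) \<longleftrightarrow> algebra_in C \<A> \<and> coalgebra_in (sharp C \<A>) \<X>"
  proof (cases "algebra_in C \<A>")
    case True
    obtain A m u P \<delta> \<epsilon> where e: "\<A> = (A, m, u)" "\<X> = (P, \<delta>, \<epsilon>)" by (cases \<A>; cases \<X>)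
    interpret strict_algebra C A m u
      using True by unfold_locales (simp add: e)
    show ?thesis
      using True comonad_pair_to_wreath by (simp only: e cowreath_def simp_thms)
  next
    case False
    then show ?thesis
      using monad_one_object[of \<A>] by (cases \<X>) (auto simp: cowreath_def simp del: algebra_in.simps)
  qed
qed

section \<open>Modules that are free on the left\<close>

context strict_algebra
begin

text \<open>The isomorphism \<open>b\<close> identifies the left module \<open>Y\<close> with the free left module \<open>A \<otimes> X\<close>.\<close>
definition free_on :: "'o \<Rightarrow> 'a \<Rightarrow> 'o \<times> 'a \<Rightarrow> bool" where
  "free_on X b Y \<longleftrightarrow> X \<in> Obj C \<and> is_iso C b \<and> b \<in> hom C (A \<otimes> X) (fst Y) \<and>
     snd Y \<in> hom C (A \<otimes> fst Y) (fst Y) \<and> b \<cdot> (m \<boxtimes> Idn C X) = snd Y \<cdot> (Idn C A \<boxtimes> b)"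

lemma free_onE:
  assumes "free_on X b (Y, l)"
  obtains b' where "X \<in> Obj C" "Y \<in> Obj C" "b \<in> Arr C" "Dom C b = A \<otimes> X" "Cod C b = Y"
    "l \<in> Arr C" "Dom C l = A \<otimes> Y" "Cod C l = Y" "b \<cdot> (m \<boxtimes> Idn C X) = l \<cdot> (Idn C A \<boxtimes> b)"
    "b' \<in> Arr C" "Dom C b' = Y" "Cod C b' = A \<otimes> X" "b' \<cdot> b = Idn C (A \<otimes> X)" "b \<cdot> b' = Idn C Y"
    "b' \<cdot> l = (m \<boxtimes> Idn C X) \<cdot> (Idn C A \<boxtimes> b')"
proof -
  have t: "X \<in> Obj C" "is_iso C b" "b \<in> Arr C" "Dom C b = A \<otimes> X" "Cod C b = Y"
    "l \<in> Arr C" "Dom C l = A \<otimes> Y" "Cod C l = Y" and e: "b \<cdot> (m \<boxtimes> Idn C X) = l \<cdot> (Idn C A \<boxtimes> b)"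
    using assms by (auto simp: free_on_def hom_iff)
  obtain b' where b': "b' \<in> Arr C" "Dom C b' = Y" "Cod C b' = A \<otimes> X" "b' \<cdot> b = Idn C (A \<otimes> X)" "b \<cdot> b' = Idn C Y"
    using iso_inverse[OF t(2)] t(4,5) by metis
  have Y: "Y \<in> Obj C" using t by auto
  have "b' \<cdot> l = b' \<cdot> (l \<cdot> (Idn C A \<boxtimes> (b \<cdot> b')))"
    using t b' Y by (simp del: whisker_left)
  also have "\<dots> = b' \<cdot> (b \<cdot> (m \<boxtimes> Idn C X)) \<cdot> (Idn C A \<boxtimes> b')"
    unfolding e using t(1-8) b'(1-3) Y by simp
  also have "\<dots> = (m \<boxtimes> Idn C X) \<cdot> (Idn C A \<boxtimes> b')"
    using t(1-8) b'(1-3) Y Cmp_extend[OF b'(4)] by simp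
  finally show ?thesis
    using that[of b'] t e b' Y by simp
qed

text \<open>The module laws of \<open>A \<otimes> X\<close> are those of \<open>mult_whisker\<close>; they are carried over along the inverse of \<open>b\<close>.\<close>
lemma free_on_left_module:
  assumes "free_on X b (Y, l)"
  shows "left_module C (A, m, u) (Y, l)"
  using assms
proof (rule free_onE)
  fix b'
  assume t: "X \<in> Obj C" "Y \<in> Obj C" "b \<in> Arr C" "Dom C b = A \<otimes> X" "Cod C b = Y"
    "l \<in> Arr C" "Dom C l = A \<otimes> Y" "Cod C l = Y" and e: "b \<cdot> (m \<boxtimes> Idn C X) = l \<cdot> (Idn C A \<boxtimes> b)"
    and b': "b' \<in> Arr C" "Dom C b' = Y" "Cod C b' = A \<otimes> X" "b' \<cdot> b = Idn C (A \<otimes> X)" "b \<cdot> b' = Idn C Y"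
    and e': "b' \<cdot> l = (m \<boxtimes> Idn C X) \<cdot> (Idn C A \<boxtimes> b')"
  have iso: "is_iso C b'"
    using t b' by (intro is_isoI[of _ b]) simp_all
  have "b' \<cdot> (l \<cdot> (m \<boxtimes> Idn C Y)) = (m \<boxtimes> Idn C X) \<cdot> ((Idn C A \<boxtimes> b') \<cdot> (m \<boxtimes> Idn C Y))"
    using t b'(1-3) Cmp_extend[OF e'] by simp
  also have "(Idn C A \<boxtimes> b') \<cdot> (m \<boxtimes> Idn C Y) = (m \<boxtimes> Idn C (A \<otimes> X)) \<cdot> (Idn C (A \<otimes> A) \<boxtimes> b')"
    using t b'(1-3) interchange_arr[of m b' "A \<otimes> A" A Y "A \<otimes> X"] by simp
  also have "(m \<boxtimes> Idn C X) \<cdot> ((m \<boxtimes> Idn C (A \<otimes> X)) \<cdot> (Idn C (A \<otimes> A) \<boxtimes> b'))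
      = (m \<boxtimes> Idn C X) \<cdot> (Idn C A \<boxtimes> ((m \<boxtimes> Idn C X) \<cdot> (Idn C A \<boxtimes> b')))"
    using t b'(1-3) by (subst Cmp_extend[OF mult_whisker(1)]) simp_all
  also have "\<dots> = b' \<cdot> (l \<cdot> (Idn C A \<boxtimes> l))"
    unfolding e'[symmetric] using t b'(1-3) Cmp_extend[OF e'] by simp
  finally have 1: "l \<cdot> (m \<boxtimes> Idn C Y) = l \<cdot> (Idn C A \<boxtimes> l)"
    by (rule iso_cancel_left[OF _ iso]) (use t b'(1-3) in simp_all)
  have "b' \<cdot> (l \<cdot> (u \<boxtimes> Idn C Y)) = (m \<boxtimes> Idn C X) \<cdot> ((Idn C A \<boxtimes> b') \<cdot> (u \<boxtimes> Idn C Y))"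
    using t b'(1-3) Cmp_extend[OF e'] by simp
  also have "(Idn C A \<boxtimes> b') \<cdot> (u \<boxtimes> Idn C Y) = (u \<boxtimes> Idn C (A \<otimes> X)) \<cdot> b'"
    using t b'(1-3) interchange_arr[of u b' "\<I>" A Y "A \<otimes> X"] by simp
  also have "(m \<boxtimes> Idn C X) \<cdot> ((u \<boxtimes> Idn C (A \<otimes> X)) \<cdot> b') = b' \<cdot> Idn C Y"
    using t b'(1-3) by (subst Cmp_extend[OF mult_whisker(2)]) simp_all
  finally have 2: "l \<cdot> (u \<boxtimes> Idn C Y) = Idn C Y"
    by (rule iso_cancel_left[OF _ iso]) (use t b'(1-3) in simp_all)
  show ?thesis
    using t 1 2 by (simp add: hom_iff)
qed

text \<open>For \<open>Y = A \<otimes> X\<close> the arrow is the action \<open>r \<otimes> X\<close>, which identifies \<open>Z \<otimes>\<^sub>A (A \<otimes> X)\<close> with \<open>Z \<otimes> X\<close>.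
  Both splittings insert the unit of \<open>A\<close> before \<open>X\<close>: \<open>s\<close> embeds \<open>Z \<otimes> X\<close> into \<open>Z \<otimes> Y\<close>, and \<open>t\<close> keeps the
  factor \<open>A\<close> of \<open>Y\<close> as the middle one of \<open>Z \<otimes> A \<otimes> Y\<close>.\<close>
lemma free_on_coequalizer:
  assumes r: "r \<in> Arr C" "Dom C r = Z \<otimes> A" "Cod C r = Z" "Z \<in> Obj C"
      "r \<cdot> (Idn C Z \<boxtimes> m) = r \<cdot> (r \<boxtimes> Idn C A)" "r \<cdot> (Idn C Z \<boxtimes> u) = Idn C Z"
    and t: "X \<in> Obj C" "Y \<in> Obj C" "b \<in> Arr C" "Dom C b = A \<otimes> X" "Cod C b = Y"
    "l \<in> Arr C" "Dom C l = A \<otimes> Y" "Cod C l = Y" and e: "b \<cdot> (m \<boxtimes> Idn C X) = l \<cdot> (Idn C A \<boxtimes> b)"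
    and b': "b' \<in> Arr C" "Dom C b' = Y" "Cod C b' = A \<otimes> X" "b' \<cdot> b = Idn C (A \<otimes> X)" "b \<cdot> b' = Idn C Y"
    and e': "b' \<cdot> l = (m \<boxtimes> Idn C X) \<cdot> (Idn C A \<boxtimes> b')"
  shows "is_coequalizer C (r \<boxtimes> Idn C Y) (Idn C Z \<boxtimes> l) ((r \<boxtimes> Idn C X) \<cdot> (Idn C Z \<boxtimes> b'))"
proof -
  note ty = r(1-4) t b'(1-3)
  let ?p = "(r \<boxtimes> Idn C X) \<cdot> (Idn C Z \<boxtimes> b')"
  let ?s = "Idn C Z \<boxtimes> (b \<cdot> (u \<boxtimes> Idn C X))"
  let ?t = "Idn C Z \<boxtimes> ((Idn C A \<boxtimes> (b \<cdot> (u \<boxtimes> Idn C X))) \<cdot> b')"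
  have rm: "(r \<boxtimes> Idn C X) \<cdot> (r \<boxtimes> Idn C (A \<otimes> X)) = (r \<boxtimes> Idn C X) \<cdot> (Idn C Z \<boxtimes> (m \<boxtimes> Idn C X))"
    using arg_cong[OF r(5), of "\<lambda>f. f \<boxtimes> Idn C X"] ty by simp
  have ru: "(r \<boxtimes> Idn C X) \<cdot> (Idn C Z \<boxtimes> (u \<boxtimes> Idn C X)) = Idn C (Z \<otimes> X)"
    using arg_cong[OF r(6), of "\<lambda>f. f \<boxtimes> Idn C X"] ty by simp
  have "?p \<cdot> (r \<boxtimes> Idn C Y) = (r \<boxtimes> Idn C X) \<cdot> ((Idn C Z \<boxtimes> b') \<cdot> (r \<boxtimes> Idn C Y))"
    using ty by simp
  also have "(Idn C Z \<boxtimes> b') \<cdot> (r \<boxtimes> Idn C Y) = (r \<boxtimes> Idn C (A \<otimes> X)) \<cdot> (Idn C (Z \<otimes> A) \<boxtimes> b')"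
    using ty interchange_arr[of r b' "Z \<otimes> A" Z Y "A \<otimes> X"] by simp
  also have "(r \<boxtimes> Idn C X) \<cdot> ((r \<boxtimes> Idn C (A \<otimes> X)) \<cdot> (Idn C (Z \<otimes> A) \<boxtimes> b'))
      = (r \<boxtimes> Idn C X) \<cdot> (Idn C Z \<boxtimes> ((m \<boxtimes> Idn C X) \<cdot> (Idn C A \<boxtimes> b')))"
    using ty by (subst Cmp_extend[OF rm]) simp_all
  also have "\<dots> = ?p \<cdot> (Idn C Z \<boxtimes> l)"
    unfolding e'[symmetric] using ty by simp
  finally have 1: "?p \<cdot> (r \<boxtimes> Idn C Y) = ?p \<cdot> (Idn C Z \<boxtimes> l)" .
  have "?p \<cdot> ?s = (r \<boxtimes> Idn C X) \<cdot> ((Idn C Z \<boxtimes> (b' \<cdot> b)) \<cdot> (Idn C Z \<boxtimes> (u \<boxtimes> Idn C X)))"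
    using ty by simp
  also have "\<dots> = Idn C (Z \<otimes> X)"
    unfolding b'(4) using ty ru by simp
  finally have 2: "?p \<cdot> ?s = Idn C (Z \<otimes> X)" .
  have "(r \<boxtimes> Idn C Y) \<cdot> ?t = ((r \<boxtimes> Idn C Y) \<cdot> (Idn C (Z \<otimes> A) \<boxtimes> (b \<cdot> (u \<boxtimes> Idn C X)))) \<cdot> (Idn C Z \<boxtimes> b')"
    using ty by simp
  also have "(r \<boxtimes> Idn C Y) \<cdot> (Idn C (Z \<otimes> A) \<boxtimes> (b \<cdot> (u \<boxtimes> Idn C X))) = ?s \<cdot> (r \<boxtimes> Idn C X)"
    using ty interchange_arr[of r "b \<cdot> (u \<boxtimes> Idn C X)" "Z \<otimes> A" Z X Y] by simp
  also have "(?s \<cdot> (r \<boxtimes> Idn C X)) \<cdot> (Idn C Z \<boxtimes> b') = ?s \<cdot> ?p"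
    using ty by simp
  finally have 3: "(r \<boxtimes> Idn C Y) \<cdot> ?t = ?s \<cdot> ?p" .
  have "(Idn C Z \<boxtimes> l) \<cdot> ?t = Idn C Z \<boxtimes> ((l \<cdot> (Idn C A \<boxtimes> b)) \<cdot> (Idn C A \<boxtimes> (u \<boxtimes> Idn C X)) \<cdot> b')"
    using ty by simp
  also have "\<dots> = Idn C Z \<boxtimes> (b \<cdot> (((m \<boxtimes> Idn C X) \<cdot> (Idn C A \<boxtimes> (u \<boxtimes> Idn C X))) \<cdot> b'))"
    unfolding e[symmetric] using ty by simp
  also have "\<dots> = Idn C (Z \<otimes> Y)"
    unfolding mult_whisker(3)[OF t(1)] using ty b' by (simp del: whisker_left)
  finally have 4: "(Idn C Z \<boxtimes> l) \<cdot> ?t = Idn C (Z \<otimes> Y)" .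
  show ?thesis
    by (rule split_coequalizer[where s = ?s and t = ?t]) (use ty 1 2 3 4 in simp_all)
qed

end

lemma (in strict_monoidal_category) left_coflat_TenO:
  assumes "left_coflat C X" "left_coflat C Y"
  shows "left_coflat C (X \<otimes> Y)"
  unfolding left_coflat_def
proof (intro conjI allI impI)
  have XY: "X \<in> Obj C" "Y \<in> Obj C"
    using assms by (simp_all add: left_coflat_def)
  then show "X \<otimes> Y \<in> Obj C" by simp
  fix f g q assume q: "is_coequalizer C f g q"
  note t = coequalizer_typing[OF q]
  have "is_coequalizer C ((f \<boxtimes> Idn C X) \<boxtimes> Idn C Y) ((g \<boxtimes> Idn C X) \<boxtimes> Idn C Y) ((q \<boxtimes> Idn C X) \<boxtimes> Idn C Y)"
    using assms q by (simp add: left_coflat_def)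
  then show "is_coequalizer C (f \<boxtimes> Idn C (X \<otimes> Y)) (g \<boxtimes> Idn C (X \<otimes> Y)) (q \<boxtimes> Idn C (X \<otimes> Y))"
    using t XY by simp
qed

lemma (in strict_monoidal_category) left_coflat_Unit: "left_coflat C \<I>"
proof -
  have "is_coequalizer C (f \<boxtimes> Idn C \<I>) (g \<boxtimes> Idn C \<I>) (q \<boxtimes> Idn C \<I>)"
    if "is_coequalizer C f g q" for f g q
    using that coequalizer_typing(1-3)[OF that] by simp
  then show ?thesis
    by (simp add: left_coflat_def)
qed

text \<open>Being a coequalizer transports along the isomorphisms \<open>W \<otimes> b\<close>.\<close>
lemma (in strict_monoidal_category) left_coflat_iso:
  assumes "left_coflat C X" and b: "is_iso C b" "Dom C b = X" "Cod C b = Y"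
  shows "left_coflat C Y"
  unfolding left_coflat_def
proof (intro conjI allI impI)
  have XY: "X \<in> Obj C" "Y \<in> Obj C" "b \<in> Arr C"
    using assms by (auto simp: is_iso_def)
  show "Y \<in> Obj C" by fact
  fix f g q assume q: "is_coequalizer C f g q"
  note t = coequalizer_typing[OF q]
  have iso: "is_iso C (Idn C W \<boxtimes> b)" if "W \<in> Obj C" for W
    using that b by (intro is_iso_TenA is_iso_Idn)
  have s: "(h \<boxtimes> Idn C Y) \<cdot> (Idn C (Dom C h) \<boxtimes> b) = (Idn C (Cod C h) \<boxtimes> b) \<cdot> (h \<boxtimes> Idn C X)"
    if "h \<in> Arr C" for h
    using that b XY by (intro interchange_arr) simp_all
  have qX: "is_coequalizer C (f \<boxtimes> Idn C X) (g \<boxtimes> Idn C X) (q \<boxtimes> Idn C X)"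
    using assms q by (simp add: left_coflat_def)
  show "is_coequalizer C (f \<boxtimes> Idn C Y) (g \<boxtimes> Idn C Y) (q \<boxtimes> Idn C Y)"
    by (rule coequalizer_iso_transport[OF qX, where a = "Idn C (Dom C f) \<boxtimes> b"
          and b = "Idn C (Cod C f) \<boxtimes> b" and c = "Idn C (Cod C q) \<boxtimes> b"])
      (use t XY b iso s[of f] s[of g] s[of q] in simp_all)
qed

locale strict_algebra_coequalizers = strict_algebra C A m u
  for C :: "('o, 'a) moncat" (structure) and A m u +
  assumes coequalizers: "has_coequalizers C"
begin

text \<open>The projection onto \<open>Z \<otimes>\<^sub>A Y\<close> agrees with \<open>r \<otimes> X\<close> up to an isomorphism \<open>j\<close>. It is stated after
  composition with \<open>Z \<otimes> b\<close>, which avoids the inverse of \<open>b\<close>.\<close>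
lemma tensor_proj_free:
  assumes r: "right_module C (A, m, u) (Z, r)" and b: "free_on X b (Y, l)"
  obtains j where "is_iso C j" "Dom C j = Z \<otimes> X" "Cod C j = Cod C (tensor_proj C (Z, r) (Y, l))"
    "tensor_proj C (Z, r) (Y, l) \<cdot> (Idn C Z \<boxtimes> b) = j \<cdot> (r \<boxtimes> Idn C X)"
    "is_coequalizer C (r \<boxtimes> Idn C Y) (Idn C Z \<boxtimes> l) (tensor_proj C (Z, r) (Y, l))"
  using b
proof (rule free_onE)
  fix b'
  assume t: "X \<in> Obj C" "Y \<in> Obj C" "b \<in> Arr C" "Dom C b = A \<otimes> X" "Cod C b = Y"
    "l \<in> Arr C" "Dom C l = A \<otimes> Y" "Cod C l = Y" and e: "b \<cdot> (m \<boxtimes> Idn C X) = l \<cdot> (Idn C A \<boxtimes> b)"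
    and b': "b' \<in> Arr C" "Dom C b' = Y" "Cod C b' = A \<otimes> X" "b' \<cdot> b = Idn C (A \<otimes> X)" "b \<cdot> b' = Idn C Y"
    and e': "b' \<cdot> l = (m \<boxtimes> Idn C X) \<cdot> (Idn C A \<boxtimes> b')"
  have r: "r \<in> Arr C" "Dom C r = Z \<otimes> A" "Cod C r = Z" "Z \<in> Obj C"
      "r \<cdot> (Idn C Z \<boxtimes> m) = r \<cdot> (r \<boxtimes> Idn C A)" "r \<cdot> (Idn C Z \<boxtimes> u) = Idn C Z"
    using r by (auto simp: hom_iff)
  let ?p = "(r \<boxtimes> Idn C X) \<cdot> (Idn C Z \<boxtimes> b')"
  have p: "is_coequalizer C (r \<boxtimes> Idn C Y) (Idn C Z \<boxtimes> l) ?p"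
    by (rule free_on_coequalizer) fact+
  have q: "is_coequalizer C (r \<boxtimes> Idn C Y) (Idn C Z \<boxtimes> l) (tensor_proj C (Z, r) (Y, l))"
    using r t coequalizers by (simp add: coequalizer_of_pair)
  show thesis
  proof (rule coequalizer_comparison[OF p q])
    fix j assume j: "is_iso C j" "Dom C j = Cod C ?p" "Cod C j = Cod C (tensor_proj C (Z, r) (Y, l))"
      "j \<cdot> ?p = tensor_proj C (Z, r) (Y, l)"
    have jt: "j \<in> Arr C" "Dom C j = Z \<otimes> X"
      using j(1,2) r t b' by (auto simp: is_iso_def)
    have "(j \<cdot> ?p) \<cdot> (Idn C Z \<boxtimes> b) = j \<cdot> ((r \<boxtimes> Idn C X) \<cdot> (Idn C Z \<boxtimes> (b' \<cdot> b)))"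
      using jt r t b'(1-3) by simp
    also have "\<dots> = j \<cdot> (r \<boxtimes> Idn C X)"
      unfolding b'(4) using jt r t by simp
    finally show thesis
      using that[of j] j(1,3) jt(2) q unfolding j(4) by blast
  qed
qed

text \<open>The explicit coequalizer for \<open>M \<otimes> Z\<close> is \<open>M\<close> tensored with the one for \<open>Z\<close>, so the canonical
  arrow is built from the two comparison isomorphisms.\<close>
lemma free_on_left_robust:
  assumes b: "free_on X b (Y, l)"
  shows "left_robust C (A, m, u) (Y, l)"
  unfolding left_robust_def
proof (intro conjI allI impI)
  show "left_module C (A, m, u) (Y, l)"
    using b by (rule free_on_left_module)
  fix M Z r assume a: "M \<in> Obj C \<and> right_module C (A, m, u) (Z, r)"
  then have M: "M \<in> Obj C" and r: "right_module C (A, m, u) (Z, r)" by auto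
  have t: "r \<in> Arr C" "Dom C r = Z \<otimes> A" "Cod C r = Z" "Z \<in> Obj C"
      and rl: "r \<cdot> (Idn C Z \<boxtimes> m) = r \<cdot> (r \<boxtimes> Idn C A)" "r \<cdot> (Idn C Z \<boxtimes> u) = Idn C Z"
    using r by (auto simp: hom_iff)
  have bt: "X \<in> Obj C" "Y \<in> Obj C" "b \<in> Arr C" "Dom C b = A \<otimes> X" "Cod C b = Y" "is_iso C b"
    "l \<in> Arr C" "Dom C l = A \<otimes> Y" "Cod C l = Y"
    using b by (auto simp: free_on_def hom_iff)
  have rM: "right_module C (A, m, u) (M \<otimes> Z, Idn C M \<boxtimes> r)"
    using t M arg_cong[OF rl(1), of "\<lambda>f. Idn C M \<boxtimes> f"] arg_cong[OF rl(2), of "\<lambda>f. Idn C M \<boxtimes> f"]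
    by (simp add: hom_iff)
  define q where "q = tensor_proj C (Z, r) (Y, l)"
  define qM where "qM = tensor_proj C (M \<otimes> Z, Idn C M \<boxtimes> r) (Y, l)"
  obtain j where j: "is_iso C j" "Dom C j = Z \<otimes> X" "Cod C j = Cod C q"
    "q \<cdot> (Idn C Z \<boxtimes> b) = j \<cdot> (r \<boxtimes> Idn C X)" "is_coequalizer C (r \<boxtimes> Idn C Y) (Idn C Z \<boxtimes> l) q"
    unfolding q_def by (rule tensor_proj_free[OF r b])
  obtain jM where jM: "is_iso C jM" "Dom C jM = (M \<otimes> Z) \<otimes> X" "Cod C jM = Cod C qM"
    "qM \<cdot> (Idn C (M \<otimes> Z) \<boxtimes> b) = jM \<cdot> ((Idn C M \<boxtimes> r) \<boxtimes> Idn C X)"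
    "is_coequalizer C ((Idn C M \<boxtimes> r) \<boxtimes> Idn C Y) (Idn C (M \<otimes> Z) \<boxtimes> l) qM"
    unfolding qM_def by (rule tensor_proj_free[OF rM b])
  obtain jM' where jM': "jM \<in> Arr C" "jM' \<in> Arr C" "Dom C jM' = Cod C jM" "Cod C jM' = Dom C jM"
    "jM' \<cdot> jM = Idn C (Dom C jM)" "jM \<cdot> jM' = Idn C (Cod C jM)"
    using jM(1) by (rule iso_inverse)
  have jt: "j \<in> Arr C" using j(1) by (simp add: is_iso_def)
  have qt: "q \<in> Arr C" "Dom C q = Z \<otimes> Y"
    using coequalizer_typing[OF j(5)] t bt by simp_all
  have qMt: "qM \<in> Arr C" "Dom C qM = M \<otimes> Z \<otimes> Y"
    using coequalizer_typing[OF jM(5)] t bt M by simp_all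
  note ty = t bt(1-5,7-9) M jM'(1-4) jM(2,3) jt j(2,3) qt qMt
  \<comment> \<open>Both projections factor through the action on \<open>Z\<close>, so this is forced to be the canonical arrow.\<close>
  let ?k = "(Idn C M \<boxtimes> j) \<cdot> jM'"
  have "(?k \<cdot> qM) \<cdot> (Idn C (M \<otimes> Z) \<boxtimes> b) = (Idn C M \<boxtimes> j) \<cdot> (jM' \<cdot> jM) \<cdot> (Idn C M \<boxtimes> (r \<boxtimes> Idn C X))"
    using ty jM(4) by simp
  also have "\<dots> = Idn C M \<boxtimes> (j \<cdot> (r \<boxtimes> Idn C X))"
    unfolding jM'(5) using ty by simp
  also have "\<dots> = (Idn C M \<boxtimes> q) \<cdot> (Idn C (M \<otimes> Z) \<boxtimes> b)"
    unfolding j(4)[symmetric] using ty by simp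
  finally have "?k \<cdot> qM = Idn C M \<boxtimes> q"
    by (rule iso_cancel_right) (use ty in \<open>simp_all add: is_iso_TenA is_iso_Idn bt(6)\<close>)
  moreover have "factor C qM (?k \<cdot> qM) = ?k"
    using jM(5) by (rule factor_of_Cmp) (use ty in simp_all)
  moreover have "is_iso C ?k"
    using ty j(1) M jM' jM(2)
    by (intro is_iso_Cmp is_iso_TenA is_iso_Idn is_isoI[of jM' jM]) simp_all
  ultimately show "is_iso C (factor C (tensor_proj C (M \<otimes> Z, Idn C M \<boxtimes> r) (Y, l)) (Idn C M \<boxtimes> tensor_proj C (Z, r) (Y, l)))"
    by (simp only: q_def qM_def)
qed

end

section \<open>Bimodules presented by objects of \<open>T\<^sub>A\<^sup>#\<close>\<close>

text \<open>An object \<open>(X, \<psi>)\<close> of \<open>T\<^sub>A\<^sup>#\<close>, an isomorphism from \<open>A \<otimes> X\<close>, and the bimodule that it reaches.\<close>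
type_synonym ('o, 'a) presentation = "('o \<times> 'a) \<times> 'a \<times> ('o, 'a) bimod"

context strict_algebra
begin

lemma sharp_obj_facts:
  assumes "sharp_obj C \<A> (X, \<psi>)"
  shows "X \<in> Obj C" "\<psi> \<in> Arr C" "Dom C \<psi> = X \<otimes> A" "Cod C \<psi> = A \<otimes> X"
    "\<psi> \<cdot> (Idn C X \<boxtimes> m) = ext \<psi> X \<cdot> (\<psi> \<boxtimes> Idn C A)" "\<psi> \<cdot> (Idn C X \<boxtimes> u) = u \<boxtimes> Idn C X"
    "ext \<psi> X \<in> Arr C" "Dom C (ext \<psi> X) = A \<otimes> X \<otimes> A" "Cod C (ext \<psi> X) = A \<otimes> X"
  using assms by (auto simp: hom_iff ext_def)

text \<open>The axioms on \<open>\<psi>\<close> say that \<open>ext \<psi> X\<close> is a right action on \<open>A \<otimes> X\<close>; being an extension, it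
  commutes with the left action.\<close>
lemma ext_right_action:
  assumes "sharp_obj C \<A> (X, \<psi>)"
  shows "ext \<psi> X \<cdot> (ext \<psi> X \<boxtimes> Idn C A) = ext \<psi> X \<cdot> (Idn C (A \<otimes> X) \<boxtimes> m)"
    and "ext \<psi> X \<cdot> (Idn C (A \<otimes> X) \<boxtimes> u) = Idn C (A \<otimes> X)"
    and "ext \<psi> X \<cdot> (m \<boxtimes> Idn C (X \<otimes> A)) = (m \<boxtimes> Idn C X) \<cdot> (Idn C A \<boxtimes> ext \<psi> X)"
proof -
  note X = sharp_obj_facts[OF assms]
  show lin: "ext \<psi> X \<cdot> (m \<boxtimes> Idn C (X \<otimes> A)) = (m \<boxtimes> Idn C X) \<cdot> (Idn C A \<boxtimes> ext \<psi> X)"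
    using X ext_linear[of \<psi> "X \<otimes> A" X] by simp
  have "ext \<psi> X \<cdot> (ext \<psi> X \<boxtimes> Idn C A) = (ext \<psi> X \<cdot> (m \<boxtimes> Idn C (X \<otimes> A))) \<cdot> (Idn C A \<boxtimes> (\<psi> \<boxtimes> Idn C A))"
    using X by (simp add: ext_def)
  also have "\<dots> = (m \<boxtimes> Idn C X) \<cdot> (Idn C A \<boxtimes> (ext \<psi> X \<cdot> (\<psi> \<boxtimes> Idn C A)))"
    unfolding lin using X(1-4,7-9) by simp
  also have "\<dots> = ext \<psi> X \<cdot> (Idn C (A \<otimes> X) \<boxtimes> m)"
    unfolding X(5)[symmetric] using X(1-4) by (simp add: ext_def)
  finally show "ext \<psi> X \<cdot> (ext \<psi> X \<boxtimes> Idn C A) = ext \<psi> X \<cdot> (Idn C (A \<otimes> X) \<boxtimes> m)" .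
  have "ext \<psi> X \<cdot> (Idn C (A \<otimes> X) \<boxtimes> u) = (m \<boxtimes> Idn C X) \<cdot> (Idn C A \<boxtimes> (\<psi> \<cdot> (Idn C X \<boxtimes> u)))"
    using X(1-4) by (simp add: ext_def)
  also have "\<dots> = Idn C (A \<otimes> X)"
    unfolding X(6) using X(1) by (rule mult_whisker(3))
  finally show "ext \<psi> X \<cdot> (Idn C (A \<otimes> X) \<boxtimes> u) = Idn C (A \<otimes> X)" .
qed

text \<open>The multiplication of \<open>A\<close> is moved past \<open>Y\<close> by \<open>\<phi>\<close> and then past \<open>X\<close> by \<open>\<psi>\<close>; between these two
  steps \<open>\<psi>\<close> and \<open>\<phi>\<close> act on disjoint factors and can be exchanged.\<close>
lemma sharp_obj_TenO:
  assumes "sharp_obj C \<A> (X, \<psi>)" "sharp_obj C \<A> (Y, \<phi>)"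
  shows "sharp_obj C \<A> (sharp_TenO C (X, \<psi>) (Y, \<phi>))"
proof -
  note X = sharp_obj_facts[OF assms(1)] and Y = sharp_obj_facts[OF assms(2)]
  note ty = X(1-4,7-9) Y(1-4,7-9)
  let ?\<chi> = "(\<psi> \<boxtimes> Idn C Y) \<cdot> (Idn C X \<boxtimes> \<phi>)"
  have "?\<chi> \<cdot> (Idn C (X \<otimes> Y) \<boxtimes> m) = (\<psi> \<boxtimes> Idn C Y) \<cdot> (Idn C X \<boxtimes> (\<phi> \<cdot> (Idn C Y \<boxtimes> m)))"
    using ty by simp
  also have "\<dots> = ((\<psi> \<cdot> (Idn C X \<boxtimes> m)) \<boxtimes> Idn C Y) \<cdot> (Idn C (X \<otimes> A) \<boxtimes> \<phi>) \<cdot> (Idn C X \<boxtimes> (\<phi> \<boxtimes> Idn C A))"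
    unfolding Y(5) using ty(1-4,8-11) by (simp add: ext_def)
  also have "\<dots> = (ext \<psi> X \<boxtimes> Idn C Y) \<cdot> ((\<psi> \<boxtimes> Idn C (A \<otimes> Y)) \<cdot> (Idn C (X \<otimes> A) \<boxtimes> \<phi>)) \<cdot> (Idn C X \<boxtimes> (\<phi> \<boxtimes> Idn C A))"
    unfolding X(5) using ty by simp
  also have "(\<psi> \<boxtimes> Idn C (A \<otimes> Y)) \<cdot> (Idn C (X \<otimes> A) \<boxtimes> \<phi>) = (Idn C (A \<otimes> X) \<boxtimes> \<phi>) \<cdot> (\<psi> \<boxtimes> Idn C (Y \<otimes> A))"
    using ty interchange_arr[of \<psi> \<phi> "X \<otimes> A" "A \<otimes> X" "Y \<otimes> A" "A \<otimes> Y"] by simp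
  also have "(ext \<psi> X \<boxtimes> Idn C Y) \<cdot> ((Idn C (A \<otimes> X) \<boxtimes> \<phi>) \<cdot> (\<psi> \<boxtimes> Idn C (Y \<otimes> A))) \<cdot> (Idn C X \<boxtimes> (\<phi> \<boxtimes> Idn C A))
      = (m \<boxtimes> Idn C (X \<otimes> Y)) \<cdot> (Idn C A \<boxtimes> ?\<chi>) \<cdot> (?\<chi> \<boxtimes> Idn C A)"
    using ty(1-4,8-11) by (simp add: ext_def)
  finally have 1: "?\<chi> \<cdot> (Idn C (X \<otimes> Y) \<boxtimes> m) = (m \<boxtimes> Idn C (X \<otimes> Y)) \<cdot> (Idn C A \<boxtimes> ?\<chi>) \<cdot> (?\<chi> \<boxtimes> Idn C A)" .
  have "?\<chi> \<cdot> (Idn C (X \<otimes> Y) \<boxtimes> u) = (\<psi> \<boxtimes> Idn C Y) \<cdot> (Idn C X \<boxtimes> (\<phi> \<cdot> (Idn C Y \<boxtimes> u)))"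
    using ty by simp
  also have "\<dots> = (\<psi> \<cdot> (Idn C X \<boxtimes> u)) \<boxtimes> Idn C Y"
    unfolding Y(6) using ty by simp
  also have "\<dots> = u \<boxtimes> Idn C (X \<otimes> Y)"
    unfolding X(6) using ty by simp
  finally have 2: "?\<chi> \<cdot> (Idn C (X \<otimes> Y) \<boxtimes> u) = u \<boxtimes> Idn C (X \<otimes> Y)" .
  show ?thesis
    using 1 2 ty by (simp add: hom_iff)
qed

text \<open>On \<open>A \<otimes> X \<otimes> A \<otimes> Y \<otimes> A\<close>, the middle and the last factor \<open>A\<close> can be absorbed in either order, because
  \<open>ext \<psi> X\<close> is a right action. The same identity gives the right action on a tensor product
  over \<open>A\<close> and the compatibility of its two bracketings.\<close>
lemma ext_TenO:
  assumes "sharp_obj C \<A> (X, \<psi>)" "sharp_obj C \<A> (Y, \<phi>)"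
  shows "ext ((\<psi> \<boxtimes> Idn C Y) \<cdot> (Idn C X \<boxtimes> \<phi>)) (X \<otimes> Y) = (ext \<psi> X \<boxtimes> Idn C Y) \<cdot> (Idn C (A \<otimes> X) \<boxtimes> \<phi>)"
    and "ext ((\<psi> \<boxtimes> Idn C Y) \<cdot> (Idn C X \<boxtimes> \<phi>)) (X \<otimes> Y) \<cdot> (ext \<psi> X \<boxtimes> Idn C (Y \<otimes> A))
      = (ext \<psi> X \<boxtimes> Idn C Y) \<cdot> (Idn C (A \<otimes> X) \<boxtimes> ext \<phi> Y)"
proof -
  note X = sharp_obj_facts[OF assms(1)] and Y = sharp_obj_facts[OF assms(2)]
  note ty = X(1-4,7-9) Y(1-4,7-9)
  show e: "ext ((\<psi> \<boxtimes> Idn C Y) \<cdot> (Idn C X \<boxtimes> \<phi>)) (X \<otimes> Y) = (ext \<psi> X \<boxtimes> Idn C Y) \<cdot> (Idn C (A \<otimes> X) \<boxtimes> \<phi>)"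
    using X(1-4) Y(1-4) by (simp add: ext_def)
  have "(ext \<psi> X \<boxtimes> Idn C Y) \<cdot> (Idn C (A \<otimes> X) \<boxtimes> \<phi>) \<cdot> (ext \<psi> X \<boxtimes> Idn C (Y \<otimes> A))
      = (ext \<psi> X \<boxtimes> Idn C Y) \<cdot> (ext \<psi> X \<boxtimes> Idn C (A \<otimes> Y)) \<cdot> (Idn C (A \<otimes> X \<otimes> A) \<boxtimes> \<phi>)"
    using ty interchange_arr[of "ext \<psi> X" \<phi> "A \<otimes> X \<otimes> A" "A \<otimes> X" "Y \<otimes> A" "A \<otimes> Y"] by simp
  also have "\<dots> = ((ext \<psi> X \<cdot> (ext \<psi> X \<boxtimes> Idn C A)) \<boxtimes> Idn C Y) \<cdot> (Idn C (A \<otimes> X \<otimes> A) \<boxtimes> \<phi>)"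
    using ty by simp
  also have "\<dots> = (ext \<psi> X \<boxtimes> Idn C Y) \<cdot> (Idn C (A \<otimes> X) \<boxtimes> ext \<phi> Y)"
    unfolding ext_right_action(1)[OF assms(1)] using X(1-4,7-9) Y(1-4) by (simp add: ext_def[of \<phi>])
  finally show "ext ((\<psi> \<boxtimes> Idn C Y) \<cdot> (Idn C X \<boxtimes> \<phi>)) (X \<otimes> Y) \<cdot> (ext \<psi> X \<boxtimes> Idn C (Y \<otimes> A))
      = (ext \<psi> X \<boxtimes> Idn C Y) \<cdot> (Idn C (A \<otimes> X) \<boxtimes> ext \<phi> Y)"
    unfolding e using ty by simp
qed

fun presents :: "('o, 'a) presentation \<Rightarrow> bool" where
  "presents ((X, \<psi>), b, (V, l, r)) \<longleftrightarrow>
     sharp_obj C \<A> (X, \<psi>) \<and> free_on X b (V, l) \<and> r \<in> hom C (V \<otimes> A) V \<and>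
     b \<cdot> ext \<psi> X = r \<cdot> (b \<boxtimes> Idn C A)"

lemma presents_facts:
  assumes "presents ((X, \<psi>), b, (V, l, r))"
  shows "sharp_obj C \<A> (X, \<psi>)" "free_on X b (V, l)"
    "X \<in> Obj C" "\<psi> \<in> Arr C" "Dom C \<psi> = X \<otimes> A" "Cod C \<psi> = A \<otimes> X"
    "ext \<psi> X \<in> Arr C" "Dom C (ext \<psi> X) = A \<otimes> X \<otimes> A" "Cod C (ext \<psi> X) = A \<otimes> X"
    "V \<in> Obj C" "b \<in> Arr C" "Dom C b = A \<otimes> X" "Cod C b = V"
    "l \<in> Arr C" "Dom C l = A \<otimes> V" "Cod C l = V" "r \<in> Arr C" "Dom C r = V \<otimes> A" "Cod C r = V"
    "is_iso C b" "b \<cdot> (m \<boxtimes> Idn C X) = l \<cdot> (Idn C A \<boxtimes> b)" "b \<cdot> ext \<psi> X = r \<cdot> (b \<boxtimes> Idn C A)"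
  using assms by (auto simp: free_on_def hom_iff)

text \<open>The laws are checked after composition with the isomorphism \<open>b\<close>, where they become those of
  \<open>ext_right_action\<close>.\<close>
lemma presents_right_module:
  assumes "presents ((X, \<psi>), b, (V, l, r))"
  shows "right_module C \<A> (V, r)"
proof -
  note p = presents_facts[OF assms]
  note ty = p(3-19) and R = ext_right_action[OF p(1)]
  have "(r \<cdot> (Idn C V \<boxtimes> m)) \<cdot> (b \<boxtimes> Idn C (A \<otimes> A)) = r \<cdot> ((Idn C V \<boxtimes> m) \<cdot> (b \<boxtimes> Idn C (A \<otimes> A)))"
    using ty by simp
  also have "(Idn C V \<boxtimes> m) \<cdot> (b \<boxtimes> Idn C (A \<otimes> A)) = (b \<boxtimes> Idn C A) \<cdot> (Idn C (A \<otimes> X) \<boxtimes> m)"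
    using ty interchange_arr[of b m "A \<otimes> X" V "A \<otimes> A" A] by simp
  also have "r \<cdot> ((b \<boxtimes> Idn C A) \<cdot> (Idn C (A \<otimes> X) \<boxtimes> m)) = b \<cdot> (ext \<psi> X \<cdot> (Idn C (A \<otimes> X) \<boxtimes> m))"
    using ty Cmp_extend[OF p(22)[symmetric]] by simp
  also have "\<dots> = b \<cdot> (ext \<psi> X \<cdot> (ext \<psi> X \<boxtimes> Idn C A))"
    by (simp only: R(1))
  also have "\<dots> = r \<cdot> ((b \<cdot> ext \<psi> X) \<boxtimes> Idn C A)"
    using ty Cmp_extend[OF p(22)] by simp
  also have "\<dots> = (r \<cdot> (r \<boxtimes> Idn C A)) \<cdot> (b \<boxtimes> Idn C (A \<otimes> A))"
    unfolding p(22) using ty by simp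
  finally have 1: "r \<cdot> (Idn C V \<boxtimes> m) = r \<cdot> (r \<boxtimes> Idn C A)"
    by (rule iso_cancel_right) (use ty in \<open>simp_all add: is_iso_TenA is_iso_Idn p(20)\<close>)
  have "(r \<cdot> (Idn C V \<boxtimes> u)) \<cdot> b = r \<cdot> ((Idn C V \<boxtimes> u) \<cdot> b)"
    using ty by simp
  also have "(Idn C V \<boxtimes> u) \<cdot> b = (b \<boxtimes> Idn C A) \<cdot> (Idn C (A \<otimes> X) \<boxtimes> u)"
    using ty interchange_arr[of b u "A \<otimes> X" V \<I> A] by simp
  also have "r \<cdot> ((b \<boxtimes> Idn C A) \<cdot> (Idn C (A \<otimes> X) \<boxtimes> u)) = b \<cdot> (ext \<psi> X \<cdot> (Idn C (A \<otimes> X) \<boxtimes> u))"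
    using ty Cmp_extend[OF p(22)[symmetric]] by simp
  also have "\<dots> = Idn C V \<cdot> b"
    using ty by (simp add: R(2))
  finally have 2: "r \<cdot> (Idn C V \<boxtimes> u) = Idn C V"
    by (rule iso_cancel_right) (use ty in \<open>simp_all add: p(20)\<close>)
  show ?thesis
    using ty 1 2 by (simp add: hom_iff)
qed

lemma presents_bimodule:
  assumes "presents ((X, \<psi>), b, (V, l, r))"
  shows "bimodule C \<A> (V, l, r)"
proof -
  note p = presents_facts[OF assms]
  note ty = p(3-19) and R = ext_right_action[OF p(1)]
  have "(r \<cdot> (l \<boxtimes> Idn C A)) \<cdot> (Idn C A \<boxtimes> (b \<boxtimes> Idn C A)) = r \<cdot> ((l \<cdot> (Idn C A \<boxtimes> b)) \<boxtimes> Idn C A)"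
    using ty by simp
  also have "\<dots> = (r \<cdot> (b \<boxtimes> Idn C A)) \<cdot> (m \<boxtimes> Idn C (X \<otimes> A))"
    unfolding p(21)[symmetric] using ty by simp
  also have "\<dots> = b \<cdot> (ext \<psi> X \<cdot> (m \<boxtimes> Idn C (X \<otimes> A)))"
    unfolding p(22)[symmetric] using ty by simp
  also have "\<dots> = l \<cdot> (Idn C A \<boxtimes> (b \<cdot> ext \<psi> X))"
    unfolding R(3) using ty Cmp_extend[OF p(21)] by simp
  also have "\<dots> = (l \<cdot> (Idn C A \<boxtimes> r)) \<cdot> (Idn C A \<boxtimes> (b \<boxtimes> Idn C A))"
    unfolding p(22) using ty by simp
  finally have "r \<cdot> (l \<boxtimes> Idn C A) = l \<cdot> (Idn C A \<boxtimes> r)"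
    by (rule iso_cancel_right) (use ty in \<open>simp_all add: is_iso_TenA is_iso_Idn p(20)\<close>)
  then show ?thesis
    using presents_right_module[OF assms] free_on_left_module[OF p(2)] by simp
qed

lemma presents_free_bimod:
  assumes "sharp_obj C \<A> (X, \<psi>)"
  shows "presents ((X, \<psi>), Idn C (A \<otimes> X), free_bimod C \<A> (X, \<psi>))"
  using sharp_obj_facts[OF assms] assms
  by (simp add: free_on_def hom_iff is_iso_Idn ext_def[symmetric] del: sharp_obj.simps)

end

context strict_algebra_coequalizers
begin

lemma presents_bimod_obj:
  assumes "presents ((X, \<psi>), b, (V, l, r))" "left_coflat C A" "left_coflat C X"
  shows "bimod_obj C \<A> (V, l, r)"
  using presents_bimodule[OF assms(1)] free_on_left_robust[OF presents_facts(2)[OF assms(1)]]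
    left_coflat_iso[OF left_coflat_TenO[OF assms(2,3)] presents_facts(20,12,13)[OF assms(1)]]
  by simp

text \<open>The arrow \<open>A \<otimes> X \<otimes> Y \<rightarrow> V \<otimes>\<^sub>A W\<close> that presents \<open>V \<otimes>\<^sub>A W\<close> inserts the unit of \<open>A\<close> between \<open>X\<close>
  and \<open>Y\<close>.\<close>
fun tensor_pres :: "('o, 'a) presentation \<Rightarrow> ('o, 'a) presentation
    \<Rightarrow> ('o, 'a) presentation" where
  "tensor_pres ((X, \<psi>), b, B) ((Y, \<phi>), c, D) =
     (sharp_TenO C (X, \<psi>) (Y, \<phi>),
      bimod_proj C B D \<cdot> ((b \<boxtimes> c) \<cdot> (Idn C (A \<otimes> X) \<boxtimes> (u \<boxtimes> Idn C Y))),
      bimod_TenO C \<A> B D)"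

text \<open>Under the identifications \<open>b\<close> and \<open>c\<close>, the projection onto \<open>V \<otimes>\<^sub>A W\<close> is the right action of \<open>A\<close>
  on \<open>A \<otimes> X\<close>, tensored with \<open>Y\<close>. This determines every arrow defined by factorization through \<open>q\<close>.\<close>
lemma bimod_proj_presented:
  assumes B: "presents ((X, \<psi>), b, (V, l, r))" and D: "presents ((Y, \<phi>), c, (W, l', r'))"
  defines "q \<equiv> bimod_proj C (V, l, r) (W, l', r')"
  defines "t \<equiv> fst (snd (tensor_pres ((X, \<psi>), b, (V, l, r)) ((Y, \<phi>), c, (W, l', r'))))"
  shows "is_coequalizer C (r \<boxtimes> Idn C W) (Idn C V \<boxtimes> l') q" "is_iso C t"
    "t \<in> Arr C" "Dom C t = A \<otimes> X \<otimes> Y" "Cod C t = Cod C q" "q \<in> Arr C" "Dom C q = V \<otimes> W"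
    "q \<cdot> (b \<boxtimes> c) = t \<cdot> (ext \<psi> X \<boxtimes> Idn C Y)"
proof -
  note p = presents_facts[OF B] and p' = presents_facts[OF D]
  note ty = p(3-19) p'(3-19)
  obtain j where j: "is_iso C j" "Dom C j = V \<otimes> Y" "Cod C j = Cod C q"
    "q \<cdot> (Idn C V \<boxtimes> c) = j \<cdot> (r \<boxtimes> Idn C Y)"
    and q: "is_coequalizer C (r \<boxtimes> Idn C W) (Idn C V \<boxtimes> l') q"
    using tensor_proj_free[OF presents_right_module[OF B] p'(2)] unfolding q_def by auto
  have jt: "j \<in> Arr C" using j(1) by (simp add: is_iso_def)
  show "is_coequalizer C (r \<boxtimes> Idn C W) (Idn C V \<boxtimes> l') q" by fact
  show qt: "q \<in> Arr C" "Dom C q = V \<otimes> W"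
    using coequalizer_typing[OF q] ty by simp_all
  have "q \<cdot> (b \<boxtimes> c) = q \<cdot> ((Idn C V \<boxtimes> c) \<cdot> (b \<boxtimes> Idn C (A \<otimes> Y)))"
    using ty interchange_left_first[of b c "A \<otimes> Y" V] by simp
  also have "\<dots> = j \<cdot> ((r \<cdot> (b \<boxtimes> Idn C A)) \<boxtimes> Idn C Y)"
    using ty qt jt j(2,3) Cmp_extend[OF j(4)] by simp
  also have "\<dots> = (j \<cdot> (b \<boxtimes> Idn C Y)) \<cdot> (ext \<psi> X \<boxtimes> Idn C Y)"
    unfolding p(22)[symmetric] using ty jt j(2) by simp
  finally have e: "q \<cdot> (b \<boxtimes> c) = (j \<cdot> (b \<boxtimes> Idn C Y)) \<cdot> (ext \<psi> X \<boxtimes> Idn C Y)" .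
  have "t = (q \<cdot> (b \<boxtimes> c)) \<cdot> (Idn C (A \<otimes> X) \<boxtimes> (u \<boxtimes> Idn C Y))"
    using ty qt by (simp add: t_def q_def[symmetric] del: bimod_proj.simps)
  also have "\<dots> = (j \<cdot> (b \<boxtimes> Idn C Y)) \<cdot> ((ext \<psi> X \<cdot> (Idn C (A \<otimes> X) \<boxtimes> u)) \<boxtimes> Idn C Y)"
    unfolding e using ty jt j(2) by simp
  also have "\<dots> = j \<cdot> (b \<boxtimes> Idn C Y)"
    unfolding ext_right_action(2)[OF p(1)] using ty jt j(2) by simp
  finally have t: "t = j \<cdot> (b \<boxtimes> Idn C Y)" .
  show "is_iso C t"
    unfolding t using ty j(1,2) p(20) by (intro is_iso_Cmp is_iso_TenA is_iso_Idn) simp_all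
  show "t \<in> Arr C" "Dom C t = A \<otimes> X \<otimes> Y" "Cod C t = Cod C q"
    unfolding t using ty jt j(2,3) by simp_all
  show "q \<cdot> (b \<boxtimes> c) = t \<cdot> (ext \<psi> X \<boxtimes> Idn C Y)"
    unfolding t by (rule e)
qed

lemma bimod_proj_section:
  assumes B: "presents ((X, \<psi>), b, (V, l, r))" and D: "presents ((Y, \<phi>), c, (W, l', r'))"
  obtains s where "s \<in> Arr C" "Dom C s = Cod C (bimod_proj C (V, l, r) (W, l', r'))" "Cod C s = V \<otimes> W"
    "bimod_proj C (V, l, r) (W, l', r') \<cdot> s = Idn C (Cod C (bimod_proj C (V, l, r) (W, l', r')))"
proof -
  note p = presents_facts[OF B] and p' = presents_facts[OF D]
  define q where "q = bimod_proj C (V, l, r) (W, l', r')"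
  define t where "t = fst (snd (tensor_pres ((X, \<psi>), b, (V, l, r)) ((Y, \<phi>), c, (W, l', r'))))"
  note qt = bimod_proj_presented[OF B D, folded q_def t_def]
  obtain t' where t': "t' \<in> Arr C" "Dom C t' = Cod C t" "Cod C t' = Dom C t" "t \<cdot> t' = Idn C (Cod C t)"
    using qt(2) by (rule iso_inverse)
  have t: "t = q \<cdot> ((b \<boxtimes> c) \<cdot> (Idn C (A \<otimes> X) \<boxtimes> (u \<boxtimes> Idn C Y)))"
    by (simp add: t_def q_def)
  let ?s = "((b \<boxtimes> c) \<cdot> (Idn C (A \<otimes> X) \<boxtimes> (u \<boxtimes> Idn C Y))) \<cdot> t'"
  have "q \<cdot> ?s = t \<cdot> t'"
    unfolding t using p(3-19) p'(3-19) qt(3-7) t'(1-3) by simp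
  then show thesis
    using that[of ?s] p(3-19) p'(3-19) qt(3-7) t' unfolding q_def[symmetric] by simp
qed

text \<open>The factorizations that define the two actions on \<open>V \<otimes>\<^sub>A W\<close> are identified with the actions
  \<open>?L\<close>, \<open>?R\<close> carried over from the free bimodule on \<open>(X, \<psi>) \<otimes> (Y, \<phi>)\<close>. The required equations are
  checked on \<open>A \<otimes> X \<otimes> A \<otimes> Y\<close>, where the projection is \<open>ext \<psi> X \<otimes> Y\<close>.\<close>
lemma presents_TenO:
  assumes B: "presents ((X, \<psi>), b, (V, l, r))" and D: "presents ((Y, \<phi>), c, (W, l', r'))"
  shows "presents (tensor_pres ((X, \<psi>), b, (V, l, r)) ((Y, \<phi>), c, (W, l', r')))"
proof -
  note p = presents_facts[OF B] and p' = presents_facts[OF D]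
  define q where "q = bimod_proj C (V, l, r) (W, l', r')"
  define t where "t = fst (snd (tensor_pres ((X, \<psi>), b, (V, l, r)) ((Y, \<phi>), c, (W, l', r'))))"
  note qt = bimod_proj_presented[OF B D, folded q_def t_def]
  obtain t' where t': "t' \<in> Arr C" "Dom C t' = Cod C q" "Cod C t' = A \<otimes> X \<otimes> Y"
    "t' \<cdot> t = Idn C (A \<otimes> X \<otimes> Y)" "t \<cdot> t' = Idn C (Cod C q)"
    using iso_inverse[OF qt(2)] qt(4,5) by metis
  obtain s where s: "s \<in> Arr C" "Dom C s = Cod C q" "Cod C s = V \<otimes> W" "q \<cdot> s = Idn C (Cod C q)"
    using bimod_proj_section[OF B D] unfolding q_def by blast
  let ?\<chi> = "(\<psi> \<boxtimes> Idn C Y) \<cdot> (Idn C X \<boxtimes> \<phi>)"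
  note ty = p(3-19) p'(3-19) qt(3-7) t'(1-3) s(1-3)
  have Cq: "Cod C q \<in> Obj C" using qt by simp
  have xt: "ext ?\<chi> (X \<otimes> Y) \<in> Arr C" "Dom C (ext ?\<chi> (X \<otimes> Y)) = A \<otimes> X \<otimes> Y \<otimes> A" "Cod C (ext ?\<chi> (X \<otimes> Y)) = A \<otimes> X \<otimes> Y"
    using ty by simp_all
  let ?L = "t \<cdot> (m \<boxtimes> Idn C (X \<otimes> Y)) \<cdot> (Idn C A \<boxtimes> t')"
  let ?R = "t \<cdot> ext ?\<chi> (X \<otimes> Y) \<cdot> (t' \<boxtimes> Idn C A)"
  have Lt: "?L \<in> Arr C" "Dom C ?L = A \<otimes> Cod C q" "Cod C ?L = Cod C q"
    and Rt: "?R \<in> Arr C" "Dom C ?R = Cod C q \<otimes> A" "Cod C ?R = Cod C q"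
    using ty Cq xt by simp_all
  have Le: "?L \<cdot> (Idn C A \<boxtimes> t) = t \<cdot> (m \<boxtimes> Idn C (X \<otimes> Y))"
  proof -
    have "?L \<cdot> (Idn C A \<boxtimes> t) = t \<cdot> (m \<boxtimes> Idn C (X \<otimes> Y)) \<cdot> (Idn C A \<boxtimes> (t' \<cdot> t))"
      using ty by simp
    then show ?thesis unfolding t'(4) using ty by simp
  qed
  have Re: "?R \<cdot> (t \<boxtimes> Idn C A) = t \<cdot> ext ?\<chi> (X \<otimes> Y)"
  proof -
    have "?R \<cdot> (t \<boxtimes> Idn C A) = t \<cdot> ext ?\<chi> (X \<otimes> Y) \<cdot> ((t' \<cdot> t) \<boxtimes> Idn C A)"
      using ty xt by simp
    then show ?thesis unfolding t'(4) using ty xt by simp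
  qed
  have "(?L \<cdot> (Idn C A \<boxtimes> q)) \<cdot> (Idn C A \<boxtimes> (b \<boxtimes> c)) = ?L \<cdot> (Idn C A \<boxtimes> (q \<cdot> (b \<boxtimes> c)))"
    using ty Lt by simp
  also have "\<dots> = (?L \<cdot> (Idn C A \<boxtimes> t)) \<cdot> (Idn C A \<boxtimes> (ext \<psi> X \<boxtimes> Idn C Y))"
    unfolding qt(8) using ty Lt by simp
  also have "\<dots> = t \<cdot> (((m \<boxtimes> Idn C X) \<cdot> (Idn C A \<boxtimes> ext \<psi> X)) \<boxtimes> Idn C Y)"
    unfolding Le using ty by simp
  also have "\<dots> = (t \<cdot> (ext \<psi> X \<boxtimes> Idn C Y)) \<cdot> (m \<boxtimes> Idn C (X \<otimes> A \<otimes> Y))"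
    unfolding ext_right_action(3)[OF p(1), symmetric] using ty by simp
  also have "\<dots> = q \<cdot> ((b \<boxtimes> c) \<cdot> (m \<boxtimes> Idn C (X \<otimes> A \<otimes> Y)))"
    unfolding qt(8)[symmetric] using ty by simp
  also have "(b \<boxtimes> c) \<cdot> (m \<boxtimes> Idn C (X \<otimes> A \<otimes> Y)) = (b \<cdot> (m \<boxtimes> Idn C X)) \<boxtimes> c"
    using ty TenA_Cmp_arr[of "m \<boxtimes> Idn C X" b "Idn C (A \<otimes> Y)" c] by simp
  also have "\<dots> = (l \<boxtimes> Idn C W) \<cdot> (Idn C A \<boxtimes> (b \<boxtimes> c))"
    unfolding p(21) using ty TenA_Cmp_arr[of "Idn C A \<boxtimes> b" l c "Idn C W"] by simp
  also have "q \<cdot> ((l \<boxtimes> Idn C W) \<cdot> (Idn C A \<boxtimes> (b \<boxtimes> c))) = (q \<cdot> (l \<boxtimes> Idn C W)) \<cdot> (Idn C A \<boxtimes> (b \<boxtimes> c))"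
    using ty by simp
  finally have Lq: "?L \<cdot> (Idn C A \<boxtimes> q) = q \<cdot> (l \<boxtimes> Idn C W)"
    by (rule iso_cancel_right) (use ty Lt in \<open>simp_all add: is_iso_TenA is_iso_Idn p(20) p'(20)\<close>)
  have "(?R \<cdot> (q \<boxtimes> Idn C A)) \<cdot> (b \<boxtimes> (c \<boxtimes> Idn C A)) = ?R \<cdot> ((q \<cdot> (b \<boxtimes> c)) \<boxtimes> Idn C A)"
    using ty Rt by simp
  also have "\<dots> = (?R \<cdot> (t \<boxtimes> Idn C A)) \<cdot> (ext \<psi> X \<boxtimes> Idn C (Y \<otimes> A))"
    unfolding qt(8) using ty Rt by simp
  also have "\<dots> = t \<cdot> (ext ?\<chi> (X \<otimes> Y) \<cdot> (ext \<psi> X \<boxtimes> Idn C (Y \<otimes> A)))"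
    unfolding Re using ty xt by simp
  also have "\<dots> = (t \<cdot> (ext \<psi> X \<boxtimes> Idn C Y)) \<cdot> (Idn C (A \<otimes> X) \<boxtimes> ext \<phi> Y)"
    unfolding ext_TenO(2)[OF p(1) p'(1)] using ty by simp
  also have "\<dots> = q \<cdot> ((b \<boxtimes> c) \<cdot> (Idn C (A \<otimes> X) \<boxtimes> ext \<phi> Y))"
    unfolding qt(8)[symmetric] using ty by simp
  also have "(b \<boxtimes> c) \<cdot> (Idn C (A \<otimes> X) \<boxtimes> ext \<phi> Y) = b \<boxtimes> (c \<cdot> ext \<phi> Y)"
    using ty TenA_Cmp_arr[of "Idn C (A \<otimes> X)" b "ext \<phi> Y" c] by simp
  also have "\<dots> = (Idn C V \<boxtimes> r') \<cdot> (b \<boxtimes> (c \<boxtimes> Idn C A))"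
    unfolding p'(22) using ty TenA_Cmp_arr[of b "Idn C V" "c \<boxtimes> Idn C A" r'] by simp
  also have "q \<cdot> ((Idn C V \<boxtimes> r') \<cdot> (b \<boxtimes> (c \<boxtimes> Idn C A))) = (q \<cdot> (Idn C V \<boxtimes> r')) \<cdot> (b \<boxtimes> (c \<boxtimes> Idn C A))"
    using ty by simp
  finally have Rq: "?R \<cdot> (q \<boxtimes> Idn C A) = q \<cdot> (Idn C V \<boxtimes> r')"
    by (rule iso_cancel_right) (use ty Rt in \<open>simp_all add: is_iso_TenA is_iso_Idn p(20) p'(20)\<close>)
  have As: "(Idn C A \<boxtimes> q) \<cdot> (Idn C A \<boxtimes> s) = Idn C (Cod C (Idn C A \<boxtimes> q))"
    and sA: "(q \<boxtimes> Idn C A) \<cdot> (s \<boxtimes> Idn C A) = Idn C (Cod C (q \<boxtimes> Idn C A))"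
    using ty Cq s(4) by (simp_all flip: whisker_left whisker_right)
  have L: "factor C (Idn C A \<boxtimes> q) (q \<cdot> (l \<boxtimes> Idn C W)) = ?L"
    by (rule factor_split_epi[OF Lq As]) (use ty Lt in simp_all)
  have R: "factor C (q \<boxtimes> Idn C A) (q \<cdot> (Idn C V \<boxtimes> r')) = ?R"
    by (rule factor_split_epi[OF Rq sA]) (use ty Rt in simp_all)
  have T: "bimod_TenO C \<A> (V, l, r) (W, l', r') = (Cod C q, ?L, ?R)"
    unfolding bimod_TenO.simps Let_def q_def[symmetric] L R ..
  have "tensor_pres ((X, \<psi>), b, (V, l, r)) ((Y, \<phi>), c, (W, l', r')) = ((X \<otimes> Y, ?\<chi>), t, (Cod C q, ?L, ?R))"
    unfolding tensor_pres.simps T q_def[symmetric] by (simp add: t_def q_def)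
  moreover have "free_on (X \<otimes> Y) t (Cod C q, ?L)"
    using Le Lt ty qt(2) by (simp add: free_on_def hom_iff)
  ultimately show ?thesis
    using sharp_obj_TenO[OF p(1) p'(1)] Re Rt by (simp add: hom_iff del: sharp_obj.simps)
qed

end

section \<open>Arrows of bimodules represented by arrows of \<open>T\<^sub>A\<^sup>#\<close>\<close>

lemma bimod_cat_simps [simp]:
  "Obj (bimod_cat C \<A>) = {X. bimod_obj C \<A> X}"
  "hom (bimod_cat C \<A>) B D = {f. bimod_arr C \<A> f \<and> fst f = B \<and> snd (snd f) = D}"
  "Idn (bimod_cat C \<A>) X = (X, Idn C (fst X), X)"
  "Cmp (bimod_cat C \<A>) (Y, g, Z) (X, f, Y') = (X, Cmp C g f, Z)"
  "TenO (bimod_cat C \<A>) = bimod_TenO C \<A>" "TenA (bimod_cat C \<A>) = bimod_TenA C \<A>"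
  "Unit (bimod_cat C \<A>) = regular_bimod \<A>"
  "Assoc (bimod_cat C \<A>) = bimod_Assoc C \<A>"
  "LUnit (bimod_cat C \<A>) = bimod_LUnit C \<A>" "RUnit (bimod_cat C \<A>) = bimod_RUnit C \<A>"
  by (auto simp: bimod_cat_def hom_def)

context strict_algebra_coequalizers
begin

text \<open>An arrow \<open>f\<close> of bimodules and an arrow \<open>\<rho>\<close> of \<open>T\<^sub>A\<^sup>#\<close> correspond when the presenting isomorphisms
  turn \<open>f\<close> into the left linear extension of \<open>\<rho>\<close>. Compatibility with the right actions is left out
  and recovered in \<open>represents_linear\<close>, so that composites can be treated by source and target alone.\<close>
fun represents :: "('o, 'a) presentation \<Rightarrow> ('o, 'a) presentation
    \<Rightarrow> ('o \<times> 'a) \<times> 'a \<times> ('o \<times> 'a) \<Rightarrow> ('o, 'a) bimod \<times> 'a \<times> ('o, 'a) bimod \<Rightarrow> bool" where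
  "represents (P, b, B) (Q, c, D) (P', \<rho>, Q') (B', f, D') \<longleftrightarrow>
     presents (P, b, B) \<and> presents (Q, c, D) \<and> P' = P \<and> Q' = Q \<and> B' = B \<and> D' = D \<and>
     \<rho> \<in> hom C (fst P) (A \<otimes> fst Q) \<and> f \<in> hom C (fst B) (fst D) \<and> f \<cdot> b = c \<cdot> ext \<rho> (fst Q)"

lemma represents_ends:
  assumes "represents p p' \<rho> f"
  shows "presents p" "presents p'" "fst \<rho> = fst p" "snd (snd \<rho>) = fst p'"
    "fst f = snd (snd p)" "snd (snd f) = snd (snd p')"
  using assms by (cases p; cases p'; cases \<rho>; cases f; auto)+

text \<open>The presenting isomorphisms and \<open>ext_inject\<close> determine each of the two arrows from the other.\<close>
lemma represents_unique:
  assumes "represents p p' \<rho> f" "represents p p' \<sigma> g"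
  shows "\<rho> = \<sigma> \<longleftrightarrow> f = g"
proof -
  obtain X \<psi> b V l r where p: "p = ((X, \<psi>), b, (V, l, r))" by (metis prod.exhaust)
  obtain Y \<phi> c W l' r' where p': "p' = ((Y, \<phi>), c, (W, l', r'))" by (metis prod.exhaust)
  obtain \<rho>0 f0 where \<rho>: "\<rho> = ((X, \<psi>), \<rho>0, (Y, \<phi>))" and f: "f = ((V, l, r), f0, (W, l', r'))"
    using assms(1) unfolding p p' by (cases \<rho>; cases f) auto
  obtain \<sigma>0 g0 where \<sigma>: "\<sigma> = ((X, \<psi>), \<sigma>0, (Y, \<phi>))" and g: "g = ((V, l, r), g0, (W, l', r'))"
    using assms(2) unfolding p p' by (cases \<sigma>; cases g) auto
  have a: "presents ((X, \<psi>), b, (V, l, r))" "presents ((Y, \<phi>), c, (W, l', r'))"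
    "\<rho>0 \<in> Arr C" "Dom C \<rho>0 = X" "Cod C \<rho>0 = A \<otimes> Y" "f0 \<in> Arr C" "Dom C f0 = V" "Cod C f0 = W"
    "\<sigma>0 \<in> Arr C" "Dom C \<sigma>0 = X" "Cod C \<sigma>0 = A \<otimes> Y" "g0 \<in> Arr C" "Dom C g0 = V" "Cod C g0 = W"
    and e: "f0 \<cdot> b = c \<cdot> ext \<rho>0 Y" "g0 \<cdot> b = c \<cdot> ext \<sigma>0 Y"
    using assms unfolding p p' \<rho> f \<sigma> g by (auto simp: hom_iff)
  note pb = presents_facts[OF a(1)] and pc = presents_facts[OF a(2)]
  note ty = pb(3-19) pc(3-19) a(3-)
  have "\<rho>0 = \<sigma>0 \<longleftrightarrow> f0 = g0"
  proof
    assume "\<rho>0 = \<sigma>0"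
    then have "f0 \<cdot> b = g0 \<cdot> b" using e by (simp only:)
    then show "f0 = g0"
      by (rule iso_cancel_right[OF _ pb(20)]) (use ty in simp_all)
  next
    assume "f0 = g0"
    then have "c \<cdot> ext \<rho>0 Y = c \<cdot> ext \<sigma>0 Y" using e by (simp only:)
    then have "ext \<rho>0 Y = ext \<sigma>0 Y"
      by (rule iso_cancel_left[OF _ pc(20)]) (use ty in simp_all)
    then show "\<rho>0 = \<sigma>0"
      by (rule ext_inject) (use ty in simp_all)
  qed
  then show ?thesis
    by (simp add: \<rho> f \<sigma> g)
qed

lemma represents_Idn:
  assumes "presents (P, b, B)"
  shows "represents (P, b, B) (P, b, B) (sharp_Idn C \<A> P) (B, Idn C (fst B), B)"
proof -
  obtain X \<psi> V l r where P: "P = (X, \<psi>)" "B = (V, l, r)" by (metis prod.exhaust)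
  note p = presents_facts[OF assms[unfolded P]]
  show ?thesis
    using assms p(3-19) by (simp add: P hom_iff ext_Idn del: presents.simps)
qed

lemma represents_Cmp:
  assumes "represents p p' \<rho> f" "represents p' p'' \<sigma> g"
  shows "represents p p'' (sharp_Cmp C \<A> \<sigma> \<rho>) (Cmp (bimod_cat C \<A>) g f)"
proof -
  obtain X \<psi> b V l r where p: "p = ((X, \<psi>), b, (V, l, r))" by (metis prod.exhaust)
  obtain Y \<phi> c W l' r' where p': "p' = ((Y, \<phi>), c, (W, l', r'))" by (metis prod.exhaust)
  obtain Z \<chi> d U l'' r'' where p'': "p'' = ((Z, \<chi>), d, (U, l'', r''))" by (metis prod.exhaust)
  obtain \<rho>0 f0 where \<rho>: "\<rho> = ((X, \<psi>), \<rho>0, (Y, \<phi>))" and f: "f = ((V, l, r), f0, (W, l', r'))"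
    using assms(1) unfolding p p' by (cases \<rho>; cases f) auto
  obtain \<sigma>0 g0 where \<sigma>: "\<sigma> = ((Y, \<phi>), \<sigma>0, (Z, \<chi>))" and g: "g = ((W, l', r'), g0, (U, l'', r''))"
    using assms(2) unfolding p' p'' by (cases \<sigma>; cases g) auto
  have a: "presents ((X, \<psi>), b, (V, l, r))" "presents ((Y, \<phi>), c, (W, l', r'))" "presents ((Z, \<chi>), d, (U, l'', r''))"
    "\<rho>0 \<in> Arr C" "Dom C \<rho>0 = X" "Cod C \<rho>0 = A \<otimes> Y" "f0 \<in> Arr C" "Dom C f0 = V" "Cod C f0 = W"
    "\<sigma>0 \<in> Arr C" "Dom C \<sigma>0 = Y" "Cod C \<sigma>0 = A \<otimes> Z" "g0 \<in> Arr C" "Dom C g0 = W" "Cod C g0 = U"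
    and e: "f0 \<cdot> b = c \<cdot> ext \<rho>0 Y" "g0 \<cdot> c = d \<cdot> ext \<sigma>0 Z"
    using assms unfolding p p' p'' \<rho> f \<sigma> g by (auto simp: hom_iff)
  note pb = presents_facts[OF a(1)] and pc = presents_facts[OF a(2)] and pd = presents_facts[OF a(3)]
  note ty = pb(3-19) pc(3-19) pd(3-19) a(4-)
  have "(g0 \<cdot> f0) \<cdot> b = d \<cdot> ext \<sigma>0 Z \<cdot> ext \<rho>0 Y"
    using ty e(1) Cmp_extend[OF e(2)] by simp
  also have "ext \<sigma>0 Z \<cdot> ext \<rho>0 Y = ext (ext \<sigma>0 Z \<cdot> \<rho>0) Z"
    using ty by (intro ext_Cmp[symmetric]) simp_all
  finally have "(g0 \<cdot> f0) \<cdot> b = d \<cdot> ext ((m \<boxtimes> Idn C Z) \<cdot> (Idn C A \<boxtimes> \<sigma>0) \<cdot> \<rho>0) Z"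
    using ty by (simp add: ext_def[of \<sigma>0])
  then show ?thesis
    using ty a(1,3) by (simp add: p p'' \<rho> f \<sigma> g hom_iff del: presents.simps)
qed

text \<open>Left linearity of \<open>f\<close> is automatic, since extensions are left linear. The two sides of right
  linearity, composed with \<open>b \<otimes> A\<close>, are extensions of the two sides of the condition on \<open>\<rho>\<close>.\<close>
lemma represents_linear:
  assumes "represents p p' \<rho> f" "bimod_obj C \<A> (snd (snd p))" "bimod_obj C \<A> (snd (snd p'))"
  shows "bimod_arr C \<A> f \<longleftrightarrow> sharp_arr C \<A> \<rho>"
proof -
  obtain X \<psi> b V l r where p: "p = ((X, \<psi>), b, (V, l, r))" by (metis prod.exhaust)
  obtain Y \<phi> c W l' r' where p': "p' = ((Y, \<phi>), c, (W, l', r'))" by (metis prod.exhaust)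
  obtain \<rho>0 f0 where \<rho>: "\<rho> = ((X, \<psi>), \<rho>0, (Y, \<phi>))" and f: "f = ((V, l, r), f0, (W, l', r'))"
    using assms(1) unfolding p p' by (cases \<rho>; cases f) auto
  have a: "presents ((X, \<psi>), b, (V, l, r))" "presents ((Y, \<phi>), c, (W, l', r'))"
    "\<rho>0 \<in> Arr C" "Dom C \<rho>0 = X" "Cod C \<rho>0 = A \<otimes> Y" "f0 \<in> Arr C" "Dom C f0 = V" "Cod C f0 = W"
    and e: "f0 \<cdot> b = c \<cdot> ext \<rho>0 Y"
    using assms(1) unfolding p p' \<rho> f by (auto simp: hom_iff)
  note pb = presents_facts[OF a(1)] and pc = presents_facts[OF a(2)]
  note ty = pb(3-19) pc(3-19) a(3-)
  have x: "ext \<rho>0 Y \<in> Arr C" "Dom C (ext \<rho>0 Y) = A \<otimes> X" "Cod C (ext \<rho>0 Y) = A \<otimes> Y"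
    using ty by simp_all
  have "(f0 \<cdot> l) \<cdot> (Idn C A \<boxtimes> b) = f0 \<cdot> (b \<cdot> (m \<boxtimes> Idn C X))"
    using ty pb(21) by simp
  also have "\<dots> = c \<cdot> (ext \<rho>0 Y \<cdot> (m \<boxtimes> Idn C X))"
    using ty x Cmp_extend[OF e] by simp
  also have "ext \<rho>0 Y \<cdot> (m \<boxtimes> Idn C X) = (m \<boxtimes> Idn C Y) \<cdot> (Idn C A \<boxtimes> ext \<rho>0 Y)"
    using ty by (intro ext_linear) simp_all
  also have "c \<cdot> ((m \<boxtimes> Idn C Y) \<cdot> (Idn C A \<boxtimes> ext \<rho>0 Y)) = l' \<cdot> (Idn C A \<boxtimes> (c \<cdot> ext \<rho>0 Y))"
    using ty x Cmp_extend[OF pc(21)] by simp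
  also have "\<dots> = (l' \<cdot> (Idn C A \<boxtimes> f0)) \<cdot> (Idn C A \<boxtimes> b)"
    unfolding e[symmetric] using ty by simp
  finally have left: "f0 \<cdot> l = l' \<cdot> (Idn C A \<boxtimes> f0)"
    by (rule iso_cancel_right) (use ty in \<open>simp_all add: is_iso_TenA is_iso_Idn pb(20)\<close>)
  have "(f0 \<cdot> r) \<cdot> (b \<boxtimes> Idn C A) = f0 \<cdot> (b \<cdot> ext \<psi> X)"
    unfolding pb(22) using ty by simp
  also have "\<dots> = c \<cdot> (ext \<rho>0 Y \<cdot> ext \<psi> X)"
    using ty x Cmp_extend[OF e] by simp
  also have "ext \<rho>0 Y \<cdot> ext \<psi> X = ext (ext \<rho>0 Y \<cdot> \<psi>) Y"
    using ty by (intro ext_Cmp[symmetric]) simp_all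
  finally have R1: "(f0 \<cdot> r) \<cdot> (b \<boxtimes> Idn C A) = c \<cdot> ext (ext \<rho>0 Y \<cdot> \<psi>) Y" .
  have "(r' \<cdot> (f0 \<boxtimes> Idn C A)) \<cdot> (b \<boxtimes> Idn C A) = r' \<cdot> ((f0 \<cdot> b) \<boxtimes> Idn C A)"
    using ty by simp
  also have "\<dots> = (c \<cdot> ext \<phi> Y) \<cdot> (ext \<rho>0 Y \<boxtimes> Idn C A)"
    unfolding e pc(22) using ty x by simp
  also have "\<dots> = c \<cdot> ((ext \<phi> Y \<cdot> (m \<boxtimes> Idn C (Y \<otimes> A))) \<cdot> (Idn C A \<boxtimes> (\<rho>0 \<boxtimes> Idn C A)))"
    using ty by (simp add: ext_def[of \<rho>0])
  also have "\<dots> = c \<cdot> ext (ext \<phi> Y \<cdot> (\<rho>0 \<boxtimes> Idn C A)) Y"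
    unfolding ext_right_action(3)[OF pc(1)] using ty by (simp add: ext_def[of "_ \<cdot> _"])
  finally have R2: "(r' \<cdot> (f0 \<boxtimes> Idn C A)) \<cdot> (b \<boxtimes> Idn C A) = c \<cdot> ext (ext \<phi> Y \<cdot> (\<rho>0 \<boxtimes> Idn C A)) Y" .
  have "f0 \<cdot> r = r' \<cdot> (f0 \<boxtimes> Idn C A) \<longleftrightarrow> ext \<rho>0 Y \<cdot> \<psi> = ext \<phi> Y \<cdot> (\<rho>0 \<boxtimes> Idn C A)"
  proof
    assume "f0 \<cdot> r = r' \<cdot> (f0 \<boxtimes> Idn C A)"
    then have "c \<cdot> ext (ext \<rho>0 Y \<cdot> \<psi>) Y = c \<cdot> ext (ext \<phi> Y \<cdot> (\<rho>0 \<boxtimes> Idn C A)) Y"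
      by (simp only: R1[symmetric] R2[symmetric])
    then have "ext (ext \<rho>0 Y \<cdot> \<psi>) Y = ext (ext \<phi> Y \<cdot> (\<rho>0 \<boxtimes> Idn C A)) Y"
      by (rule iso_cancel_left[OF _ pc(20)]) (use ty x in simp_all)
    then show "ext \<rho>0 Y \<cdot> \<psi> = ext \<phi> Y \<cdot> (\<rho>0 \<boxtimes> Idn C A)"
      by (rule ext_inject) (use ty x in simp_all)
  next
    assume "ext \<rho>0 Y \<cdot> \<psi> = ext \<phi> Y \<cdot> (\<rho>0 \<boxtimes> Idn C A)"
    then have "(f0 \<cdot> r) \<cdot> (b \<boxtimes> Idn C A) = (r' \<cdot> (f0 \<boxtimes> Idn C A)) \<cdot> (b \<boxtimes> Idn C A)"
      by (simp only: R1 R2)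
    then show "f0 \<cdot> r = r' \<cdot> (f0 \<boxtimes> Idn C A)"
      by (rule iso_cancel_right) (use ty in \<open>simp_all add: is_iso_TenA is_iso_Idn pb(20)\<close>)
  qed
  moreover have "sharp_arr C \<A> \<rho> \<longleftrightarrow> ext \<rho>0 Y \<cdot> \<psi> = ext \<phi> Y \<cdot> (\<rho>0 \<boxtimes> Idn C A)"
    using ty pb(1) pc(1) by (simp add: \<rho> hom_iff ext_def del: sharp_obj.simps)
  ultimately show ?thesis
    using assms(2,3) left ty by (simp add: f p p' hom_iff del: bimod_obj.simps)
qed

lemma represents_ext:
  assumes "presents ((X, \<psi>), b, B)" "presents ((Y, \<phi>), c, D)" "\<rho> \<in> hom C X (A \<otimes> Y)"
    and "f \<in> Arr C" "Dom C f = Cod C b" "Cod C f = Cod C c" "f \<cdot> b = c \<cdot> ext \<rho> Y"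
  shows "represents ((X, \<psi>), b, B) ((Y, \<phi>), c, D) ((X, \<psi>), \<rho>, (Y, \<phi>)) (B, f, D)"
proof -
  obtain V l r W l' r' where B: "B = (V, l, r)" "D = (W, l', r')" by (metis prod.exhaust)
  show ?thesis
    using assms presents_facts(13)[OF assms(1)[unfolded B]] presents_facts(13)[OF assms(2)[unfolded B]]
    by (simp add: B hom_iff del: presents.simps)
qed

text \<open>The representing arrow is \<open>f\<close>, read as an arrow \<open>A \<otimes> X \<rightarrow> A \<otimes> Y\<close>, restricted along the unit of \<open>A\<close>.\<close>
lemma represents_onto:
  assumes p: "presents (P, b, B)" and p': "presents (Q, c, D)" and f: "bimod_arr C \<A> (B, f, D)"
  obtains \<rho> where "represents (P, b, B) (Q, c, D) (P, \<rho>, Q) (B, f, D)"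
proof -
  obtain X \<psi> V l r where P: "P = (X, \<psi>)" "B = (V, l, r)" by (metis prod.exhaust)
  obtain Y \<phi> W l' r' where Q: "Q = (Y, \<phi>)" "D = (W, l', r')" by (metis prod.exhaust)
  note pb = presents_facts[OF p[unfolded P]] and pc = presents_facts[OF p'[unfolded Q]]
  have ft: "f \<in> Arr C" "Dom C f = V" "Cod C f = W" and fl: "f \<cdot> l = l' \<cdot> (Idn C A \<boxtimes> f)"
    using f by (auto simp: P Q hom_iff)
  obtain c' where c': "c' \<in> Arr C" "Dom C c' = W" "Cod C c' = A \<otimes> Y" "c \<cdot> c' = Idn C W"
    "c' \<cdot> l' = (m \<boxtimes> Idn C Y) \<cdot> (Idn C A \<boxtimes> c')"
    using pc(2) by (rule free_onE) blast
  note ty = pb(3-19) pc(3-19) ft c'(1-3)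
  let ?h = "c' \<cdot> f \<cdot> b"
  have "?h \<cdot> (m \<boxtimes> Idn C X) = c' \<cdot> (f \<cdot> l) \<cdot> (Idn C A \<boxtimes> b)"
    using ty pb(21) by simp
  also have "\<dots> = (c' \<cdot> l') \<cdot> (Idn C A \<boxtimes> (f \<cdot> b))"
    unfolding fl using ty by simp
  also have "\<dots> = (m \<boxtimes> Idn C Y) \<cdot> (Idn C A \<boxtimes> ?h)"
    unfolding c'(5) using ty by simp
  finally have h: "?h = ext (?h \<cdot> (u \<boxtimes> Idn C X)) Y"
    by (rule linear_eq_ext) (use ty in simp_all)
  have "c \<cdot> ?h = f \<cdot> b"
    using ty Cmp_extend[OF c'(4)] by simp
  then have fb: "f \<cdot> b = c \<cdot> ext (?h \<cdot> (u \<boxtimes> Idn C X)) Y"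
    unfolding h[symmetric] by (rule sym)
  have "represents ((X, \<psi>), b, B) ((Y, \<phi>), c, D) ((X, \<psi>), ?h \<cdot> (u \<boxtimes> Idn C X), (Y, \<phi>)) (B, f, D)"
    by (rule represents_ext[OF p[unfolded P(1)] p'[unfolded Q(1)] _ _ _ _ fb]) (use ty in \<open>simp_all add: hom_iff\<close>)
  then show thesis
    using that unfolding P(1) Q(1) by blast
qed

text \<open>The factorization \<open>h\<close> that defines the tensor product of \<open>f\<close> and \<open>g\<close> exists because \<open>f\<close> is right
  linear and \<open>g\<close> is left linear. Its value on generators is computed by pushing \<open>b \<otimes> c\<close> through the
  projections.\<close>
lemma represents_TenA:
  assumes rf: "represents p p' \<rho> f" and sg: "represents q q' \<sigma> g"
    and fa: "bimod_arr C \<A> f" and ga: "bimod_arr C \<A> g"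
  shows "represents (tensor_pres p q) (tensor_pres p' q') (sharp_TenA C \<A> \<rho> \<sigma>) (bimod_TenA C \<A> f g)"
proof -
  obtain X \<psi> b V l r where p: "p = ((X, \<psi>), b, (V, l, r))" by (metis prod.exhaust)
  obtain X' \<psi>' b' V' l\<^sub>1 r\<^sub>1 where p': "p' = ((X', \<psi>'), b', (V', l\<^sub>1, r\<^sub>1))" by (metis prod.exhaust)
  obtain Y \<phi> c W k s where q: "q = ((Y, \<phi>), c, (W, k, s))" by (metis prod.exhaust)
  obtain Y' \<phi>' c' W' k\<^sub>1 s\<^sub>1 where q': "q' = ((Y', \<phi>'), c', (W', k\<^sub>1, s\<^sub>1))" by (metis prod.exhaust)
  obtain \<rho>0 f0 where \<rho>: "\<rho> = ((X, \<psi>), \<rho>0, (X', \<psi>'))" and f: "f = ((V, l, r), f0, (V', l\<^sub>1, r\<^sub>1))"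
    using rf unfolding p p' by (cases \<rho>; cases f) auto
  obtain \<sigma>0 g0 where \<sigma>: "\<sigma> = ((Y, \<phi>), \<sigma>0, (Y', \<phi>'))" and g: "g = ((W, k, s), g0, (W', k\<^sub>1, s\<^sub>1))"
    using sg unfolding q q' by (cases \<sigma>; cases g) auto
  have B: "presents ((X, \<psi>), b, (V, l, r))" "presents ((X', \<psi>'), b', (V', l\<^sub>1, r\<^sub>1))"
    "presents ((Y, \<phi>), c, (W, k, s))" "presents ((Y', \<phi>'), c', (W', k\<^sub>1, s\<^sub>1))"
    and a: "\<rho>0 \<in> Arr C" "Dom C \<rho>0 = X" "Cod C \<rho>0 = A \<otimes> X'" "f0 \<in> Arr C" "Dom C f0 = V" "Cod C f0 = V'"
    "\<sigma>0 \<in> Arr C" "Dom C \<sigma>0 = Y" "Cod C \<sigma>0 = A \<otimes> Y'" "g0 \<in> Arr C" "Dom C g0 = W" "Cod C g0 = W'"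
    and e: "f0 \<cdot> b = b' \<cdot> ext \<rho>0 X'" "g0 \<cdot> c = c' \<cdot> ext \<sigma>0 Y'"
    using rf sg unfolding p p' q q' \<rho> f \<sigma> g by (auto simp: hom_iff)
  have fr: "f0 \<cdot> r = r\<^sub>1 \<cdot> (f0 \<boxtimes> Idn C A)" and gl: "g0 \<cdot> k = k\<^sub>1 \<cdot> (Idn C A \<boxtimes> g0)"
    using fa ga unfolding f g by auto
  note P = presents_facts[OF B(1)] and P' = presents_facts[OF B(2)]
    and Q = presents_facts[OF B(3)] and Q' = presents_facts[OF B(4)]
  define z where "z = bimod_proj C (V, l, r) (W, k, s)"
  define z' where "z' = bimod_proj C (V', l\<^sub>1, r\<^sub>1) (W', k\<^sub>1, s\<^sub>1)"
  define t where "t = fst (snd (tensor_pres ((X, \<psi>), b, (V, l, r)) ((Y, \<phi>), c, (W, k, s))))"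
  define t' where "t' = fst (snd (tensor_pres ((X', \<psi>'), b', (V', l\<^sub>1, r\<^sub>1)) ((Y', \<phi>'), c', (W', k\<^sub>1, s\<^sub>1))))"
  note z = bimod_proj_presented[OF B(1,3), folded z_def t_def]
    and z' = bimod_proj_presented[OF B(2,4), folded z'_def t'_def]
  note ty = P(3-6,10-19) P'(3-6,10-19) Q(3-6,10-19) Q'(3-6,10-19) a z(3-7) z'(3-7)
  have x: "ext \<rho>0 X' \<in> Arr C" "Dom C (ext \<rho>0 X') = A \<otimes> X" "Cod C (ext \<rho>0 X') = A \<otimes> X'"
    "ext \<sigma>0 Y' \<in> Arr C" "Dom C (ext \<sigma>0 Y') = A \<otimes> Y" "Cod C (ext \<sigma>0 Y') = A \<otimes> Y'"
    using ty by simp_all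
  have "(z' \<cdot> (f0 \<boxtimes> g0)) \<cdot> (r \<boxtimes> Idn C W) = z' \<cdot> ((f0 \<cdot> r) \<boxtimes> g0)"
    using ty by (simp add: TenA_Cmp_arr)
  also have "\<dots> = (z' \<cdot> (r\<^sub>1 \<boxtimes> Idn C W')) \<cdot> (f0 \<boxtimes> (Idn C A \<boxtimes> g0))"
    unfolding fr using ty TenA_Cmp_arr[of "f0 \<boxtimes> Idn C A" r\<^sub>1 g0 "Idn C W'"] by simp
  also have "\<dots> = z' \<cdot> (f0 \<boxtimes> (g0 \<cdot> k))"
    unfolding coequalizer_typing(7)[OF z'(1)] gl using ty TenA_Cmp_arr[of f0 "Idn C V'" "Idn C A \<boxtimes> g0" k\<^sub>1] by simp
  also have "\<dots> = (z' \<cdot> (f0 \<boxtimes> g0)) \<cdot> (Idn C V \<boxtimes> k)"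
    using ty TenA_Cmp_arr[of "Idn C V" f0 k g0] by simp
  finally have zz: "(z' \<cdot> (f0 \<boxtimes> g0)) \<cdot> (r \<boxtimes> Idn C W) = (z' \<cdot> (f0 \<boxtimes> g0)) \<cdot> (Idn C V \<boxtimes> k)" .
  define h where "h = factor C z (z' \<cdot> (f0 \<boxtimes> g0))"
  have h: "h \<in> Arr C" "Dom C h = Cod C z" "Cod C h = Cod C z'" "h \<cdot> z = z' \<cdot> (f0 \<boxtimes> g0)"
    using factor_coequalizer[OF z(1) _ _ zz] ty by (simp_all add: h_def)
  let ?\<tau> = "(m \<boxtimes> Idn C X' \<boxtimes> Idn C Y') \<cdot> (Idn C A \<boxtimes> \<psi>' \<boxtimes> Idn C Y') \<cdot> (\<rho>0 \<boxtimes> \<sigma>0)"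
  let ?i = "Idn C (A \<otimes> X) \<boxtimes> (u \<boxtimes> Idn C Y)"
  have \<tau>: "?\<tau> = (ext \<psi>' X' \<boxtimes> Idn C Y') \<cdot> (\<rho>0 \<boxtimes> \<sigma>0)"
    using ty by (simp add: ext_def[of \<psi>'])
  have "ext ?\<tau> (X' \<otimes> Y') = (((m \<boxtimes> Idn C X') \<cdot> (Idn C A \<boxtimes> ext \<psi>' X')) \<boxtimes> Idn C Y') \<cdot> (Idn C A \<boxtimes> (\<rho>0 \<boxtimes> \<sigma>0))"
    unfolding \<tau> using ty by (simp add: ext_def[of "_ \<cdot> _"])
  also have "\<dots> = (ext \<psi>' X' \<boxtimes> Idn C Y') \<cdot> ((m \<boxtimes> Idn C (X' \<otimes> A \<otimes> Y')) \<cdot> (Idn C A \<boxtimes> (\<rho>0 \<boxtimes> \<sigma>0)))"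
    unfolding ext_right_action(3)[OF P'(1), symmetric] using ty by simp
  also have "(m \<boxtimes> Idn C (X' \<otimes> A \<otimes> Y')) \<cdot> (Idn C A \<boxtimes> (\<rho>0 \<boxtimes> \<sigma>0)) = ext \<rho>0 X' \<boxtimes> \<sigma>0"
    using ty TenA_Cmp_arr[of "Idn C A \<boxtimes> \<rho>0" "m \<boxtimes> Idn C X'" \<sigma>0 "Idn C (A \<otimes> Y')"] by (simp add: ext_def[of \<rho>0])
  finally have x\<tau>: "ext ?\<tau> (X' \<otimes> Y') = (ext \<psi>' X' \<boxtimes> Idn C Y') \<cdot> (ext \<rho>0 X' \<boxtimes> \<sigma>0)" .
  have "h \<cdot> t = (h \<cdot> z) \<cdot> ((b \<boxtimes> c) \<cdot> ?i)"
    using ty h(1-3) by (simp add: t_def z_def[symmetric] del: bimod_proj.simps)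
  also have "\<dots> = z' \<cdot> (((f0 \<boxtimes> g0) \<cdot> (b \<boxtimes> c)) \<cdot> ?i)"
    unfolding h(4) using ty by simp
  also have "(f0 \<boxtimes> g0) \<cdot> (b \<boxtimes> c) = (b' \<boxtimes> c') \<cdot> (ext \<rho>0 X' \<boxtimes> ext \<sigma>0 Y')"
    using ty x e by (simp add: TenA_Cmp_arr)
  also have "z' \<cdot> (((b' \<boxtimes> c') \<cdot> (ext \<rho>0 X' \<boxtimes> ext \<sigma>0 Y')) \<cdot> ?i) = (z' \<cdot> (b' \<boxtimes> c')) \<cdot> ((ext \<rho>0 X' \<boxtimes> ext \<sigma>0 Y') \<cdot> ?i)"
    using ty x by simp
  also have "(ext \<rho>0 X' \<boxtimes> ext \<sigma>0 Y') \<cdot> ?i = ext \<rho>0 X' \<boxtimes> (ext \<sigma>0 Y' \<cdot> (u \<boxtimes> Idn C Y))"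
    using ty x TenA_Cmp_arr[of "Idn C (A \<otimes> X)" "ext \<rho>0 X'" "u \<boxtimes> Idn C Y" "ext \<sigma>0 Y'"] by simp
  also have "ext \<sigma>0 Y' \<cdot> (u \<boxtimes> Idn C Y) = \<sigma>0"
    using ty by (intro ext_unit) simp_all
  also have "(z' \<cdot> (b' \<boxtimes> c')) \<cdot> (ext \<rho>0 X' \<boxtimes> \<sigma>0) = t' \<cdot> ext ?\<tau> (X' \<otimes> Y')"
    unfolding z'(8) x\<tau> using ty x by simp
  finally have ht: "h \<cdot> t = t' \<cdot> ext ?\<tau> (X' \<otimes> Y')" .
  have T: "tensor_pres p q = (sharp_TenO C (X, \<psi>) (Y, \<phi>), t, bimod_TenO C \<A> (V, l, r) (W, k, s))"
    "tensor_pres p' q' = (sharp_TenO C (X', \<psi>') (Y', \<phi>'), t', bimod_TenO C \<A> (V', l\<^sub>1, r\<^sub>1) (W', k\<^sub>1, s\<^sub>1))"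
    unfolding p p' q q' t_def t'_def by simp_all
  have pT: "presents (tensor_pres p q)" "presents (tensor_pres p' q')"
    unfolding p p' q q' using presents_TenO B by blast+
  have "represents (tensor_pres p q) (tensor_pres p' q')
     (sharp_TenO C (X, \<psi>) (Y, \<phi>), ?\<tau>, sharp_TenO C (X', \<psi>') (Y', \<phi>'))
     (bimod_TenO C \<A> (V, l, r) (W, k, s), h, bimod_TenO C \<A> (V', l\<^sub>1, r\<^sub>1) (W', k\<^sub>1, s\<^sub>1))"
    using pT unfolding T sharp_TenO.simps
    by (rule represents_ext[OF _ _ _ _ _ _ ht]) (use ty h in \<open>simp_all add: hom_iff\<close>)
  then show ?thesis
    by (simp only: \<rho> \<sigma> f g sharp_TenA.simps bimod_TenA.simps fst_conv z_def[symmetric] z'_def[symmetric] h_def)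
qed

text \<open>Both composite projections out of \<open>V \<otimes> W \<otimes> U\<close>, composed with \<open>b \<otimes> c \<otimes> d\<close>, are an isomorphism
  after the same arrow \<open>A \<otimes> X \<otimes> A \<otimes> Y \<otimes> A \<otimes> Z \<rightarrow> A \<otimes> X \<otimes> Y \<otimes> Z\<close>; the associativity arrow is the quotient
  of these two isomorphisms and therefore represented by an identity.\<close>
lemma represents_Assoc:
  assumes "presents p" "presents q" "presents s"
  shows "represents (tensor_pres (tensor_pres p q) s) (tensor_pres p (tensor_pres q s))
    (sharp_Idn C \<A> (sharp_TenO C (fst p) (sharp_TenO C (fst q) (fst s))))
    (bimod_Assoc C \<A> (snd (snd p)) (snd (snd q)) (snd (snd s)))"
proof -
  obtain X \<psi> b V l r where p: "p = ((X, \<psi>), b, (V, l, r))" by (metis prod.exhaust)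
  obtain Y \<phi> c W l' r' where q: "q = ((Y, \<phi>), c, (W, l', r'))" by (metis prod.exhaust)
  obtain Z \<chi> d U l'' r'' where s: "s = ((Z, \<chi>), d, (U, l'', r''))" by (metis prod.exhaust)
  note B = assms[unfolded p q s]
  note P = presents_facts[OF B(1)] and Q = presents_facts[OF B(2)] and S = presents_facts[OF B(3)]
  obtain N k\<^sub>l k\<^sub>r where N: "bimod_TenO C \<A> (V, l, r) (W, l', r') = (N, k\<^sub>l, k\<^sub>r)" by (metis prod.exhaust)
  obtain M m\<^sub>l m\<^sub>r where M: "bimod_TenO C \<A> (W, l', r') (U, l'', r'') = (M, m\<^sub>l, m\<^sub>r)" by (metis prod.exhaust)
  define t where "t = fst (snd (tensor_pres ((X, \<psi>), b, (V, l, r)) ((Y, \<phi>), c, (W, l', r'))))"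
  define t' where "t' = fst (snd (tensor_pres ((Y, \<phi>), c, (W, l', r')) ((Z, \<chi>), d, (U, l'', r''))))"
  define z where "z = bimod_proj C (V, l, r) (W, l', r')"
  define z' where "z' = bimod_proj C (W, l', r') (U, l'', r'')"
  let ?\<psi> = "(\<psi> \<boxtimes> Idn C Y) \<cdot> (Idn C X \<boxtimes> \<phi>)" and ?\<phi> = "(\<phi> \<boxtimes> Idn C Z) \<cdot> (Idn C Y \<boxtimes> \<chi>)"
  have T: "tensor_pres p q = ((X \<otimes> Y, ?\<psi>), t, (N, k\<^sub>l, k\<^sub>r))"
    and T': "tensor_pres q s = ((Y \<otimes> Z, ?\<phi>), t', (M, m\<^sub>l, m\<^sub>r))"
    unfolding p q s t_def t'_def N[symmetric] M[symmetric] by simp_all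
  have BT: "presents ((X \<otimes> Y, ?\<psi>), t, (N, k\<^sub>l, k\<^sub>r))" and BT': "presents ((Y \<otimes> Z, ?\<phi>), t', (M, m\<^sub>l, m\<^sub>r))"
    using presents_TenO[OF B(1,2)] presents_TenO[OF B(2,3)] unfolding T[symmetric] T'[symmetric] p q s by auto
  define t\<^sub>1 where "t\<^sub>1 = fst (snd (tensor_pres ((X \<otimes> Y, ?\<psi>), t, (N, k\<^sub>l, k\<^sub>r)) ((Z, \<chi>), d, (U, l'', r''))))"
  define t\<^sub>2 where "t\<^sub>2 = fst (snd (tensor_pres ((X, \<psi>), b, (V, l, r)) ((Y \<otimes> Z, ?\<phi>), t', (M, m\<^sub>l, m\<^sub>r))))"
  define z\<^sub>1 where "z\<^sub>1 = bimod_proj C (N, k\<^sub>l, k\<^sub>r) (U, l'', r'')"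
  define z\<^sub>2 where "z\<^sub>2 = bimod_proj C (V, l, r) (M, m\<^sub>l, m\<^sub>r)"
  note z = bimod_proj_presented[OF B(1,2), folded z_def t_def]
    and z' = bimod_proj_presented[OF B(2,3), folded z'_def t'_def]
    and z1 = bimod_proj_presented[OF BT B(3), folded z\<^sub>1_def t\<^sub>1_def]
    and z2 = bimod_proj_presented[OF B(1) BT', folded z\<^sub>2_def t\<^sub>2_def]
  have codz: "Cod C z = N" "Cod C z' = M"
    using presents_facts(13)[OF BT] presents_facts(13)[OF BT'] z(5) z'(5) by simp_all
  obtain v where v: "v \<in> Arr C" "Dom C v = N" "Cod C v = V \<otimes> W" "z \<cdot> v = Idn C N"
    using bimod_proj_section[OF B(1,2)] unfolding z_def[symmetric] codz by blast
  obtain v\<^sub>1 where v1: "v\<^sub>1 \<in> Arr C" "Dom C v\<^sub>1 = Cod C z\<^sub>1" "Cod C v\<^sub>1 = N \<otimes> U" "z\<^sub>1 \<cdot> v\<^sub>1 = Idn C (Cod C z\<^sub>1)"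
    using bimod_proj_section[OF BT B(3)] unfolding z\<^sub>1_def[symmetric] by blast
  obtain t\<^sub>1' where t1': "t\<^sub>1' \<in> Arr C" "Dom C t\<^sub>1' = Cod C z\<^sub>1" "Cod C t\<^sub>1' = A \<otimes> X \<otimes> Y \<otimes> Z"
    "t\<^sub>1' \<cdot> t\<^sub>1 = Idn C (A \<otimes> X \<otimes> Y \<otimes> Z)"
    using iso_inverse[OF z1(2)] z1(4,5) P(3) Q(3) S(3) by (metis TenO_simps(2,5) algebra_typing(1))
  have NM: "N \<in> Obj C" "M \<in> Obj C"
    using presents_facts(10)[OF BT] presents_facts(10)[OF BT'] by simp_all
  note ty = P(3-19) Q(3-19) S(3-19) z(3,4,6,7) z(5)[unfolded codz] z'(3,4,6,7) z'(5)[unfolded codz] z1(3-7) z2(3-7) codz NM v(1-3) v1(1-3) t1'(1-3)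
  note xt = presents_facts(7-9)[OF BT]
  have "z\<^sub>1 \<cdot> (z \<boxtimes> Idn C U) \<cdot> (b \<boxtimes> (c \<boxtimes> d)) = z\<^sub>1 \<cdot> ((z \<cdot> (b \<boxtimes> c)) \<boxtimes> d)"
    using ty TenA_Cmp_arr[of "b \<boxtimes> c" z d "Idn C U"] by simp
  also have "\<dots> = (z\<^sub>1 \<cdot> (t \<boxtimes> d)) \<cdot> (ext \<psi> X \<boxtimes> Idn C (Y \<otimes> A \<otimes> Z))"
    unfolding z(8) using ty TenA_Cmp_arr[of "ext \<psi> X \<boxtimes> Idn C Y" t "Idn C (A \<otimes> Z)" d] by simp
  also have "\<dots> = t\<^sub>1 \<cdot> ((ext ?\<psi> (X \<otimes> Y) \<cdot> (ext \<psi> X \<boxtimes> Idn C (Y \<otimes> A))) \<boxtimes> Idn C Z)"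
    unfolding z1(8) using ty xt by simp
  finally have e1: "z\<^sub>1 \<cdot> (z \<boxtimes> Idn C U) \<cdot> (b \<boxtimes> (c \<boxtimes> d))
      = t\<^sub>1 \<cdot> (ext \<psi> X \<boxtimes> Idn C (Y \<otimes> Z)) \<cdot> (Idn C (A \<otimes> X) \<boxtimes> (ext \<phi> Y \<boxtimes> Idn C Z))"
    unfolding ext_TenO(2)[OF P(1) Q(1)] using ty by simp
  have "z\<^sub>2 \<cdot> (Idn C V \<boxtimes> z') \<cdot> (b \<boxtimes> (c \<boxtimes> d)) = z\<^sub>2 \<cdot> (b \<boxtimes> (z' \<cdot> (c \<boxtimes> d)))"
    using ty TenA_Cmp_arr[of b "Idn C V" "c \<boxtimes> d" z'] by simp
  also have "\<dots> = (z\<^sub>2 \<cdot> (b \<boxtimes> t')) \<cdot> (Idn C (A \<otimes> X) \<boxtimes> (ext \<phi> Y \<boxtimes> Idn C Z))"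
    unfolding z'(8) using ty TenA_Cmp_arr[of "Idn C (A \<otimes> X)" b "ext \<phi> Y \<boxtimes> Idn C Z" t'] by simp
  also have "\<dots> = t\<^sub>2 \<cdot> (ext \<psi> X \<boxtimes> Idn C (Y \<otimes> Z)) \<cdot> (Idn C (A \<otimes> X) \<boxtimes> (ext \<phi> Y \<boxtimes> Idn C Z))"
    unfolding z2(8) using ty by simp
  finally have e2: "z\<^sub>2 \<cdot> (Idn C V \<boxtimes> z') \<cdot> (b \<boxtimes> (c \<boxtimes> d))
      = t\<^sub>2 \<cdot> (ext \<psi> X \<boxtimes> Idn C (Y \<otimes> Z)) \<cdot> (Idn C (A \<otimes> X) \<boxtimes> (ext \<phi> Y \<boxtimes> Idn C Z))" .
  \<comment> \<open>The two projections differ only by the isomorphisms in front, by \<open>e1\<close> and \<open>e2\<close>.\<close>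
  let ?k = "t\<^sub>2 \<cdot> t\<^sub>1'" and ?e = "(ext \<psi> X \<boxtimes> Idn C (Y \<otimes> Z)) \<cdot> (Idn C (A \<otimes> X) \<boxtimes> (ext \<phi> Y \<boxtimes> Idn C Z))"
  have "(?k \<cdot> (z\<^sub>1 \<cdot> (z \<boxtimes> Idn C U))) \<cdot> (b \<boxtimes> (c \<boxtimes> d)) = ?k \<cdot> (z\<^sub>1 \<cdot> (z \<boxtimes> Idn C U) \<cdot> (b \<boxtimes> (c \<boxtimes> d)))"
    using ty by simp
  also have "\<dots> = t\<^sub>2 \<cdot> (t\<^sub>1' \<cdot> t\<^sub>1) \<cdot> ?e"
    unfolding e1 using ty by simp
  also have "\<dots> = (z\<^sub>2 \<cdot> (Idn C V \<boxtimes> z')) \<cdot> (b \<boxtimes> (c \<boxtimes> d))"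
    using ty e2 by (simp add: t1'(4))
  finally have k: "?k \<cdot> (z\<^sub>1 \<cdot> (z \<boxtimes> Idn C U)) = z\<^sub>2 \<cdot> (Idn C V \<boxtimes> z')"
    by (rule iso_cancel_right) (use ty in \<open>simp_all add: is_iso_TenA P(20) Q(20) S(20)\<close>)
  have "(z\<^sub>1 \<cdot> (z \<boxtimes> Idn C U)) \<cdot> ((v \<boxtimes> Idn C U) \<cdot> v\<^sub>1) = z\<^sub>1 \<cdot> ((z \<cdot> v) \<boxtimes> Idn C U) \<cdot> v\<^sub>1"
    using ty by simp
  also have "\<dots> = Idn C (Cod C z\<^sub>1)"
    unfolding v(4) using ty v1(4) by simp
  finally have sec: "(z\<^sub>1 \<cdot> (z \<boxtimes> Idn C U)) \<cdot> ((v \<boxtimes> Idn C U) \<cdot> v\<^sub>1) = Idn C (Cod C (z\<^sub>1 \<cdot> (z \<boxtimes> Idn C U)))"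
    using ty by simp
  have fk: "factor C (z\<^sub>1 \<cdot> (z \<boxtimes> Idn C U)) (z\<^sub>2 \<cdot> (Idn C V \<boxtimes> z')) = ?k"
    by (rule factor_split_epi[OF k sec]) (use ty in simp_all)
  have assoc: "bimod_Assoc C \<A> (V, l, r) (W, l', r') (U, l'', r'') =
      (bimod_TenO C \<A> (N, k\<^sub>l, k\<^sub>r) (U, l'', r''), ?k, bimod_TenO C \<A> (V, l, r) (M, m\<^sub>l, m\<^sub>r))"
    unfolding bimod_Assoc_def Let_def N M fst_conv
      z\<^sub>1_def[symmetric] z_def[symmetric] z\<^sub>2_def[symmetric] z'_def[symmetric] fk ..
  have T1: "tensor_pres (tensor_pres p q) s = ((X \<otimes> Y \<otimes> Z, (?\<psi> \<boxtimes> Idn C Z) \<cdot> (Idn C (X \<otimes> Y) \<boxtimes> \<chi>)), t\<^sub>1, bimod_TenO C \<A> (N, k\<^sub>l, k\<^sub>r) (U, l'', r''))"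
    unfolding T s t\<^sub>1_def using ty by simp
  have T2: "tensor_pres p (tensor_pres q s) = ((X \<otimes> Y \<otimes> Z, (?\<psi> \<boxtimes> Idn C Z) \<cdot> (Idn C (X \<otimes> Y) \<boxtimes> \<chi>)), t\<^sub>2, bimod_TenO C \<A> (V, l, r) (M, m\<^sub>l, m\<^sub>r))"
    unfolding T' p t\<^sub>2_def using ty by simp
  have pT: "presents (tensor_pres (tensor_pres p q) s)" "presents (tensor_pres p (tensor_pres q s))"
    unfolding T T' unfolding p s using presents_TenO[OF BT B(3)] presents_TenO[OF B(1) BT'] by simp_all
  have kt: "?k \<cdot> t\<^sub>1 = t\<^sub>2 \<cdot> ext (u \<boxtimes> Idn C (X \<otimes> Y \<otimes> Z)) (X \<otimes> Y \<otimes> Z)"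
    using ty t1'(4) by (simp add: ext_Idn)
  have "represents (tensor_pres (tensor_pres p q) s) (tensor_pres p (tensor_pres q s))
     ((X \<otimes> Y \<otimes> Z, (?\<psi> \<boxtimes> Idn C Z) \<cdot> (Idn C (X \<otimes> Y) \<boxtimes> \<chi>)), u \<boxtimes> Idn C (X \<otimes> Y \<otimes> Z), (X \<otimes> Y \<otimes> Z, (?\<psi> \<boxtimes> Idn C Z) \<cdot> (Idn C (X \<otimes> Y) \<boxtimes> \<chi>)))
     (bimod_TenO C \<A> (N, k\<^sub>l, k\<^sub>r) (U, l'', r''), ?k, bimod_TenO C \<A> (V, l, r) (M, m\<^sub>l, m\<^sub>r))"
    using pT unfolding T1 T2
    by (rule represents_ext[OF _ _ _ _ _ _ kt]) (use ty in \<open>simp_all add: hom_iff\<close>)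
  moreover have "sharp_Idn C \<A> (sharp_TenO C (X, \<psi>) (sharp_TenO C (Y, \<phi>) (Z, \<chi>))) =
     ((X \<otimes> Y \<otimes> Z, (?\<psi> \<boxtimes> Idn C Z) \<cdot> (Idn C (X \<otimes> Y) \<boxtimes> \<chi>)), u \<boxtimes> Idn C (X \<otimes> Y \<otimes> Z), (X \<otimes> Y \<otimes> Z, (?\<psi> \<boxtimes> Idn C Z) \<cdot> (Idn C (X \<otimes> Y) \<boxtimes> \<chi>)))"
    using ty by simp
  ultimately show ?thesis
    by (simp only: p q s assoc fst_conv snd_conv)
qed

text \<open>The regular bimodule is the free bimodule on the unit object, presented by an identity.\<close>
abbreviation unit_pres :: "('o, 'a) presentation" where
  "unit_pres \<equiv> ((\<I>, Idn C A), Idn C A, (A, m, m))"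

lemma ext_Idn_Unit: "ext (Idn C A) \<I> = m"
  by (simp add: ext_def)

lemma presents_unit: "presents unit_pres"
proof -
  have "sharp_obj C \<A> (\<I>, Idn C A)"
    by (simp add: hom_iff)
  then show ?thesis
    by (simp add: free_on_def hom_iff is_iso_Idn ext_Idn_Unit del: sharp_obj.simps)
qed

text \<open>The projection \<open>A \<otimes> V \<rightarrow> A \<otimes>\<^sub>A V\<close> and the left action both become \<open>m \<otimes> X\<close> on \<open>A \<otimes> A \<otimes> X\<close>, so the unit
  arrow is the quotient of the two presenting isomorphisms.\<close>
lemma represents_LUnit:
  assumes "presents (P, b, B)"
  shows "represents (tensor_pres unit_pres (P, b, B)) (P, b, B) (sharp_Idn C \<A> P) (bimod_LUnit C \<A> B)"
proof -
  obtain X \<psi> V l r where e: "P = (X, \<psi>)" "B = (V, l, r)" by (metis prod.exhaust)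
  note B = assms[unfolded e]
  note p = presents_facts[OF B]
  define z where "z = bimod_proj C (A, m, m) (V, l, r)"
  define t where "t = fst (snd (tensor_pres unit_pres ((X, \<psi>), b, (V, l, r))))"
  note z = bimod_proj_presented[OF presents_unit B, folded z_def t_def]
  obtain t' where t': "t' \<in> Arr C" "Dom C t' = Cod C z" "Cod C t' = A \<otimes> X" "t' \<cdot> t = Idn C (A \<otimes> X)"
    using iso_inverse[OF z(2)] z(4,5) p(3) by (metis TenO_simps(3))
  note ty = p(3-19) z(3-7) t'(1-3)
  let ?k = "b \<cdot> t'"
  have "(?k \<cdot> z) \<cdot> (Idn C A \<boxtimes> b) = b \<cdot> (t' \<cdot> t) \<cdot> (m \<boxtimes> Idn C X)"
    using ty z(8) by (simp add: ext_Idn_Unit)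
  also have "\<dots> = l \<cdot> (Idn C A \<boxtimes> b)"
    unfolding t'(4) using ty p(21) by simp
  finally have k: "?k \<cdot> z = l"
    by (rule iso_cancel_right) (use ty in \<open>simp_all add: is_iso_TenA is_iso_Idn p(20)\<close>)
  have "factor C z (?k \<cdot> z) = ?k"
    by (rule factor_of_Cmp[OF z(1)]) (use ty in simp_all)
  from this[unfolded k, unfolded z_def] have L: "bimod_LUnit C \<A> B = (bimod_TenO C \<A> (A, m, m) B, ?k, B)"
    by (simp add: e del: bimod_proj.simps bimod_TenO.simps)
  have T: "tensor_pres unit_pres (P, b, B) = (P, t, bimod_TenO C \<A> (A, m, m) B)"
    unfolding e t_def using ty by simp
  have pT: "presents (tensor_pres unit_pres (P, b, B))"
    unfolding e by (rule presents_TenO[OF presents_unit B])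
  have kt: "?k \<cdot> t = b \<cdot> ext (u \<boxtimes> Idn C X) X"
    using ty t'(4) by (simp add: ext_Idn)
  have "represents (tensor_pres unit_pres (P, b, B)) (P, b, B)
     ((X, \<psi>), u \<boxtimes> Idn C X, (X, \<psi>)) (bimod_TenO C \<A> (A, m, m) B, ?k, B)"
    using pT assms unfolding T unfolding e(1)
    by (rule represents_ext[OF _ _ _ _ _ _ kt]) (use ty in \<open>simp_all add: hom_iff\<close>)
  then show ?thesis
    by (simp only: L e(1) sharp_Idn.simps)
qed

text \<open>As for the left unit, with the right action \<open>ext \<psi> X\<close> in place of \<open>m \<otimes> X\<close>.\<close>
lemma represents_RUnit:
  assumes "presents (P, b, B)"
  shows "represents (tensor_pres (P, b, B) unit_pres) (P, b, B) (sharp_Idn C \<A> P) (bimod_RUnit C \<A> B)"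
proof -
  obtain X \<psi> V l r where e: "P = (X, \<psi>)" "B = (V, l, r)" by (metis prod.exhaust)
  note B = assms[unfolded e]
  note p = presents_facts[OF B]
  define z where "z = bimod_proj C (V, l, r) (A, m, m)"
  define t where "t = fst (snd (tensor_pres ((X, \<psi>), b, (V, l, r)) unit_pres))"
  note z = bimod_proj_presented[OF B presents_unit, folded z_def t_def]
  obtain t' where t': "t' \<in> Arr C" "Dom C t' = Cod C z" "Cod C t' = A \<otimes> X" "t' \<cdot> t = Idn C (A \<otimes> X)"
    using iso_inverse[OF z(2)] z(4,5) p(3) by (metis TenO_simps(4))
  note ty = p(3-19) z(3-7) t'(1-3)
  let ?k = "b \<cdot> t'"
  have "(?k \<cdot> z) \<cdot> (b \<boxtimes> Idn C A) = b \<cdot> (t' \<cdot> t) \<cdot> ext \<psi> X"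
    using ty z(8) by simp
  also have "\<dots> = r \<cdot> (b \<boxtimes> Idn C A)"
    unfolding t'(4) using ty p(22) by simp
  finally have k: "?k \<cdot> z = r"
    by (rule iso_cancel_right) (use ty in \<open>simp_all add: is_iso_TenA is_iso_Idn p(20)\<close>)
  have "factor C z (?k \<cdot> z) = ?k"
    by (rule factor_of_Cmp[OF z(1)]) (use ty in simp_all)
  from this[unfolded k, unfolded z_def] have L: "bimod_RUnit C \<A> B = (bimod_TenO C \<A> B (A, m, m), ?k, B)"
    by (simp add: e del: bimod_proj.simps bimod_TenO.simps)
  have T: "tensor_pres (P, b, B) unit_pres = (P, t, bimod_TenO C \<A> B (A, m, m))"
    unfolding e t_def using ty by simp
  have pT: "presents (tensor_pres (P, b, B) unit_pres)"
    unfolding e by (rule presents_TenO[OF B presents_unit])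
  have kt: "?k \<cdot> t = b \<cdot> ext (u \<boxtimes> Idn C X) X"
    using ty t'(4) by (simp add: ext_Idn)
  have "represents (tensor_pres (P, b, B) unit_pres) (P, b, B)
     ((X, \<psi>), u \<boxtimes> Idn C X, (X, \<psi>)) (bimod_TenO C \<A> B (A, m, m), ?k, B)"
    using pT assms unfolding T unfolding e(1)
    by (rule represents_ext[OF _ _ _ _ _ _ kt]) (use ty in \<open>simp_all add: hom_iff\<close>)
  then show ?thesis
    by (simp only: L e(1) sharp_Idn.simps)
qed

end

section \<open>Algebras and coalgebras of bimodules\<close>

context strict_algebra_coequalizers
begin

lemma tensor_pres_ends [simp]:
  "fst (tensor_pres p q) = sharp_TenO C (fst p) (fst q)"
  "snd (snd (tensor_pres p q)) = bimod_TenO C \<A> (snd (snd p)) (snd (snd q))"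
  by (cases p; cases q; cases "fst p"; cases "fst q"; simp)+

lemma presents_tensor_pres:
  assumes "presents p" "presents q"
  shows "presents (tensor_pres p q)"
proof -
  obtain X \<psi> b V l r where p: "p = ((X, \<psi>), b, (V, l, r))" by (metis prod.exhaust)
  obtain Y \<phi> c W k s where q: "q = ((Y, \<phi>), c, (W, k, s))" by (metis prod.exhaust)
  show ?thesis
    using assms unfolding p q by (rule presents_TenO)
qed

lemma bimod_obj_presented:
  assumes "presents p" "left_coflat C A" "left_coflat C (fst (fst p))"
  shows "bimod_obj C \<A> (snd (snd p))"
proof -
  obtain X \<psi> b V l r where p: "p = ((X, \<psi>), b, (V, l, r))" by (metis prod.exhaust)
  show ?thesis
    using assms presents_bimod_obj[of X \<psi> b V l r] unfolding p fst_conv snd_conv by blast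
qed

text \<open>Each side of an axiom for \<open>(M, E)\<close> is represented by the same side of the axiom for \<open>(\<mu>, \<eta>)\<close>, so the
  axioms are equivalent by uniqueness of representation. Coflatness enters through
  \<open>bimod_obj_presented\<close>, applied to the object itself, its square and the unit.\<close>
lemma algebra_presented:
  assumes p: "presents p" and coflat: "left_coflat C A" "left_coflat C (fst (fst p))"
    and \<mu>: "represents (tensor_pres p p) p \<mu> M" and \<eta>: "represents unit_pres p \<eta> E"
  shows "algebra_in (sharp C \<A>) (fst p, \<mu>, \<eta>) \<longleftrightarrow> algebra_in (bimod_cat C \<A>) (snd (snd p), M, E)"
proof -
  obtain P b B where e: "p = (P, b, B)" by (metis prod.exhaust)
  have sP: "sharp_obj C \<A> P"
    using p unfolding e by (cases P; cases B) auto
  have cc: "left_coflat C (fst (fst (tensor_pres p p)))"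
    using left_coflat_TenO[OF coflat(2) coflat(2)] by (cases "fst p") simp
  have B: "bimod_obj C \<A> B" and BB: "bimod_obj C \<A> (bimod_TenO C \<A> B B)" and U: "bimod_obj C \<A> (A, m, m)"
    using bimod_obj_presented[OF p coflat] bimod_obj_presented[OF presents_tensor_pres[OF p p] coflat(1) cc]
      bimod_obj_presented[OF presents_unit coflat(1)] left_coflat_Unit
    by (simp_all add: e del: bimod_obj.simps)
  have M: "bimod_arr C \<A> M \<longleftrightarrow> sharp_arr C \<A> \<mu>" and E: "bimod_arr C \<A> E \<longleftrightarrow> sharp_arr C \<A> \<eta>"
    using represents_linear[OF \<mu>] represents_linear[OF \<eta>] B BB U by (simp_all add: e del: bimod_obj.simps)
  note ends = represents_ends(3-6)[OF \<mu>] represents_ends(3-6)[OF \<eta>]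
  show ?thesis
  proof (cases "sharp_arr C \<A> \<mu> \<and> sharp_arr C \<A> \<eta>")
    case True
    then have arr: "bimod_arr C \<A> M" "bimod_arr C \<A> E"
      using M E by simp_all
    let ?i = "sharp_Idn C \<A> P" and ?I = "(B, Idn C (fst B), B)"
    have i: "represents p p ?i ?I"
      using represents_Idn p unfolding e by blast
    have Ia: "bimod_arr C \<A> ?I"
      using represents_linear[OF i] B sharp_arr_Idn[OF sP] by (simp add: e del: bimod_obj.simps)
    note assoc_left = represents_Cmp[OF represents_TenA[OF \<mu> i arr(1) Ia] \<mu>]
    note assoc_right = represents_Cmp[OF represents_Cmp[OF represents_Assoc[OF p p p] represents_TenA[OF i \<mu> Ia arr(1)]] \<mu>]
    note unit_left = represents_Cmp[OF represents_TenA[OF \<eta> i arr(2) Ia] \<mu>]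
    note unit_right = represents_Cmp[OF represents_TenA[OF i \<eta> Ia arr(2)] \<mu>]
    have L: "represents (tensor_pres unit_pres p) p ?i (bimod_LUnit C \<A> B)"
      and R: "represents (tensor_pres p unit_pres) p ?i (bimod_RUnit C \<A> B)"
      using represents_LUnit represents_RUnit p unfolding e by blast+
    show ?thesis
      using represents_unique[OF assoc_left assoc_right] represents_unique[OF unit_left L]
        represents_unique[OF unit_right R] True arr ends sP B
      by (simp add: e del: bimod_obj.simps sharp_obj.simps bimod_cat_simps(4))
  next
    case False
    then show ?thesis
      using M E by auto
  qed
qed

lemma coalgebra_presented:
  assumes p: "presents p" and coflat: "left_coflat C A" "left_coflat C (fst (fst p))"
    and \<delta>: "represents p (tensor_pres p p) \<delta> D" and \<epsilon>: "represents p unit_pres \<epsilon> E"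
  shows "coalgebra_in (sharp C \<A>) (fst p, \<delta>, \<epsilon>) \<longleftrightarrow> coalgebra_in (bimod_cat C \<A>) (snd (snd p), D, E)"
proof -
  obtain P b B where e: "p = (P, b, B)" by (metis prod.exhaust)
  have sP: "sharp_obj C \<A> P"
    using p unfolding e by (cases P; cases B) auto
  have cc: "left_coflat C (fst (fst (tensor_pres p p)))"
    using left_coflat_TenO[OF coflat(2) coflat(2)] by (cases "fst p") simp
  have B: "bimod_obj C \<A> B" and BB: "bimod_obj C \<A> (bimod_TenO C \<A> B B)" and U: "bimod_obj C \<A> (A, m, m)"
    using bimod_obj_presented[OF p coflat] bimod_obj_presented[OF presents_tensor_pres[OF p p] coflat(1) cc]
      bimod_obj_presented[OF presents_unit coflat(1)] left_coflat_Unit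
    by (simp_all add: e del: bimod_obj.simps)
  have M: "bimod_arr C \<A> D \<longleftrightarrow> sharp_arr C \<A> \<delta>" and E: "bimod_arr C \<A> E \<longleftrightarrow> sharp_arr C \<A> \<epsilon>"
    using represents_linear[OF \<delta>] represents_linear[OF \<epsilon>] B BB U by (simp_all add: e del: bimod_obj.simps)
  note ends = represents_ends(3-6)[OF \<delta>] represents_ends(3-6)[OF \<epsilon>]
  show ?thesis
  proof (cases "sharp_arr C \<A> \<delta> \<and> sharp_arr C \<A> \<epsilon>")
    case True
    then have arr: "bimod_arr C \<A> D" "bimod_arr C \<A> E"
      using M E by simp_all
    let ?i = "sharp_Idn C \<A> P" and ?I = "(B, Idn C (fst B), B)"
    have i: "represents p p ?i ?I"
      using represents_Idn p unfolding e by blast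
    have Ia: "bimod_arr C \<A> ?I"
      using represents_linear[OF i] B sharp_arr_Idn[OF sP] by (simp add: e del: bimod_obj.simps)
    have L: "represents (tensor_pres unit_pres p) p ?i (bimod_LUnit C \<A> B)"
      and R: "represents (tensor_pres p unit_pres) p ?i (bimod_RUnit C \<A> B)"
      using represents_LUnit represents_RUnit p unfolding e by blast+
    note assoc_left = represents_Cmp[OF represents_Cmp[OF \<delta> represents_TenA[OF \<delta> i arr(1) Ia]] represents_Assoc[OF p p p]]
    note assoc_right = represents_Cmp[OF \<delta> represents_TenA[OF i \<delta> Ia arr(1)]]
    note unit_left = represents_Cmp[OF represents_Cmp[OF \<delta> represents_TenA[OF \<epsilon> i arr(2) Ia]] L]
    note unit_right = represents_Cmp[OF represents_Cmp[OF \<delta> represents_TenA[OF i \<epsilon> Ia arr(2)]] R]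
    show ?thesis
      using represents_unique[OF assoc_left assoc_right] represents_unique[OF unit_left i]
        represents_unique[OF unit_right i] True arr ends sP B
      by (simp add: e del: bimod_obj.simps sharp_obj.simps bimod_cat_simps(4))
  next
    case False
    then show ?thesis
      using M E by auto
  qed
qed

text \<open>The arrow \<open>\<psi>\<close> is the right action restricted along the unit of \<open>A\<close>. Since the right action is left
  linear, it is the extension of \<open>\<psi>\<close>, and its module laws restrict to the axioms on \<open>\<psi>\<close>.\<close>
lemma bimodule_free_bimod:
  assumes "bimodule C \<A> (A \<otimes> X, m \<boxtimes> Idn C X, r)" "X \<in> Obj C"
  obtains \<psi> where "sharp_obj C \<A> (X, \<psi>)" "free_bimod C \<A> (X, \<psi>) = (A \<otimes> X, m \<boxtimes> Idn C X, r)"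
proof -
  have X: "X \<in> Obj C" by fact
  have r: "r \<in> Arr C" "Dom C r = A \<otimes> X \<otimes> A" "Cod C r = A \<otimes> X"
    "r \<cdot> (Idn C (A \<otimes> X) \<boxtimes> m) = r \<cdot> (r \<boxtimes> Idn C A)" "r \<cdot> (Idn C (A \<otimes> X) \<boxtimes> u) = Idn C (A \<otimes> X)"
    "r \<cdot> (m \<boxtimes> Idn C (X \<otimes> A)) = (m \<boxtimes> Idn C X) \<cdot> (Idn C A \<boxtimes> r)"
    using assms by (auto simp: hom_iff)
  let ?\<psi> = "r \<cdot> (u \<boxtimes> Idn C (X \<otimes> A))"
  have ext: "ext ?\<psi> X = r"
    by (rule linear_eq_ext[symmetric]) (use r X in simp_all)
  have "?\<psi> \<cdot> (Idn C X \<boxtimes> m) = r \<cdot> ((u \<boxtimes> Idn C (X \<otimes> A)) \<cdot> (Idn C X \<boxtimes> m))"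
    using r(1-3) X by simp
  also have "(u \<boxtimes> Idn C (X \<otimes> A)) \<cdot> (Idn C X \<boxtimes> m) = (Idn C (A \<otimes> X) \<boxtimes> m) \<cdot> (u \<boxtimes> Idn C (X \<otimes> A \<otimes> A))"
    using X interchange_arr[of u "Idn C X \<boxtimes> m" \<I> A "X \<otimes> A \<otimes> A" "X \<otimes> A"] by simp
  also have "r \<cdot> ((Idn C (A \<otimes> X) \<boxtimes> m) \<cdot> (u \<boxtimes> Idn C (X \<otimes> A \<otimes> A))) = r \<cdot> (?\<psi> \<boxtimes> Idn C A)"
    using r(1-3) X Cmp_extend[OF r(4)] by simp
  finally have 1: "?\<psi> \<cdot> (Idn C X \<boxtimes> m) = ext ?\<psi> X \<cdot> (?\<psi> \<boxtimes> Idn C A)"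
    unfolding ext .
  have "?\<psi> \<cdot> (Idn C X \<boxtimes> u) = r \<cdot> ((u \<boxtimes> Idn C (X \<otimes> A)) \<cdot> (Idn C X \<boxtimes> u))"
    using r(1-3) X by simp
  also have "(u \<boxtimes> Idn C (X \<otimes> A)) \<cdot> (Idn C X \<boxtimes> u) = (Idn C (A \<otimes> X) \<boxtimes> u) \<cdot> (u \<boxtimes> Idn C X)"
    using X interchange_arr[of u "Idn C X \<boxtimes> u" \<I> A X "X \<otimes> A"] by simp
  also have "r \<cdot> ((Idn C (A \<otimes> X) \<boxtimes> u) \<cdot> (u \<boxtimes> Idn C X)) = u \<boxtimes> Idn C X"
    using r(1-3) X Cmp_extend[OF r(5), of "u \<boxtimes> Idn C X"] by simp
  finally have 2: "?\<psi> \<cdot> (Idn C X \<boxtimes> u) = u \<boxtimes> Idn C X" .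
  have "sharp_obj C \<A> (X, ?\<psi>)"
    using 1 2 r(1-3) X by (simp add: hom_iff ext_def)
  moreover have "free_bimod C \<A> (X, ?\<psi>) = (A \<otimes> X, m \<boxtimes> Idn C X, r)"
    using ext by (simp add: ext_def)
  ultimately show thesis
    by (rule that)
qed

abbreviation free_pres :: "'o \<times> 'a \<Rightarrow> ('o, 'a) presentation" where
  "free_pres P \<equiv> (P, Idn C (A \<otimes> fst P), free_bimod C \<A> P)"

lemma presents_free_pres: "sharp_obj C \<A> P \<Longrightarrow> presents (free_pres P)"
  using presents_free_bimod by (cases P) (simp only: fst_conv)

lemma tensor_pres_free_tensor:
  assumes "sharp_obj C \<A> P" "sharp_obj C \<A> Q"
  shows "fst (snd (tensor_pres (free_pres P) (free_pres Q))) = free_tensor C \<A> P Q"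
proof -
  obtain X \<psi> Y \<phi> where e: "P = (X, \<psi>)" "Q = (Y, \<phi>)" by (metis prod.exhaust)
  have "X \<in> Obj C" "Y \<in> Obj C"
    using assms by (auto simp: e)
  then show ?thesis
    by (simp add: e del: bimod_proj.simps free_bimod.simps)
qed

end

section \<open>Ring and coring structures on \<open>A \<otimes> X\<close>\<close>

context strict_algebra_coequalizers
begin

text \<open>The part of \<open>wreath_to_ring\<close> after \<open>wreath_to_pair\<close>, for the algebra \<open>\<A>\<close>; similarly \<open>coring_of\<close>.\<close>
fun ring_of :: "('o \<times> 'a) \<times> (('o \<times> 'a) \<times> 'a \<times> ('o \<times> 'a)) \<times> (('o \<times> 'a) \<times> 'a \<times> ('o \<times> 'a))
    \<Rightarrow> ('o, 'a) bimod \<times> (('o, 'a) bimod \<times> 'a \<times> ('o, 'a) bimod) \<times> (('o, 'a) bimod \<times> 'a \<times> ('o, 'a) bimod)" where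
  "ring_of (P, \<mu>, \<eta>) = (let F = free_bimod C \<A> P in
     (F, (bimod_TenO C \<A> F F, factor C (free_tensor C \<A> P P) (free_arr C \<A> \<mu>), F),
         ((A, m, m), free_arr C \<A> \<eta>, F)))"

fun coring_of :: "('o \<times> 'a) \<times> (('o \<times> 'a) \<times> 'a \<times> ('o \<times> 'a)) \<times> (('o \<times> 'a) \<times> 'a \<times> ('o \<times> 'a))
    \<Rightarrow> ('o, 'a) bimod \<times> (('o, 'a) bimod \<times> 'a \<times> ('o, 'a) bimod) \<times> (('o, 'a) bimod \<times> 'a \<times> ('o, 'a) bimod)" where
  "coring_of (P, \<delta>, \<epsilon>) = (let F = free_bimod C \<A> P in
     (F, (F, free_tensor C \<A> P P \<cdot> free_arr C \<A> \<delta>, bimod_TenO C \<A> F F),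
         (F, free_arr C \<A> \<epsilon>, (A, m, m))))"

lemma free_pres_TenO:
  assumes "sharp_obj C \<A> P"
  shows "tensor_pres (free_pres P) (free_pres P) =
      (sharp_TenO C P P, free_tensor C \<A> P P, bimod_TenO C \<A> (free_bimod C \<A> P) (free_bimod C \<A> P))"
    and "is_iso C (free_tensor C \<A> P P)" "Dom C (free_tensor C \<A> P P) = A \<otimes> fst P \<otimes> fst P"
proof -
  obtain X \<psi> where P: "P = (X, \<psi>)" by (cases P)
  let ?t = "tensor_pres (free_pres P) (free_pres P)"
  show "?t = (sharp_TenO C P P, free_tensor C \<A> P P, bimod_TenO C \<A> (free_bimod C \<A> P) (free_bimod C \<A> P))"
    using tensor_pres_free_tensor[OF assms assms] by (intro prod_eqI) simp_all
  obtain V l r where F: "free_bimod C \<A> P = (V, l, r)" by (metis prod.exhaust)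
  have "presents ((X, \<psi>), Idn C (A \<otimes> X), (V, l, r))"
    using presents_free_pres[OF assms] unfolding F unfolding P by simp
  from bimod_proj_presented(2,4)[OF this this] tensor_pres_free_tensor[OF assms assms]
  show "is_iso C (free_tensor C \<A> P P)" "Dom C (free_tensor C \<A> P P) = A \<otimes> fst P \<otimes> fst P"
    unfolding F unfolding P by simp_all
qed

lemma presents_free_tensor:
  assumes "sharp_obj C \<A> P"
  shows "presents (sharp_TenO C P P, free_tensor C \<A> P P, bimod_TenO C \<A> (free_bimod C \<A> P) (free_bimod C \<A> P))"
  using presents_tensor_pres[OF presents_free_pres[OF assms] presents_free_pres[OF assms]]
  unfolding free_pres_TenO(1)[OF assms] .

text \<open>The structure arrows in \<open>ring_of\<close> are chosen so that they are represented by those of the algebra: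
  the isomorphism \<open>free_tensor C \<A> P P\<close> is the presentation of the tensor square.\<close>
lemma represents_ring_of:
  assumes P: "sharp_obj C \<A> P"
    and \<mu>: "sharp_typed (sharp_TenO C P P, \<mu>, P)" and \<eta>: "sharp_typed ((\<I>, Idn C A), \<eta>, P)"
  shows "represents (tensor_pres (free_pres P) (free_pres P)) (free_pres P) (sharp_TenO C P P, \<mu>, P)
      (fst (snd (ring_of (P, (sharp_TenO C P P, \<mu>, P), ((\<I>, Idn C A), \<eta>, P)))))"
    and "represents unit_pres (free_pres P) ((\<I>, Idn C A), \<eta>, P)
      (snd (snd (ring_of (P, (sharp_TenO C P P, \<mu>, P), ((\<I>, Idn C A), \<eta>, P)))))"
proof -
  obtain X \<psi> where e: "P = (X, \<psi>)" by (cases P)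
  have X: "X \<in> Obj C" using P by (simp add: e)
  note t = free_pres_TenO[OF P]
  have \<mu>t: "\<mu> \<in> Arr C" "Dom C \<mu> = X \<otimes> X" "Cod C \<mu> = A \<otimes> X" and \<eta>t: "\<eta> \<in> Arr C" "Dom C \<eta> = \<I>" "Cod C \<eta> = A \<otimes> X"
    using \<mu> \<eta> by (auto simp: e)
  note pt = presents_free_tensor[OF P]
  obtain t' where t': "free_tensor C \<A> P P \<in> Arr C" "t' \<in> Arr C" "Dom C t' = Cod C (free_tensor C \<A> P P)"
     "Cod C t' = A \<otimes> X \<otimes> X" "t' \<cdot> free_tensor C \<A> P P = Idn C (A \<otimes> X \<otimes> X)"
    using iso_inverse[OF t(2)] t(3) by (metis e fst_conv)
  let ?k = "ext \<mu> X \<cdot> t'"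
  have kt: "?k \<cdot> free_tensor C \<A> P P = ext \<mu> X"
    using t' \<mu>t X t(3) by (simp add: e del: free_tensor.simps)
  have "factor C (free_tensor C \<A> P P) (?k \<cdot> free_tensor C \<A> P P) = ?k"
    by (rule factor_iso[OF t(2)]) (use t' \<mu>t X in simp_all)
  then have k: "factor C (free_tensor C \<A> P P) (ext \<mu> X) = ?k"
    unfolding kt .
  have k': "factor C (free_tensor C \<A> P P) (free_arr C \<A> (sharp_TenO C P P, \<mu>, P)) = ?k"
    using k unfolding e ext_def free_arr.simps .
  have kt': "?k \<cdot> free_tensor C \<A> P P = Idn C (A \<otimes> X) \<cdot> ext \<mu> X"
    unfolding kt using \<mu>t X by simp
  have "represents (sharp_TenO C P P, free_tensor C \<A> P P, bimod_TenO C \<A> (free_bimod C \<A> P) (free_bimod C \<A> P))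
      (free_pres P) (sharp_TenO C P P, \<mu>, P)
      (bimod_TenO C \<A> (free_bimod C \<A> P) (free_bimod C \<A> P), ?k, free_bimod C \<A> P)"
    using pt presents_free_pres[OF P] unfolding e fst_conv sharp_TenO.simps
    by (rule represents_ext[OF _ _ _ _ _ _ kt'[unfolded e]])
      (use t' \<mu>t X in \<open>simp_all add: hom_iff e del: free_tensor.simps\<close>)
  then show "represents (tensor_pres (free_pres P) (free_pres P)) (free_pres P) (sharp_TenO C P P, \<mu>, P)
      (fst (snd (ring_of (P, (sharp_TenO C P P, \<mu>, P), ((\<I>, Idn C A), \<eta>, P)))))"
    unfolding t(1) ring_of.simps Let_def fst_conv snd_conv k' .
  have f: "ext \<eta> X \<cdot> Idn C A = Idn C (A \<otimes> X) \<cdot> ext \<eta> X"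
    using \<eta>t X by simp
  have "represents unit_pres (free_pres P) ((\<I>, Idn C A), \<eta>, P) ((A, m, m), ext \<eta> X, free_bimod C \<A> P)"
    using presents_unit presents_free_pres[OF P] unfolding e fst_conv
    by (rule represents_ext[OF _ _ _ _ _ _ f]) (use \<eta>t X in \<open>simp_all add: hom_iff\<close>)
  then show "represents unit_pres (free_pres P) ((\<I>, Idn C A), \<eta>, P)
      (snd (snd (ring_of (P, (sharp_TenO C P P, \<mu>, P), ((\<I>, Idn C A), \<eta>, P)))))"
    unfolding ring_of.simps Let_def fst_conv snd_conv ext_def unfolding e free_arr.simps .
qed

lemma represents_coring_of:
  assumes P: "sharp_obj C \<A> P"
    and \<delta>: "sharp_typed (P, \<delta>, sharp_TenO C P P)" and \<epsilon>: "sharp_typed (P, \<epsilon>, (\<I>, Idn C A))"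
  shows "represents (free_pres P) (tensor_pres (free_pres P) (free_pres P)) (P, \<delta>, sharp_TenO C P P)
      (fst (snd (coring_of (P, (P, \<delta>, sharp_TenO C P P), (P, \<epsilon>, (\<I>, Idn C A))))))"
    and "represents (free_pres P) unit_pres (P, \<epsilon>, (\<I>, Idn C A))
      (snd (snd (coring_of (P, (P, \<delta>, sharp_TenO C P P), (P, \<epsilon>, (\<I>, Idn C A))))))"
proof -
  obtain X \<psi> where e: "P = (X, \<psi>)" by (cases P)
  have X: "X \<in> Obj C" using P by (simp add: e)
  note t = free_pres_TenO[OF P]
  have \<delta>t: "\<delta> \<in> Arr C" "Dom C \<delta> = X" "Cod C \<delta> = A \<otimes> X \<otimes> X" and \<epsilon>t: "\<epsilon> \<in> Arr C" "Dom C \<epsilon> = X" "Cod C \<epsilon> = A"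
    using \<delta> \<epsilon> by (auto simp: e)
  note pt = presents_free_tensor[OF P]
  have ta: "free_tensor C \<A> P P \<in> Arr C"
    using t(2) by (simp add: is_iso_def)
  let ?k = "free_tensor C \<A> P P \<cdot> ext \<delta> (X \<otimes> X)"
  have k: "?k \<cdot> Idn C (A \<otimes> X) = free_tensor C \<A> P P \<cdot> ext \<delta> (X \<otimes> X)"
    using \<delta>t X t(3) ta by (simp add: e del: free_tensor.simps)
  have "represents (free_pres P) (sharp_TenO C P P, free_tensor C \<A> P P, bimod_TenO C \<A> (free_bimod C \<A> P) (free_bimod C \<A> P))
      (P, \<delta>, sharp_TenO C P P)
      (free_bimod C \<A> P, ?k, bimod_TenO C \<A> (free_bimod C \<A> P) (free_bimod C \<A> P))"
    using presents_free_pres[OF P] pt unfolding e fst_conv sharp_TenO.simps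
    by (rule represents_ext[OF _ _ _ _ _ _ k[unfolded e]])
      (use \<delta>t X t(3) ta in \<open>simp_all add: hom_iff e del: free_tensor.simps\<close>)
  then show "represents (free_pres P) (tensor_pres (free_pres P) (free_pres P)) (P, \<delta>, sharp_TenO C P P)
      (fst (snd (coring_of (P, (P, \<delta>, sharp_TenO C P P), (P, \<epsilon>, (\<I>, Idn C A))))))"
    unfolding t(1) coring_of.simps Let_def fst_conv snd_conv ext_def unfolding e sharp_TenO.simps free_arr.simps .
  have f: "ext \<epsilon> \<I> \<cdot> Idn C (A \<otimes> X) = Idn C A \<cdot> ext \<epsilon> \<I>"
    using \<epsilon>t X by simp
  have "represents (free_pres P) unit_pres (P, \<epsilon>, (\<I>, Idn C A)) (free_bimod C \<A> P, ext \<epsilon> \<I>, (A, m, m))"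
    using presents_free_pres[OF P] presents_unit unfolding e fst_conv
    by (rule represents_ext[OF _ _ _ _ _ _ f]) (use \<epsilon>t X in \<open>simp_all add: hom_iff\<close>)
  then show "represents (free_pres P) unit_pres (P, \<epsilon>, (\<I>, Idn C A))
      (snd (snd (coring_of (P, (P, \<delta>, sharp_TenO C P P), (P, \<epsilon>, (\<I>, Idn C A))))))"
    unfolding coring_of.simps Let_def fst_conv snd_conv ext_def unfolding e free_arr.simps .
qed

lemma free_bimod_inject:
  assumes "free_bimod C \<A> (X, \<psi>) = free_bimod C \<A> (X, \<psi>')" "sharp_obj C \<A> (X, \<psi>)" "sharp_obj C \<A> (X, \<psi>')"
  shows "\<psi> = \<psi>'"
proof (rule ext_inject)
  show "ext \<psi> X = ext \<psi>' X"
    using assms(1) by (simp add: ext_def)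
qed (use assms in \<open>auto simp: hom_iff\<close>)

text \<open>The common argument for rings and corings. The presentations \<open>p\<^sub>1\<close>, \<open>q\<^sub>1\<close> are those of source and
  target of the (co)multiplication, \<open>p\<^sub>2\<close>, \<open>q\<^sub>2\<close> those of the (co)unit. Injectivity and surjectivity
  come from the one-to-one nature of representation, on objects from \<open>free_bimod_inject\<close> and
  \<open>bimodule_free_bimod\<close>.\<close>
lemma bij_structures:
  assumes X: "X \<in> Obj C"
    and G: "\<And>P \<mu> \<eta>. Alg (P, \<mu>, \<eta>) \<Longrightarrow> sharp_obj C \<A> P \<and> (\<exists>M E. G (P, \<mu>, \<eta>) = (free_bimod C \<A> P, M, E) \<and>
        represents (p\<^sub>1 P) (q\<^sub>1 P) \<mu> M \<and> represents (p\<^sub>2 P) (q\<^sub>2 P) \<eta> E)"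
    and S: "\<And>P \<mu> \<eta> M E. \<lbrakk>sharp_obj C \<A> P; fst P = X; represents (p\<^sub>1 P) (q\<^sub>1 P) \<mu> M;
        represents (p\<^sub>2 P) (q\<^sub>2 P) \<eta> E\<rbrakk> \<Longrightarrow> Alg (P, \<mu>, \<eta>) \<longleftrightarrow> St (free_bimod C \<A> P, M, E)"
    and onto: "\<And>P M E. \<lbrakk>sharp_obj C \<A> P; St (free_bimod C \<A> P, M, E)\<rbrakk> \<Longrightarrow>
        \<exists>\<mu> \<eta>. represents (p\<^sub>1 P) (q\<^sub>1 P) \<mu> M \<and> represents (p\<^sub>2 P) (q\<^sub>2 P) \<eta> E"
    and obj: "\<And>B M E. St (B, M, E) \<Longrightarrow> bimodule C \<A> B"
  shows "bij_betw G {\<X>. Alg \<X> \<and> fst (fst \<X>) = X} {R. St R \<and> (\<exists>r M E. R = ((A \<otimes> X, m \<boxtimes> Idn C X, r), M, E))}"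
    (is "bij_betw G ?S ?T")
  unfolding bij_betw_def
proof (intro conjI inj_onI set_eqI iffI)
  fix \<X> \<Y> assume a: "\<X> \<in> ?S" "\<Y> \<in> ?S" and eq: "G \<X> = G \<Y>"
  obtain \<psi> \<mu> \<eta> where x: "\<X> = ((X, \<psi>), \<mu>, \<eta>)" "Alg ((X, \<psi>), \<mu>, \<eta>)"
    using a(1) by (cases \<X>) auto
  obtain \<psi>' \<mu>' \<eta>' where y: "\<Y> = ((X, \<psi>'), \<mu>', \<eta>')" "Alg ((X, \<psi>'), \<mu>', \<eta>')"
    using a(2) by (cases \<Y>) auto
  obtain M E where g: "sharp_obj C \<A> (X, \<psi>)" "G \<X> = (free_bimod C \<A> (X, \<psi>), M, E)"
    "represents (p\<^sub>1 (X, \<psi>)) (q\<^sub>1 (X, \<psi>)) \<mu> M" "represents (p\<^sub>2 (X, \<psi>)) (q\<^sub>2 (X, \<psi>)) \<eta> E"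
    using G[OF x(2)] unfolding x(1) by blast
  obtain M' E' where h: "sharp_obj C \<A> (X, \<psi>')" "G \<Y> = (free_bimod C \<A> (X, \<psi>'), M', E')"
    "represents (p\<^sub>1 (X, \<psi>')) (q\<^sub>1 (X, \<psi>')) \<mu>' M'" "represents (p\<^sub>2 (X, \<psi>')) (q\<^sub>2 (X, \<psi>')) \<eta>' E'"
    using G[OF y(2)] unfolding y(1) by blast
  have e: "free_bimod C \<A> (X, \<psi>) = free_bimod C \<A> (X, \<psi>')" "M = M'" "E = E'"
    using eq unfolding g(2) h(2) by (simp_all only: prod.inject)
  have \<psi>: "\<psi> = \<psi>'"
    using e(1) g(1) h(1) by (rule free_bimod_inject)
  show "\<X> = \<Y>"
    using represents_unique[OF g(3) h(3)[folded \<psi>]] represents_unique[OF g(4) h(4)[folded \<psi>]] e(2,3) \<psi>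
    unfolding x(1) y(1) by blast
next
  fix R assume "R \<in> G ` ?S"
  then obtain \<X> where R: "R = G \<X>" and a: "\<X> \<in> ?S" by blast
  obtain \<psi> \<mu> \<eta> where x: "\<X> = ((X, \<psi>), \<mu>, \<eta>)" "Alg ((X, \<psi>), \<mu>, \<eta>)"
    using a by (cases \<X>) auto
  obtain M E where g: "sharp_obj C \<A> (X, \<psi>)" "G \<X> = (free_bimod C \<A> (X, \<psi>), M, E)"
    "represents (p\<^sub>1 (X, \<psi>)) (q\<^sub>1 (X, \<psi>)) \<mu> M" "represents (p\<^sub>2 (X, \<psi>)) (q\<^sub>2 (X, \<psi>)) \<eta> E"
    using G[OF x(2)] unfolding x(1) by blast
  have "St R"
    using S[OF g(1) _ g(3,4)] x(2) unfolding R g(2) by simp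
  then show "R \<in> ?T"
    unfolding R g(2) free_bimod.simps by blast
next
  fix R assume "R \<in> ?T"
  then obtain r M E where R: "R = ((A \<otimes> X, m \<boxtimes> Idn C X, r), M, E)" and St: "St R" by blast
  obtain \<psi> where P: "sharp_obj C \<A> (X, \<psi>)" and F: "free_bimod C \<A> (X, \<psi>) = (A \<otimes> X, m \<boxtimes> Idn C X, r)"
    using bimodule_free_bimod[OF obj[OF St[unfolded R]] X] by blast
  have R': "R = (free_bimod C \<A> (X, \<psi>), M, E)"
    unfolding R F ..
  obtain \<mu> \<eta> where rep: "represents (p\<^sub>1 (X, \<psi>)) (q\<^sub>1 (X, \<psi>)) \<mu> M" "represents (p\<^sub>2 (X, \<psi>)) (q\<^sub>2 (X, \<psi>)) \<eta> E"
    using onto[OF P St[unfolded R']] by blast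
  have a: "Alg ((X, \<psi>), \<mu>, \<eta>)"
    using S[OF P _ rep] St unfolding R' by simp
  obtain M' E' where g: "G ((X, \<psi>), \<mu>, \<eta>) = (free_bimod C \<A> (X, \<psi>), M', E')"
    "represents (p\<^sub>1 (X, \<psi>)) (q\<^sub>1 (X, \<psi>)) \<mu> M'" "represents (p\<^sub>2 (X, \<psi>)) (q\<^sub>2 (X, \<psi>)) \<eta> E'"
    using G[OF a] by blast
  have "M' = M" "E' = E"
    using represents_unique[OF g(2) rep(1)] represents_unique[OF g(3) rep(2)] by blast+
  then have "R = G ((X, \<psi>), \<mu>, \<eta>)"
    unfolding R' g(1) by simp
  then show "R \<in> G ` ?S"
    using a by (intro image_eqI[of _ _ "((X, \<psi>), \<mu>, \<eta>)"]) simp_all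
qed

lemma bij_ring_of:
  assumes coflat: "left_coflat C A" "left_coflat C X"
  shows "bij_betw ring_of {\<X>. algebra_in (sharp C \<A>) \<X> \<and> fst (fst \<X>) = X} (ring_structures C \<A> X)"
  unfolding ring_structures.simps
proof (rule bij_structures)
  show "X \<in> Obj C" using coflat by (simp add: left_coflat_def)
next
  fix P \<mu> \<eta> assume a: "algebra_in (sharp C \<A>) (P, \<mu>, \<eta>)"
  have P: "sharp_obj C \<A> P" and ends: "sharp_arr C \<A> \<mu>" "fst \<mu> = sharp_TenO C P P" "snd (snd \<mu>) = P"
    "sharp_arr C \<A> \<eta>" "fst \<eta> = (\<I>, Idn C A)" "snd (snd \<eta>) = P"
    using a unfolding algebra_in.simps coalgebra_in.simps sharp_simps mem_Collect_eq fst_conv by blast+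
  obtain \<mu>0 \<eta>0 where e: "\<mu> = (sharp_TenO C P P, \<mu>0, P)" "\<eta> = ((\<I>, Idn C A), \<eta>0, P)"
    using ends by (metis prod.collapse)
  note represents_ring_of[OF P sharp_typed_arr[OF ends(1)[unfolded e]] sharp_typed_arr[OF ends(4)[unfolded e]], folded e]
  moreover have "ring_of (P, \<mu>, \<eta>) = (free_bimod C \<A> P, fst (snd (ring_of (P, \<mu>, \<eta>))), snd (snd (ring_of (P, \<mu>, \<eta>))))"
    by (simp add: Let_def)
  ultimately show "sharp_obj C \<A> P \<and> (\<exists>M E. ring_of (P, \<mu>, \<eta>) = (free_bimod C \<A> P, M, E) \<and>
        represents (tensor_pres (free_pres P) (free_pres P)) (free_pres P) \<mu> M \<and> represents unit_pres (free_pres P) \<eta> E)"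
    using P by blast
next
  fix P \<mu> \<eta> M E assume P: "sharp_obj C \<A> P" "fst P = X"
    "represents (tensor_pres (free_pres P) (free_pres P)) (free_pres P) \<mu> M" "represents unit_pres (free_pres P) \<eta> E"
  show "algebra_in (sharp C \<A>) (P, \<mu>, \<eta>) \<longleftrightarrow> A_ring C \<A> (free_bimod C \<A> P, M, E)"
    using algebra_presented[OF presents_free_pres[OF P(1)] coflat(1) _ P(3,4)] coflat(2) P(2)
    unfolding A_ring_def by simp
next
  fix P M E assume P: "sharp_obj C \<A> P" and "A_ring C \<A> (free_bimod C \<A> P, M, E)"
  then have M: "bimod_arr C \<A> M" "fst M = bimod_TenO C \<A> (free_bimod C \<A> P) (free_bimod C \<A> P)" "snd (snd M) = free_bimod C \<A> P"
    and E: "bimod_arr C \<A> E" "fst E = (A, m, m)" "snd (snd E) = free_bimod C \<A> P"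
    unfolding A_ring_def algebra_in.simps bimod_cat_simps mem_Collect_eq regular_bimod.simps by blast+
  obtain M0 E0 where e: "M = (bimod_TenO C \<A> (free_bimod C \<A> P) (free_bimod C \<A> P), M0, free_bimod C \<A> P)"
      "E = ((A, m, m), E0, free_bimod C \<A> P)"
    using M(2,3) E(2,3) by (metis prod.collapse)
  obtain \<mu>0 where "represents (tensor_pres (free_pres P) (free_pres P)) (free_pres P) (sharp_TenO C P P, \<mu>0, P) M"
    unfolding e free_pres_TenO(1)[OF P]
    by (rule represents_onto[OF presents_free_tensor[OF P] presents_free_pres[OF P] M(1)[unfolded e]])
  moreover obtain \<eta>0 where "represents unit_pres (free_pres P) ((\<I>, Idn C A), \<eta>0, P) E"
    unfolding e by (rule represents_onto[OF presents_unit presents_free_pres[OF P] E(1)[unfolded e]])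
  ultimately show "\<exists>\<mu> \<eta>. represents (tensor_pres (free_pres P) (free_pres P)) (free_pres P) \<mu> M \<and> represents unit_pres (free_pres P) \<eta> E"
    by blast
next
  fix B M E assume "A_ring C \<A> (B, M, E)"
  then have "bimod_obj C \<A> B"
    unfolding A_ring_def algebra_in.simps bimod_cat_simps mem_Collect_eq by blast
  then show "bimodule C \<A> B"
    by (cases B) (simp del: bimodule.simps)
qed

lemma bij_coring_of:
  assumes coflat: "left_coflat C A" "left_coflat C X"
  shows "bij_betw coring_of {\<X>. coalgebra_in (sharp C \<A>) \<X> \<and> fst (fst \<X>) = X} (coring_structures C \<A> X)"
  unfolding coring_structures.simps
proof (rule bij_structures)
  show "X \<in> Obj C" using coflat by (simp add: left_coflat_def)
next
  fix P \<delta> \<epsilon> assume a: "coalgebra_in (sharp C \<A>) (P, \<delta>, \<epsilon>)"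
  have P: "sharp_obj C \<A> P" and ends: "sharp_arr C \<A> \<delta>" "fst \<delta> = P" "snd (snd \<delta>) = sharp_TenO C P P"
    "sharp_arr C \<A> \<epsilon>" "fst \<epsilon> = P" "snd (snd \<epsilon>) = (\<I>, Idn C A)"
    using a unfolding algebra_in.simps coalgebra_in.simps sharp_simps mem_Collect_eq fst_conv by blast+
  obtain \<delta>0 \<epsilon>0 where e: "\<delta> = (P, \<delta>0, sharp_TenO C P P)" "\<epsilon> = (P, \<epsilon>0, (\<I>, Idn C A))"
    using ends by (metis prod.collapse)
  note represents_coring_of[OF P sharp_typed_arr[OF ends(1)[unfolded e]] sharp_typed_arr[OF ends(4)[unfolded e]], folded e]
  moreover have "coring_of (P, \<delta>, \<epsilon>) = (free_bimod C \<A> P, fst (snd (coring_of (P, \<delta>, \<epsilon>))), snd (snd (coring_of (P, \<delta>, \<epsilon>))))"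
    by (simp add: Let_def)
  ultimately show "sharp_obj C \<A> P \<and> (\<exists>D E. coring_of (P, \<delta>, \<epsilon>) = (free_bimod C \<A> P, D, E) \<and>
        represents (free_pres P) (tensor_pres (free_pres P) (free_pres P)) \<delta> D \<and> represents (free_pres P) unit_pres \<epsilon> E)"
    using P by blast
next
  fix P \<delta> \<epsilon> D E assume P: "sharp_obj C \<A> P" "fst P = X"
    "represents (free_pres P) (tensor_pres (free_pres P) (free_pres P)) \<delta> D" "represents (free_pres P) unit_pres \<epsilon> E"
  show "coalgebra_in (sharp C \<A>) (P, \<delta>, \<epsilon>) \<longleftrightarrow> A_coring C \<A> (free_bimod C \<A> P, D, E)"
    using coalgebra_presented[OF presents_free_pres[OF P(1)] coflat(1) _ P(3,4)] coflat(2) P(2)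
    unfolding A_coring_def by simp
next
  fix P D E assume P: "sharp_obj C \<A> P" and "A_coring C \<A> (free_bimod C \<A> P, D, E)"
  then have D: "bimod_arr C \<A> D" "fst D = free_bimod C \<A> P" "snd (snd D) = bimod_TenO C \<A> (free_bimod C \<A> P) (free_bimod C \<A> P)"
    and E: "bimod_arr C \<A> E" "fst E = free_bimod C \<A> P" "snd (snd E) = (A, m, m)"
    unfolding A_coring_def coalgebra_in.simps bimod_cat_simps mem_Collect_eq regular_bimod.simps by blast+
  obtain D0 E0 where e: "D = (free_bimod C \<A> P, D0, bimod_TenO C \<A> (free_bimod C \<A> P) (free_bimod C \<A> P))"
      "E = (free_bimod C \<A> P, E0, (A, m, m))"
    using D(2,3) E(2,3) by (metis prod.collapse)
  obtain \<delta>0 where "represents (free_pres P) (tensor_pres (free_pres P) (free_pres P)) (P, \<delta>0, sharp_TenO C P P) D"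
    unfolding e free_pres_TenO(1)[OF P]
    by (rule represents_onto[OF presents_free_pres[OF P] presents_free_tensor[OF P] D(1)[unfolded e]])
  moreover obtain \<epsilon>0 where "represents (free_pres P) unit_pres (P, \<epsilon>0, (\<I>, Idn C A)) E"
    unfolding e by (rule represents_onto[OF presents_free_pres[OF P] presents_unit E(1)[unfolded e]])
  ultimately show "\<exists>\<delta> \<epsilon>. represents (free_pres P) (tensor_pres (free_pres P) (free_pres P)) \<delta> D \<and> represents (free_pres P) unit_pres \<epsilon> E"
    by blast
next
  fix B D E assume "A_coring C \<A> (B, D, E)"
  then have "bimod_obj C \<A> B"
    unfolding A_coring_def coalgebra_in.simps bimod_cat_simps mem_Collect_eq by blast
  then show "bimodule C \<A> B"
    by (cases B) (simp del: bimodule.simps)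
qed

end

lemma bij_betw_restrict:
  assumes "bij_betw f S T"
  shows "bij_betw f {s \<in> S. f s \<in> U} (T \<inter> U)"
  using assms by (auto simp: bij_betw_def inj_on_def)

theorem proposition4p1:
  fixes C :: "('o, 'a) moncat"
  assumes "strict_monoidal_category C"
    and "has_coequalizers C"
  shows "bij_betw wreath_to_pair
           {W. wreath (one_object C) W}
           {(\<A>, \<X>). algebra_in C \<A> \<and> algebra_in (sharp C \<A>) \<X>}
       \<and> bij_betw wreath_to_pair
           {W. cowreath (one_object C) W}
           {(\<A>, \<X>). algebra_in C \<A> \<and> coalgebra_in (sharp C \<A>) \<X>}
       \<and> (\<forall>A m u X. algebra_in C (A, m, u) \<and> left_coflat C A \<and> left_coflat C X \<longrightarrow>
            bij_betw (wreath_to_ring C)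
              (wreath_structures C (A, m, u) X) (ring_structures C (A, m, u) X)
          \<and> bij_betw (cowreath_to_coring C)
              (cowreath_structures C (A, m, u) X) (coring_structures C (A, m, u) X))"
proof (intro conjI allI impI)
  interpret strict_monoidal_category C by fact
  show w: "bij_betw wreath_to_pair {W. wreath (one_object C) W}
      {(\<A>, \<X>). algebra_in C \<A> \<and> algebra_in (sharp C \<A>) \<X>}"
    by (rule wreath_bij_algebra)
  show c: "bij_betw wreath_to_pair {W. cowreath (one_object C) W}
      {(\<A>, \<X>). algebra_in C \<A> \<and> coalgebra_in (sharp C \<A>) \<X>}"
    by (rule cowreath_bij_coalgebra)
  fix A m u X
  assume a: "algebra_in C (A, m, u) \<and> left_coflat C A \<and> left_coflat C X"
  interpret strict_algebra_coequalizers C A m u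
    using a assms(2) by unfold_locales blast+
  \<comment> \<open>The structures on a fixed \<open>A \<otimes> X\<close> come from restricting the first two bijections to the pairs over
    \<open>(A, m, u)\<close> and \<open>X\<close>.\<close>
  let ?U = "{(\<A>', \<X>). \<A>' = (A, m, u) \<and> fst (fst \<X>) = X}"
  have mem: "wreath_to_pair W \<in> ?U \<longleftrightarrow> (\<exists>\<psi> \<mu> \<eta>. wreath_to_pair W = ((A, m, u), ((X, \<psi>), \<mu>, \<eta>)))" for W :: "('o, 'a) cwreath"
    by (cases "wreath_to_pair W"; cases "fst (snd (wreath_to_pair W))") auto
  have ws: "{W \<in> {W. wreath (one_object C) W}. wreath_to_pair W \<in> ?U} = wreath_structures C (A, m, u) X"
    and cs: "{W \<in> {W. cowreath (one_object C) W}. wreath_to_pair W \<in> ?U} = cowreath_structures C (A, m, u) X"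
    unfolding wreath_structures_def cowreath_structures_def mem by blast+
  have snd: "bij_betw snd ({(\<A>', \<X>). algebra_in C \<A>' \<and> Q \<A>' \<X>} \<inter> ?U) {\<X>. Q (A, m, u) \<X> \<and> fst (fst \<X>) = X}" for Q
    by (rule bij_betw_byWitness[of _ "\<lambda>\<X>. ((A, m, u), \<X>)"]) (use algebra in \<open>auto simp del: algebra_in.simps\<close>)
  have "bij_betw (ring_of \<circ> (snd \<circ> wreath_to_pair)) (wreath_structures C (A, m, u) X) (ring_structures C (A, m, u) X)"
    using bij_betw_trans[OF bij_betw_trans[OF bij_betw_restrict[OF w, of ?U, unfolded ws] snd] bij_ring_of] a
    by blast
  moreover have "wreath_to_ring C W = (ring_of \<circ> (snd \<circ> wreath_to_pair)) W" if "W \<in> wreath_structures C (A, m, u) X" for W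
    using that by (auto simp: wreath_structures_def wreath_to_ring_def Let_def)
  ultimately show "bij_betw (wreath_to_ring C) (wreath_structures C (A, m, u) X) (ring_structures C (A, m, u) X)"
    by (simp cong: bij_betw_cong)
  have "bij_betw (coring_of \<circ> (snd \<circ> wreath_to_pair)) (cowreath_structures C (A, m, u) X) (coring_structures C (A, m, u) X)"
    using bij_betw_trans[OF bij_betw_trans[OF bij_betw_restrict[OF c, of ?U, unfolded cs] snd] bij_coring_of] a
    by blast
  moreover have "cowreath_to_coring C W = (coring_of \<circ> (snd \<circ> wreath_to_pair)) W" if "W \<in> cowreath_structures C (A, m, u) X" for W
    using that by (auto simp: cowreath_structures_def cowreath_to_coring_def Let_def)
  ultimately show "bij_betw (cowreath_to_coring C) (cowreath_structures C (A, m, u) X) (coring_structures C (A, m, u) X)"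
    by (simp cong: bij_betw_cong)
qed

end
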